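(* Let $n\ge1$ be a natural number and let $c<-1/4$ be a real number. Consider the perturbed system $$\dot x=y+x^{2n}+\varepsilon\,Q(x,y,\varepsilon),\qquad \dot y=2nc\,x^{4n-1}-\varepsilon\,P(x,y,\varepsilon),$$ where $|\varepsilon|>0$ is a small parameter, $P(x,y,\varepsilon)$ and $Q(x,y,\varepsilon)$ are real polynomials in $(x,y)$ depending analytically on $\varepsilon$, and $P(x,y,0)$, $Q(x,y,0)$ are polynomials of degree at most $4n-1$. Let $$M_1(h)=\oint_{\gamma_h}\frac{P(x,y,0)\,dx+Q(x,y,0)\,dy}{V(x,y)}$$ be the first Poincaré-Pontryagin-Melnikov function, where $\{\gamma_h\}_h$ is the continuous family of periodic orbits of the unperturbed system ($\varepsilon=0$) surrounding the center at the origin and $V(x,y)=y^2+x^{2n}y-c\,x^{4n}$. Suppose that $M_1(h)$ is not identically zero. Then: (a) the perturbed system has at most $n(3n+1)-1$ limit cycles which tend to periodic orbits of the unperturbed system as $\varepsilon$ tends to zero; (b) for suitable polynomials $P(x,y,0)$, $Q(x,y,0)$ (of degree at most $4n-1$), and for all sufficiently small $|\varepsilon|>0$, the perturbed system has at least $n(2n+1)-1$ limit cycles which tend to periodic orbits of the unperturbed system as $\varepsilon$ tends to zero.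
   Context: The unperturbed system $\dot x=y+x^{2n}$, $\dot y=2nc\,x^{4n-1}$ with $c<-1/4$ has a global center at the origin (every orbit in $\mathbb{R}^2\setminus\{(0,0)\}$ is periodic). It has the first integral $$H=(y+\mu_+x^{2n})^{1-1/\sqrt{1+4c}}\,(y+\mu_-x^{2n})^{1+1/\sqrt{1+4c}},\qquad \mu_\pm=\frac{1\pm\sqrt{1+4c}}{2},$$ where $\sqrt{1+4c}$ is purely imaginary. Explicitly, with $s=\sqrt{-(1+4c)}>0$, $\sqrt{1+4c}=is$ and $w=y+\mu_+x^{2n}$, $\arg w\in[0,\pi]$, one has $H=|w|^2e^{-2\arg(w)/s}>0$ on $\mathbb{R}^2\setminus\{(0,0)\}$. For $h>0$, $\gamma_h=\{H=h\}$ is the corresponding periodic orbit, oriented by the flow (clockwise). The function $V$ is an inverse integrating factor of the unperturbed system and is positive on $\mathbb{R}^2\setminus\{(0,0)\}$. Limit cycles tending to periodic orbits: parametrize a cross-section such as $\{(x,0):x>0\}$ and let $\Pi_\varepsilon$ be the first return map of the perturbed system, which is defined and analytic near any given compact subset $K$ of the cross-section for $|\varepsilon|$ small enough. "At most $N$ limit cycles which tend to periodic orbits as $\varepsilon\to0$" means that for every such compact $K$ there is $\varepsilon_0>0$ such that for $0<|\varepsilon|<\varepsilon_0$ the map $\Pi_\varepsilon$ has at most $N$ fixed points in $K$ corresponding to limit cycles. "At least $N$ limit cycles which tend to periodic orbits" means that for all sufficiently small $|\varepsilon|>0$ there exist $N$ distinct limit cycles, each converging to a periodic orbit of the unperturbed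 system as $\varepsilon\to0$. *)

theory Defs
  imports "HOL-Analysis.Analysis" "HOL-Computational_Algebra.Polynomial"
begin

type_synonym plane = "real \<times> real"

subsection \<open>Bivariate polynomials depending analytically on a parameter\<close>

text \<open>A polynomial in \<open>x, y\<close> is a \<^typ>\<open>real poly poly\<close>; the coefficient of
  \<open>x ^ i * y ^ j\<close> is \<open>coeff (coeff p j) i\<close>.\<close>

definition bieval :: "real poly poly \<Rightarrow> plane \<Rightarrow> real" where
  "bieval p z = poly (poly p [:snd z:]) (fst z)"

definition total_degree_le :: "nat \<Rightarrow> real poly poly \<Rightarrow> bool" where
  "total_degree_le d p \<longleftrightarrow> (\<forall>i j. coeff (coeff p j) i \<noteq> 0 \<longrightarrow> i + j \<le> d)"

text \<open>Every coefficient is a real analytic function of the parameter near 0, and the degrees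
  are bounded near 0. The values of the family away from 0 are irrelevant.\<close>

definition analytic_poly_family :: "(real \<Rightarrow> real poly poly) \<Rightarrow> bool" where
  "analytic_poly_family P \<longleftrightarrow>
     (\<forall>i j. \<exists>F. (\<lambda>e. coeff (coeff (P e) j) i) has_fps_expansion F) \<and>
     (\<exists>d. \<forall>\<^sub>F e in nhds 0. total_degree_le d (P e))"

definition admissible_perturbation ::
    "nat \<Rightarrow> (real \<Rightarrow> real poly poly) \<Rightarrow> (real \<Rightarrow> real poly poly) \<Rightarrow> bool" where
  "admissible_perturbation n P Q \<longleftrightarrow>
     analytic_poly_family P \<and> analytic_poly_family Q \<and>
     total_degree_le (4 * n - 1) (P 0) \<and> total_degree_le (4 * n - 1) (Q 0)"

subsection \<open>Planar vector fields, periodic orbits and limit cycles\<close>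

definition solution_on :: "(plane \<Rightarrow> plane) \<Rightarrow> (real \<Rightarrow> plane) \<Rightarrow> real set \<Rightarrow> bool" where
  "solution_on X \<phi> I \<longleftrightarrow>
     (\<forall>t\<in>I. (\<phi> has_vector_derivative X (\<phi> t)) (at t within I))"

definition periodic_orbit :: "(plane \<Rightarrow> plane) \<Rightarrow> plane set \<Rightarrow> bool" where
  "periodic_orbit X \<gamma> \<longleftrightarrow>
     (\<exists>\<phi> T. 0 < T \<and> solution_on X \<phi> UNIV \<and> (\<forall>t. \<phi> (t + T) = \<phi> t) \<and>
            \<not> \<phi> constant_on UNIV \<and> \<gamma> = range \<phi>)"

definition limit_cycle :: "(plane \<Rightarrow> plane) \<Rightarrow> plane set \<Rightarrow> bool" where
  "limit_cycle X \<gamma> \<longleftrightarrow>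
     periodic_orbit X \<gamma> \<and>
     (\<exists>U. open U \<and> \<gamma> \<subseteq> U \<and> (\<forall>\<gamma>'. periodic_orbit X \<gamma>' \<and> \<gamma>' \<subseteq> U \<longrightarrow> \<gamma>' = \<gamma>))"

text \<open>The graph of the (partial) first return map to a cross-section \<open>S\<close>.\<close>

definition first_return ::
    "(plane \<Rightarrow> plane) \<Rightarrow> plane set \<Rightarrow> plane \<Rightarrow> plane \<Rightarrow> bool" where
  "first_return X S p q \<longleftrightarrow> p \<in> S \<and> q \<in> S \<and>
     (\<exists>\<phi> T. 0 < T \<and> solution_on X \<phi> {0..T} \<and> \<phi> 0 = p \<and> \<phi> T = q \<and>
            (\<forall>t\<in>{0<..<T}. \<phi> t \<notin> S))"

definition cross_section :: "plane set" where
  "cross_section = {(x, 0) | x. 0 < x}"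

text \<open>For a one-parameter family of vector fields: the number of limit cycles which tend to
  periodic orbits of \<open>X 0\<close> as the parameter tends to 0. The upper bound counts fixed points of
  the first return map in an arbitrary compact part of the cross-section.\<close>

definition at_most_limit_cycles :: "(real \<Rightarrow> plane \<Rightarrow> plane) \<Rightarrow> nat \<Rightarrow> bool" where
  "at_most_limit_cycles X N \<longleftrightarrow>
     (\<forall>K. compact K \<and> K \<subseteq> cross_section \<longrightarrow>
       (\<exists>e0>0. \<forall>e. 0 < \<bar>e\<bar> \<and> \<bar>e\<bar> < e0 \<longrightarrow>
          (let Z = {p \<in> K. first_return (X e) cross_section p p \<and>
                           (\<exists>\<gamma>. limit_cycle (X e) \<gamma> \<and> p \<in> \<gamma>)}
           in finite Z \<and> card Z \<le> N)))"

text \<open>Convergence with respect to the Hausdorff distance.\<close>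

definition hausdorff_tendsto :: "('a \<Rightarrow> plane set) \<Rightarrow> plane set \<Rightarrow> 'a filter \<Rightarrow> bool" where
  "hausdorff_tendsto \<Gamma> \<gamma> F \<longleftrightarrow>
     (\<forall>\<delta>>0. \<forall>\<^sub>F e in F. \<Gamma> e \<subseteq> (\<Union>z\<in>\<gamma>. ball z \<delta>) \<and> \<gamma> \<subseteq> (\<Union>z\<in>\<Gamma> e. ball z \<delta>))"

definition at_least_limit_cycles :: "(real \<Rightarrow> plane \<Rightarrow> plane) \<Rightarrow> nat \<Rightarrow> bool" where
  "at_least_limit_cycles X N \<longleftrightarrow>
     (\<exists>e0>0. \<exists>\<Gamma> :: nat \<Rightarrow> real \<Rightarrow> plane set.
        (\<forall>e. 0 < \<bar>e\<bar> \<and> \<bar>e\<bar> < e0 \<longrightarrow>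
           inj_on (\<lambda>i. \<Gamma> i e) {..<N} \<and> (\<forall>i<N. limit_cycle (X e) (\<Gamma> i e))) \<and>
        (\<forall>i<N. \<exists>\<gamma>. periodic_orbit (X 0) \<gamma> \<and> hausdorff_tendsto (\<Gamma> i) \<gamma> (at 0)))"

subsection \<open>The system and its Melnikov function\<close>

definition center_field :: "nat \<Rightarrow> real \<Rightarrow> plane \<Rightarrow> plane" where
  "center_field n c = (\<lambda>(x, y). (y + x ^ (2 * n), 2 * real n * c * x ^ (4 * n - 1)))"

definition perturbed_field ::
    "nat \<Rightarrow> real \<Rightarrow> (real \<Rightarrow> real poly poly) \<Rightarrow> (real \<Rightarrow> real poly poly) \<Rightarrow>
     real \<Rightarrow> plane \<Rightarrow> plane" where
  "perturbed_field n c P Q e = (\<lambda>(x, y).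
     (y + x ^ (2 * n) + e * bieval (Q e) (x, y),
      2 * real n * c * x ^ (4 * n - 1) - e * bieval (P e) (x, y)))"

definition inv_int_factor :: "nat \<Rightarrow> real \<Rightarrow> plane \<Rightarrow> real" where
  "inv_int_factor n c = (\<lambda>(x, y). y ^ 2 + x ^ (2 * n) * y - c * x ^ (4 * n))"

text \<open>For \<open>c < -1/4\<close> put \<open>s = sqrt (- (1 + 4 * c))\<close>, so that \<open>\<i> * s\<close> is a square root of
  \<open>1 + 4 * c\<close>. With \<open>w = y + \<mu>\<^sub>+ * x ^ (2 * n)\<close> and \<open>\<mu>\<^sub>\<plusminus> = (1 \<plusminus> \<i> * s) / 2\<close>, the first integral
  \<open>w powr (1 - 1 / (\<i> * s)) * cnj w powr (1 + 1 / (\<i> * s))\<close> is the real expression below, for the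
  branches given by the argument of \<open>w\<close> in \<open>[0, \<pi>]\<close> and its negative for \<open>cnj w\<close>. Since
  \<open>Im w \<ge> 0\<close>, \<^const>\<open>Arg\<close> takes values in \<open>[0, \<pi>]\<close> here.\<close>

definition first_integral :: "nat \<Rightarrow> real \<Rightarrow> plane \<Rightarrow> real" where
  "first_integral n c = (\<lambda>(x, y).
     let s = sqrt (- (1 + 4 * c));
         w = of_real y + (1 + \<i> * of_real s) / 2 * of_real (x ^ (2 * n))
     in (cmod w)\<^sup>2 * exp (- 2 * Arg w / s))"

definition level_orbit :: "nat \<Rightarrow> real \<Rightarrow> real \<Rightarrow> plane set" where
  "level_orbit n c h = {z. first_integral n c z = h}"

text \<open>The integral of the 1-form \<open>A dx + B dy\<close> along the path \<open>g\<close> on \<open>[a, b]\<close>.\<close>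

definition line_integral ::
    "(plane \<Rightarrow> real) \<Rightarrow> (plane \<Rightarrow> real) \<Rightarrow> (real \<Rightarrow> plane) \<Rightarrow> real \<Rightarrow> real \<Rightarrow> real" where
  "line_integral A B g a b =
     integral {a..b} (\<lambda>t. A (g t) * fst (vector_derivative g (at t)) +
                          B (g t) * snd (vector_derivative g (at t)))"

definition traverses_once :: "(plane \<Rightarrow> plane) \<Rightarrow> (real \<Rightarrow> plane) \<Rightarrow> real \<Rightarrow> plane set \<Rightarrow> bool" where
  "traverses_once X \<phi> T \<gamma> \<longleftrightarrow>
     0 < T \<and> solution_on X \<phi> UNIV \<and> \<phi> T = \<phi> 0 \<and> inj_on \<phi> {0..<T} \<and> \<phi> ` {0..T} = \<gamma>"

text \<open>The orbit is parametrized, and thereby oriented, by the unperturbed flow; the value does not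
  depend on the choice of the parametrization, which is unique up to a time shift.\<close>

definition melnikov :: "nat \<Rightarrow> real \<Rightarrow> real poly poly \<Rightarrow> real poly poly \<Rightarrow> real \<Rightarrow> real" where
  "melnikov n c p q h =
     (THE I. \<exists>\<phi> T. traverses_once (center_field n c) \<phi> T (level_orbit n c h) \<and>
        I = line_integral (\<lambda>z. bieval p z / inv_int_factor n c z)
                          (\<lambda>z. bieval q z / inv_int_factor n c z) \<phi> 0 T)"

end

theory Submission
  imports Defs "HOL-Complex_Analysis.Complex_Analysis"
begin

text \<open>The unperturbed field is quasi-homogeneous, so its periodic orbits are the images
  \<open>(r A, r\<^sup>2\<^sup>n B)\<close> of one of them, and \<open>(\<phi>, r) \<mapsto> (r A(\<phi>), r\<^sup>2\<^sup>n B(\<phi>))\<close> are polar coordinates of the punctured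
  plane with \<open>H = r\<^sup>4\<^sup>n\<close>. In these coordinates the perturbed system becomes an equation
  \<open>dr/d\<phi> = \<epsilon> F(\<epsilon>, \<phi>, r)\<close> which extends holomorphically to complex \<open>r\<close>. Hence
  \<open>1/\<epsilon>\<close> times the displacement function is holomorphic on a fixed complex neighbourhood of any
  given interval of radii and converges there, uniformly, to the integral of \<open>F(0, \<phi>, r)\<close> over
  a period. This integral is a power of \<open>r\<close> times the Melnikov function, that is, times a
  polynomial in \<open>r\<close>.

  The reflection \<open>\<phi> \<mapsto> \<pi> - \<phi>\<close> kills half of the monomials, and those that remain have at most
  \<open>n (3 n + 1)\<close> different exponents. A real polynomial with \<open>k\<close> monomials has fewer than
  \<open>k\<close> positive zeros by Descartes' rule. The proof of the rule by Rolle's theorem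
  survives small holomorphic perturbations, which gives the upper bound without knowing the
  multiplicities of the zeros of the limit. For the lower bound, the integrals of
  \<open>x\<^sup>2\<^sup>a\<^sup>+\<^sup>1 y\<^sup>2\<^sup>l dy / V\<close> do not vanish and have distinct exponents, so one can realise a
  polynomial with \<open>n (2 n + 1)\<close> monomials that changes sign as often as Descartes' rule allows.\<close>

section \<open>Solutions of autonomous systems\<close>

text \<open>The zeros of the limit polynomial may be multiple, while the bound concerns cycles of
  the perturbed system. Descartes' rule by Rolle differentiates once per monomial, so the
  displacement has to converge together with that many derivatives. Uniform convergence of real
  functions says nothing about derivatives; for holomorphic functions Cauchy's inequality supplies
  all of them. This is the reason for complex radii, and it is why reality on the real axis is
  carried through the flow and through every differentiation.

  The two bounds differ because a surviving coefficient of the Melnikov polynomial is a sum of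
  moments which might cancel or vanish. Only for the forms \<open>x^(2a+1) y^(2l) dy\<close> is the
  integrand of constant sign, and there are n (2 n + 1) of them in the given degree; each has an
  exponent of its own.

  A limit cycle must be isolated among all periodic orbits nearby, including those that wind several
  times before closing. Fixed points of the return map see only one turn; the gap is bridged by the
  monotonicity of the return map, which comes from its being Lipschitz close to the
  identity.\<close>

definition lipschitz_on_bounded :: "('a::metric_space \<Rightarrow> 'b::metric_space) \<Rightarrow> bool" where
  "lipschitz_on_bounded f \<longleftrightarrow> (\<forall>S. bounded S \<longrightarrow> (\<exists>L. L-lipschitz_on S f))"

text \<open>Gronwall's argument: \<open>exp (- (2 * L * s))\<close> times the squared distance does
  not increase, and it vanishes at 0. Solutions on a compact interval stay in a bounded set, so
  Lipschitz constants on bounded sets suffice, and polynomial fields have these.\<close>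

lemma solution_unique:
  assumes lip: "lipschitz_on_bounded X"
    and sol: "solution_on X \<phi> {0..T}" "solution_on X \<psi> {0..T}"
    and init: "\<phi> 0 = \<psi> 0" and t: "t \<in> {0..T}"
  shows "\<phi> t = \<psi> t"
proof -
  have cont: "continuous_on {0..T} \<phi>" "continuous_on {0..T} \<psi>"
    using sol unfolding solution_on_def
    by (auto intro!: continuous_on_vector_derivative)
  have "bounded (\<phi> ` {0..T} \<union> \<psi> ` {0..T})"
    by (intro bounded_Un[THEN iffD2] conjI compact_imp_bounded compact_continuous_image cont) auto
  then obtain L where L: "L-lipschitz_on (\<phi> ` {0..T} \<union> \<psi> ` {0..T}) X"
    using lip unfolding lipschitz_on_bounded_def by blast
  define d where "d s = (\<phi> s - \<psi> s) \<bullet> (\<phi> s - \<psi> s)" for s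
  define h where "h s = exp (- (2 * L * s)) * d s" for s
  have "h t \<le> h 0"
  proof (cases "t = 0")
    case False
    with t have "0 < t" by auto
    show ?thesis
    proof (rule DERIV_nonpos_imp_decreasing_open[OF less_imp_le[OF \<open>0 < t\<close>]])
      fix s assume s: "0 < s" "s < t"
      then have "s \<in> {0<..<T}" using t by auto
      then have "at s within {0..T} = at s"
        by (intro at_within_interior) (auto simp: interior_atLeastAtMost_real)
      then have der: "(\<phi> has_vector_derivative X (\<phi> s)) (at s)" "(\<psi> has_vector_derivative X (\<psi> s)) (at s)"
        using sol s t unfolding solution_on_def by (metis atLeastAtMost_iff less_eq_real_def less_trans order.trans)+
      have dder: "(d has_real_derivative 2 * ((\<phi> s - \<psi> s) \<bullet> (X (\<phi> s) - X (\<psi> s)))) (at s)"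
      proof -
        have "((\<lambda>s. \<phi> s - \<psi> s) has_vector_derivative X (\<phi> s) - X (\<psi> s)) (at s)"
          by (intro derivative_intros der)
        from bounded_bilinear.has_vector_derivative[OF bounded_bilinear_inner this this] show ?thesis
          unfolding d_def has_real_derivative_iff_has_vector_derivative by (simp add: inner_commute)
      qed
      have "((\<lambda>s. exp (- (2 * L * s)) * d s) has_real_derivative
          (- (2 * L) * exp (- (2 * L * s))) * d s + exp (- (2 * L * s)) * (2 * ((\<phi> s - \<psi> s) \<bullet> (X (\<phi> s) - X (\<psi> s))))) (at s)"
        by (rule derivative_eq_intros dder refl | simp)+
      moreover have "(\<phi> s - \<psi> s) \<bullet> (X (\<phi> s) - X (\<psi> s)) \<le> L * d s"
      proof -
        have "(\<phi> s - \<psi> s) \<bullet> (X (\<phi> s) - X (\<psi> s)) \<le> norm (\<phi> s - \<psi> s) * norm (X (\<phi> s) - X (\<psi> s))"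
          by (rule norm_cauchy_schwarz)
        also have "\<dots> \<le> norm (\<phi> s - \<psi> s) * (L * norm (\<phi> s - \<psi> s))"
          using lipschitz_onD[OF L, of "\<phi> s" "\<psi> s"] s t
          by (intro mult_left_mono) (auto simp: dist_norm)
        finally show ?thesis by (simp add: d_def power2_norm_eq_inner[symmetric] power2_eq_square mult_ac)
      qed
      then have "exp (- (2 * L * s)) * ((\<phi> s - \<psi> s) \<bullet> (X (\<phi> s) - X (\<psi> s))) \<le> exp (- (2 * L * s)) * (L * d s)"
        by (intro mult_left_mono) auto
      ultimately show "\<exists>y. (h has_real_derivative y) (at s) \<and> y \<le> 0"
        unfolding h_def by (intro exI conjI) (assumption, simp add: algebra_simps)
    next
      show "continuous_on {0..t} h"
        unfolding h_def d_def using t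
        by (intro continuous_intros continuous_on_subset[OF cont(1)] continuous_on_subset[OF cont(2)]) auto
    qed
  qed auto
  also have "h 0 = 0" by (simp add: h_def d_def init)
  finally have "d t \<le> 0" by (simp add: h_def mult_le_0_iff)
  then have "\<phi> t - \<psi> t = 0" unfolding d_def by (metis inner_eq_zero_iff inner_ge_zero order_antisym)
  then show ?thesis by simp
qed

text \<open>The passage from angle to time: a curve whose velocity is the field up to a positive
  factor \<open>\<sigma>\<close> becomes a solution in the time \<open>\<tau> s\<close>, the
  integral of \<open>\<sigma>\<close>, and \<open>\<eta>\<close> inverts
  \<open>\<tau>\<close>.\<close>

lemma reparametrization:
  fixes g :: "real \<Rightarrow> plane" and \<sigma> :: "real \<Rightarrow> real"
  assumes L: "0 < L" and cont: "continuous_on {0..L} \<sigma>"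
    and m: "0 < m" "\<And>s. s \<in> {0..L} \<Longrightarrow> m \<le> \<sigma> s"
    and der: "\<And>s. s \<in> {0..L} \<Longrightarrow> (g has_vector_derivative \<sigma> s *\<^sub>R X (g s)) (at s within {0..L})"
  obtains T \<eta> where "0 < T" "\<eta> 0 = 0" "\<eta> T = L" "strict_mono_on {0..T} \<eta>" "\<eta> ` {0..T} = {0..L}"
    "solution_on X (g \<circ> \<eta>) {0..T}"
    "\<And>t. t \<in> {0..T} \<Longrightarrow> (\<eta> has_real_derivative 1 / \<sigma> (\<eta> t)) (at t within {0..T})"
proof -
  \<comment> \<open>Extending \<open>\<sigma>\<close> by constants, and integrating from -1, makes
    \<open>\<tau>\<close> differentiable and strictly increasing on an open interval around
    \<open>{0..L}\<close>, so that the two-sided inverse function rule also covers the end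
    points.\<close>
  define \<rho> where "\<rho> s = \<sigma> (max 0 (min L s))" for s
  have \<rho>: "\<rho> s = \<sigma> s" if "s \<in> {0..L}" for s using that by (auto simp: \<rho>_def min_def max_def)
  have \<rho>m: "m \<le> \<rho> s" for s using L m(2) by (auto simp: \<rho>_def)
  have \<rho>c: "continuous_on A \<rho>" for A
    unfolding \<rho>_def
    by (intro continuous_on_compose2[OF cont] continuous_intros) (use L in auto)
  define \<tau> where "\<tau> s = integral {-1..s} \<rho> - integral {-1..0} \<rho>" for s
  have d\<tau>: "(\<tau> has_real_derivative \<rho> s) (at s)" if "s \<in> {-1<..<L+1}" for s
  proof -
    have "((\<lambda>u. integral {-1..u} \<rho>) has_real_derivative \<rho> s) (at s within {-1..L+1})"
      by (rule integral_has_real_derivative[OF \<rho>c]) (use that in auto)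
    moreover have "at s within {-1..L+1} = at s"
      by (rule at_within_interior) (use that in \<open>auto simp: interior_atLeastAtMost_real\<close>)
    ultimately show ?thesis unfolding \<tau>_def
      by (auto intro!: derivative_eq_intros)
  qed
  have mono: "\<tau> s < \<tau> s'" if "-1 < s" "s < s'" "s' < L+1" for s s'
    by (rule DERIV_pos_imp_increasing[OF that(2)])
       (use that d\<tau> \<rho>m m(1) in \<open>meson greaterThanLessThan_iff less_le_trans le_less_trans\<close>)
  have \<tau>0: "\<tau> 0 = 0" by (simp add: \<tau>_def)
  define T where "T = \<tau> L"
  have T: "0 < T" using mono[of 0 L] L \<tau>0 by (simp add: T_def)
  have \<tau>c: "continuous_on {0..L} \<tau>"
    by (rule DERIV_continuous_on[where D=\<rho>]) (use d\<tau> in \<open>auto intro: has_field_derivative_at_within\<close>)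
  have inj: "inj_on \<tau> {-1<..<L+1}"
    by (rule linorder_inj_onI') (use mono in force)
  define \<eta> where "\<eta> = the_inv_into {-1<..<L+1} \<tau>"
  have \<eta>\<tau>: "\<eta> (\<tau> s) = s" if "s \<in> {-1<..<L+1}" for s
    unfolding \<eta>_def by (rule the_inv_into_f_f[OF inj that])
  have surj: "\<exists>s\<in>{0..L}. \<tau> s = t" if "t \<in> {0..T}" for t
    using IVT'[of \<tau> 0 t L] that \<tau>0 \<tau>c L by (auto simp: T_def)
  have \<eta>in: "\<eta> t \<in> {0..L}" and \<tau>\<eta>: "\<tau> (\<eta> t) = t" if "t \<in> {0..T}" for t
    using surj[OF that] \<eta>\<tau> by force+
  have d\<eta>: "(\<eta> has_real_derivative 1 / \<sigma> (\<eta> t)) (at t)" if t: "t \<in> {0..T}" for t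
  proof -
    define s where "s = \<eta> t"
    have s: "s \<in> {0..L}" "\<tau> s = t" using \<eta>in[OF t] \<tau>\<eta>[OF t] by (auto simp: s_def)
    have icont: "isCont \<eta> (\<tau> s)"
    proof (rule isCont_inverse_function[where d="1/2" and f=\<tau> and g=\<eta> and x=s])
      fix z assume "\<bar>z - s\<bar> \<le> 1/2"
      then have "z - s \<le> 1/2" "s - z \<le> 1/2" by linarith+
      then have "z \<in> {-1<..<L+1}" using s by auto
      then show "\<eta> (\<tau> z) = z" "isCont \<tau> z" using \<eta>\<tau> DERIV_isCont[OF d\<tau>] by auto
    qed simp
    have "\<exists>a b. a < t \<and> t < b \<and> (\<forall>y. a < y \<and> y < b \<longrightarrow> \<tau> (\<eta> y) = y)"
    proof (rule exI[of _ "\<tau> (-1/2)"], rule exI[of _ "\<tau> (L+1/2)"], intro conjI allI impI)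
      show "\<tau> (-1/2) < t" "t < \<tau> (L+1/2)" using s mono[of "-1/2" s] mono[of s "L+1/2"] by auto
      fix y assume "\<tau> (-1/2) < y \<and> y < \<tau> (L+1/2)"
      moreover have "continuous_on {-1/2..L+1/2} \<tau>"
        by (rule DERIV_continuous_on[where D=\<rho>]) (use d\<tau> in \<open>auto intro: has_field_derivative_at_within\<close>)
      ultimately obtain x where "-1/2 \<le> x" "x \<le> L+1/2" "\<tau> x = y"
        using IVT'[of \<tau> "-1/2" y "L+1/2"] L by force
      then show "\<tau> (\<eta> y) = y" using \<eta>\<tau>[of x] by auto
    qed
    then obtain a b where "a < t" "t < b" "\<And>y. a < y \<Longrightarrow> y < b \<Longrightarrow> \<tau> (\<eta> y) = y" by blast
    moreover have "(\<tau> has_real_derivative \<rho> s) (at (\<eta> t))" using d\<tau>[of s] s by (auto simp: s_def)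
    moreover have "\<rho> s \<noteq> 0" using \<rho>m[of s] m(1) by auto
    ultimately have "(\<eta> has_real_derivative inverse (\<rho> s)) (at t)"
      using icont s
      by (intro DERIV_inverse_function[of \<tau> "\<rho> s" \<eta> t a b]) auto
    then show ?thesis using \<rho>[OF s(1)] by (simp add: s_def inverse_eq_divide)
  qed
  show ?thesis
  proof
    show "0 < T" by (rule T)
    show "\<eta> 0 = 0" "\<eta> T = L" using \<eta>\<tau>[of 0] \<eta>\<tau>[of L] \<tau>0 L by (auto simp: T_def)
    show "strict_mono_on {0..T} \<eta>"
    proof (rule strict_mono_onI)
      fix x y assume xy: "x \<in> {0..T}" "y \<in> {0..T}" "x < y"
      show "\<eta> x < \<eta> y"
      proof (rule ccontr)
        assume "\<not> \<eta> x < \<eta> y"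
        then have "\<tau> (\<eta> y) \<le> \<tau> (\<eta> x)"
          using mono[of "\<eta> y" "\<eta> x"] \<eta>in[OF xy(1)] \<eta>in[OF xy(2)] by force
        then show False using xy \<tau>\<eta> by auto
      qed
    qed
    show "\<eta> ` {0..T} = {0..L}"
    proof (intro equalityI subsetI)
      fix s assume s: "s \<in> {0..L}"
      have "\<tau> 0 \<le> \<tau> s" "\<tau> s \<le> \<tau> L"
        using mono[of 0 s] mono[of s L] s by force+
      then show "s \<in> \<eta> ` {0..T}" using \<eta>\<tau>[of s] s \<tau>0 by (force simp: T_def image_iff)
    qed (use \<eta>in in auto)
    show "(\<eta> has_real_derivative 1 / \<sigma> (\<eta> t)) (at t within {0..T})" if "t \<in> {0..T}" for t
      using d\<eta>[OF that] by (rule has_field_derivative_at_within)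
    show "solution_on X (g \<circ> \<eta>) {0..T}" unfolding solution_on_def
    proof
      fix t assume t: "t \<in> {0..T}"
      have "(\<eta> has_vector_derivative 1 / \<sigma> (\<eta> t)) (at t within {0..T})"
        using d\<eta>[OF t] by (auto simp: has_real_derivative_iff_has_vector_derivative[symmetric] intro: has_field_derivative_at_within)
      moreover have "(g has_vector_derivative \<sigma> (\<eta> t) *\<^sub>R X (g (\<eta> t))) (at (\<eta> t) within \<eta> ` {0..T})"
        by (rule has_vector_derivative_within_subset[OF der]) (use \<eta>in t in auto)
      ultimately have "(g \<circ> \<eta> has_vector_derivative (1 / \<sigma> (\<eta> t)) *\<^sub>R (\<sigma> (\<eta> t) *\<^sub>R X (g (\<eta> t)))) (at t within {0..T})"
        by (rule vector_diff_chain_within)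
      moreover have "\<sigma> (\<eta> t) \<noteq> 0" using m(1) m(2)[OF \<eta>in[OF t]] by auto
      ultimately show "(g \<circ> \<eta> has_vector_derivative X ((g \<circ> \<eta>) t)) (at t within {0..T})" by simp
    qed
  qed
qed

lemma has_derivative_at_within_Un:
  assumes "(f has_derivative f') (at x within S)" "(f has_derivative f') (at x within T)"
  shows "(f has_derivative f') (at x within S \<union> T)"
  using assms unfolding has_derivative_within unfolding at_within_union
  by (elim conjE, intro conjI) (assumption, rule filterlim_sup)

text \<open>At the junction of two copies of \<open>\<psi>\<close> both one-sided derivatives are
  the field at the same point, because \<open>\<psi> T = \<psi> 0\<close>; together they form a
  two-sided derivative.\<close>

lemma periodic_extension:
  assumes T: "0 < T" and sol: "solution_on X \<psi> {0..T}" and closed: "\<psi> T = \<psi> 0"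
  obtains \<zeta> where "solution_on X \<zeta> UNIV" "\<And>t. \<zeta> (t + T) = \<zeta> t" "\<And>t. t \<in> {0..T} \<Longrightarrow> \<zeta> t = \<psi> t"
    "range \<zeta> = \<psi> ` {0..T}"
proof -
  define \<zeta> where "\<zeta> t = \<psi> (t - T * of_int \<lfloor>t / T\<rfloor>)" for t
  define I where "I k = {T * of_int k..T * (of_int k + 1)}" for k :: int
  have \<zeta>: "\<zeta> t = \<psi> (t - T * of_int k)" if "t \<in> I k" for t k
  proof (cases "t = T * (of_int k + 1)")
    case True
    then have "\<lfloor>t / T\<rfloor> = k + 1" using T by simp
    then show ?thesis using True closed by (simp add: \<zeta>_def algebra_simps)
  next
    case False
    then have "\<lfloor>t / T\<rfloor> = k" using T that by (auto simp: floor_eq_iff field_simps I_def)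
    then show ?thesis by (simp add: \<zeta>_def)
  qed
  have shift: "t - T * of_int k \<in> {0..T}" if "t \<in> I k" for t k
    using that by (auto simp: I_def algebra_simps)
  have within: "(\<zeta> has_vector_derivative X (\<zeta> t)) (at t within I k)" if t: "t \<in> I k" for t k
  proof -
    have "((\<lambda>t. t - T * of_int k) has_vector_derivative 1) (at t within I k)"
      by (auto intro!: derivative_eq_intros)
    moreover have "(\<psi> has_vector_derivative X (\<psi> (t - T * of_int k))) (at (t - T * of_int k) within (\<lambda>t. t - T * of_int k) ` I k)"
      by (rule has_vector_derivative_within_subset[of _ _ _ "{0..T}"])
         (use sol shift[OF t] shift in \<open>auto simp: solution_on_def\<close>)
    ultimately have "((\<psi> \<circ> (\<lambda>t. t - T * of_int k)) has_vector_derivative 1 *\<^sub>R X (\<psi> (t - T * of_int k))) (at t within I k)"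
      by (rule vector_diff_chain_within)
    then have "((\<psi> \<circ> (\<lambda>t. t - T * of_int k)) has_vector_derivative X (\<zeta> t)) (at t within I k)"
      by (simp add: \<zeta>[OF t])
    then show ?thesis
      by (rule has_vector_derivative_transform[OF t, rotated]) (simp add: \<zeta>)
  qed
  \<comment> \<open>Outside the closed set \<open>I k\<close> the filter is \<open>bot\<close> and
    the claim is vacuous. Hence a point of \<open>I k\<close> may be treated with
    \<open>I (k - 1)\<close> as well, whether or not it is the junction.\<close>
  have within': "(\<zeta> has_vector_derivative X (\<zeta> t)) (at t within I k)" for t k
  proof (cases "t \<in> I k")
    case False
    have "closed (I k)" by (auto simp: I_def)
    then have "at t within I k = bot" using False at_within_eq_bot_iff by (metis Diff_empty Diff_insert0 closure_closed)
    then show ?thesis by (simp add: has_vector_derivative_def has_derivative_def bounded_linear_scaleR_left)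
  qed (rule within)
  have sol': "(\<zeta> has_vector_derivative X (\<zeta> t)) (at t)" for t
  proof -
    define k where "k = \<lfloor>t / T\<rfloor>"
    have k: "T * of_int k \<le> t" "t < T * (of_int k + 1)"
      using floor_correct[of "t / T"] unfolding k_def[symmetric] pos_le_divide_eq[OF T] pos_divide_less_eq[OF T]
      by (simp_all add: mult.commute)
    have "(\<zeta> has_vector_derivative X (\<zeta> t)) (at t within I (k - 1) \<union> I k)"
      using within'[of t "k-1"] within'[of t k] unfolding has_vector_derivative_def
      by (rule has_derivative_at_within_Un)
    moreover have "I (k - 1) \<union> I k = {T * (of_int k - 1)..T * (of_int k + 1)}"
    proof -
      have "T * (of_int k - 1) \<le> T * of_int k" "T * of_int k \<le> T * (of_int k + 1)"
        using T by (simp_all add: algebra_simps)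
      then show ?thesis by (auto simp: I_def)
    qed
    moreover have "at t within {T * (of_int k - 1)..T * (of_int k + 1)} = at t"
      by (rule at_within_interior) (use T k in \<open>auto simp: interior_atLeastAtMost_real algebra_simps\<close>)
    ultimately show ?thesis by simp
  qed
  have ex: "\<exists>k. t \<in> I k" for t
    using floor_correct[of "t / T"] unfolding pos_le_divide_eq[OF T] pos_divide_less_eq[OF T]
    by (intro exI[of _ "\<lfloor>t / T\<rfloor>"]) (simp add: I_def mult.commute)
  show ?thesis
  proof
    show "solution_on X \<zeta> UNIV" using sol' by (auto simp: solution_on_def)
    show "\<zeta> (t + T) = \<zeta> t" for t
    proof -
      obtain k where k: "t \<in> I k" using ex by blast
      then have "t + T \<in> I (k + 1)" by (auto simp: I_def algebra_simps)
      from \<zeta>[OF this] \<zeta>[OF k] show ?thesis by (simp add: algebra_simps)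
    qed
    show 0: "\<zeta> t = \<psi> t" if "t \<in> {0..T}" for t using \<zeta>[of t 0] that by (auto simp: I_def)
    show "range \<zeta> = \<psi> ` {0..T}"
    proof (intro equalityI subsetI)
      fix z assume "z \<in> range \<zeta>"
      then obtain t k where "z = \<zeta> t" "t \<in> I k" using ex by blast
      then show "z \<in> \<psi> ` {0..T}" using \<zeta> shift by blast
    next
      fix z assume "z \<in> \<psi> ` {0..T}"
      then obtain t where "t \<in> {0..T}" "z = \<psi> t" by auto
      then show "z \<in> range \<zeta>" using 0[of t] by (auto intro: range_eqI[of _ _ t])
    qed
  qed
qed

section \<open>Zeros of perturbed sparse polynomials\<close>

text \<open>Morera's theorem: by Fubini the integral along each edge of a triangle may be exchanged
  with the integral over \<open>t\<close>, and the inner integrals around the triangle vanish by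
  Cauchy's theorem.\<close>

lemma holomorphic_on_integral:
  fixes g :: "real \<Rightarrow> complex \<Rightarrow> complex"
  assumes D: "open D" and cont: "continuous_on ({a..b} \<times> D) (\<lambda>(t, z). g t z)"
    and hol: "\<And>t. t \<in> {a..b} \<Longrightarrow> g t holomorphic_on D"
  shows "(\<lambda>z. integral {a..b} (\<lambda>t. g t z)) holomorphic_on D"
proof -
  have cont2: "continuous_on S (\<lambda>p. g (u p) (v p))"
    if "continuous_on S u" "continuous_on S v" "\<And>p. p \<in> S \<Longrightarrow> u p \<in> {a..b}" "\<And>p. p \<in> S \<Longrightarrow> v p \<in> D"
    for S u and v :: "'d::topological_space \<Rightarrow> complex"
    using continuous_on_compose2[OF cont, of S "\<lambda>p. (u p, v p)"] that
    by (force intro: continuous_on_Pair)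
  define G where "G z = integral {a..b} (\<lambda>t. g t z)" for z
  have contG: "continuous_on D G"
    unfolding G_def cbox_interval[symmetric]
  proof (rule integral_continuous_on_param)
    show "continuous_on (D \<times> cbox a b) (\<lambda>(z, t). g t z)"
      unfolding case_prod_beta by (intro cont2 continuous_intros) auto
  qed
  have path: "contour_integral (linepath p q) G = integral {a..b} (\<lambda>t. contour_integral (linepath p q) (g t))"
      "(\<lambda>t. contour_integral (linepath p q) (g t)) integrable_on {a..b}"
    if seg: "closed_segment p q \<subseteq> D" for p q
  proof -
    have in_D: "linepath p q x \<in> D" if "x \<in> {0..1}" for x
      using seg that linepath_in_path by fastforce
    have lc: "continuous_on S (\<lambda>y. linepath p q (u y))" if "continuous_on S u" for S and u :: "'d::topological_space \<Rightarrow> real"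
      unfolding linepath_def using that by (intro continuous_intros)
    have c: "continuous_on ({0..1} \<times> {a..b}) (\<lambda>(x, t). g t (linepath p q x) * (q - p))"
      unfolding case_prod_beta using in_D by (intro cont2 continuous_intros lc) auto
    have c': "continuous_on ({a..b} \<times> {0..1}) (\<lambda>(t, x). g t (linepath p q x) * (q - p))"
      unfolding case_prod_beta using in_D by (intro cont2 continuous_intros lc) auto
    have "contour_integral (linepath p q) G = integral {0..1} (\<lambda>x. integral {a..b} (\<lambda>t. g t (linepath p q x) * (q - p)))"
      by (simp add: contour_integral_integral G_def)
    also have "\<dots> = integral {a..b} (\<lambda>t. integral {0..1} (\<lambda>x. g t (linepath p q x) * (q - p)))"
    proof -
      have "continuous_on (cbox (0, a) (1, b)) (\<lambda>(x, t). g t (linepath p q x) * (q - p))"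
        unfolding cbox_Pair_eq using c by (simp only: cbox_interval)
      from integral_swap_continuous[OF this] show ?thesis by (simp only: cbox_interval)
    qed
    finally show "contour_integral (linepath p q) G = integral {a..b} (\<lambda>t. contour_integral (linepath p q) (g t))"
      by (simp add: contour_integral_integral)
    have "continuous_on {a..b} (\<lambda>t. integral (cbox 0 1) (\<lambda>x. g t (linepath p q x) * (q - p)))"
      by (rule integral_continuous_on_param) (use c' in \<open>simp add: cbox_interval\<close>)
    then show "(\<lambda>t. contour_integral (linepath p q) (g t)) integrable_on {a..b}"
      by (intro integrable_continuous_interval) (simp add: contour_integral_integral cbox_interval)
  qed
  have "G analytic_on D"
  proof (rule Morera_local_triangle, intro exI[of _ D] conjI allI impI)
    fix p q r assume hull: "convex hull {p, q, r} \<subseteq> D"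
    then have seg: "closed_segment p q \<subseteq> D" "closed_segment q r \<subseteq> D" "closed_segment r p \<subseteq> D"
      unfolding segment_convex_hull
      by (intro order.trans[OF hull_mono hull]; simp)+
    have "contour_integral (linepath p q) (g t) + contour_integral (linepath q r) (g t)
        + contour_integral (linepath r p) (g t) = 0" if "t \<in> {a..b}" for t
    proof -
      have "(g t has_contour_integral 0) (linepath p q +++ linepath q r +++ linepath r p)"
        using Cauchy_theorem_triangle[OF holomorphic_on_subset[OF hol[OF that] hull]] .
      moreover have "g t contour_integrable_on linepath u v" if "closed_segment u v \<subseteq> D" for u v
        using that \<open>t \<in> {a..b}\<close> hol holomorphic_on_subset
        by (intro contour_integrable_continuous_linepath holomorphic_on_imp_continuous_on) blast
      ultimately show ?thesis using seg
        by (auto dest!: contour_integral_unique simp: add.assoc)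
    qed
    then have "integral {a..b} (\<lambda>t. contour_integral (linepath p q) (g t) + contour_integral (linepath q r) (g t)
        + contour_integral (linepath r p) (g t)) = integral {a..b} (\<lambda>t. 0)"
      by (intro integral_cong) auto
    then show "contour_integral (linepath p q) G + contour_integral (linepath q r) G + contour_integral (linepath r p) G = 0"
      by (simp add: path seg integral_add integrable_add)
  qed (use D contG in auto)
  then show ?thesis unfolding G_def by (rule analytic_imp_holomorphic)
qed

text \<open>Cauchy's inequality on discs of one radius \<open>\<delta>\<close> around the points of
  \<open>K\<close> bounds the difference of the derivatives by that of the functions. The discs
  together form a larger compact part of \<open>\<Omega>\<close>, where convergence is still
  uniform.\<close>

lemma uniform_limit_deriv:
  fixes g :: "'a \<Rightarrow> complex \<Rightarrow> complex"
  assumes \<Omega>: "open \<Omega>" and lim: "\<And>K. compact K \<Longrightarrow> K \<subseteq> \<Omega> \<Longrightarrow> uniform_limit K g g0 F"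
    and hol: "\<forall>\<^sub>F e in F. g e holomorphic_on \<Omega>" and hol0: "g0 holomorphic_on \<Omega>"
    and K: "compact K" "K \<subseteq> \<Omega>"
  shows "uniform_limit K (\<lambda>e. deriv (g e)) (deriv g0) F"
proof (rule uniform_limitI)
  fix \<epsilon> :: real assume \<epsilon>: "0 < \<epsilon>"
  obtain \<delta> where \<delta>: "0 < \<delta>" "(\<Union>x\<in>K. cball x \<delta>) \<subseteq> \<Omega>"
    using compact_subset_open_imp_cball_epsilon_subset[OF K(1) \<Omega> K(2)] by blast
  have "compact (\<Union>x\<in>K. cball x \<delta>)" by (rule compact_minkowski_sum_cball[OF K(1)])
  from uniform_limitD[OF lim[OF this \<delta>(2)], of "\<epsilon> * \<delta> / 2"] \<epsilon> \<delta>(1)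
  have "\<forall>\<^sub>F e in F. \<forall>x\<in>(\<Union>x\<in>K. cball x \<delta>). dist (g e x) (g0 x) < \<epsilon> * \<delta> / 2" by simp
  with hol show "\<forall>\<^sub>F e in F. \<forall>x\<in>K. dist (deriv (g e) x) (deriv g0 x) < \<epsilon>"
  proof eventually_elim
    case (elim e)
    show ?case
    proof
      fix x assume x: "x \<in> K"
      have sub: "cball x \<delta> \<subseteq> \<Omega>" using \<delta>(2) x by blast
      then have x\<Omega>: "x \<in> \<Omega>" using \<delta>(1) by auto
      have holh: "(\<lambda>y. g e y - g0 y) holomorphic_on cball x \<delta>"
        using elim(1) hol0 sub by (intro holomorphic_intros) (auto intro: holomorphic_on_subset)
      have "norm ((deriv ^^ 1) (\<lambda>y. g e y - g0 y) x) \<le> fact 1 * (\<epsilon> * \<delta> / 2) / \<delta> ^ 1"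
      proof (rule Cauchy_inequality)
        show "(\<lambda>y. g e y - g0 y) holomorphic_on ball x \<delta>"
          using holh by (rule holomorphic_on_subset) auto
        show "continuous_on (cball x \<delta>) (\<lambda>y. g e y - g0 y)"
          using holh by (rule holomorphic_on_imp_continuous_on)
        fix y assume "norm (x - y) = \<delta>"
        then have "y \<in> (\<Union>x\<in>K. cball x \<delta>)" using x by (auto simp: dist_norm)
        then show "norm (g e y - g0 y) \<le> \<epsilon> * \<delta> / 2" using elim(2) by (force simp: dist_norm)
      qed (rule \<delta>(1))
      moreover have "deriv (\<lambda>y. g e y - g0 y) x = deriv (g e) x - deriv g0 x"
        using elim(1) hol0 x\<Omega> \<Omega> by (intro deriv_diff) (auto simp: holomorphic_on_imp_differentiable_at)
      ultimately have "norm (deriv (g e) x - deriv g0 x) \<le> \<epsilon> / 2" using \<delta>(1) by simp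
      then show "dist (deriv (g e) x) (deriv g0 x) < \<epsilon>" using \<epsilon> by (simp add: dist_norm)
    qed
  qed
qed

text \<open>Distinct zeros are counted, without multiplicity. Bounding every finite set of zeros of
  \<open>f\<close> yields the finiteness of the zero set along with its cardinality.\<close>

lemma card_zeros_Rolle:
  fixes f f' :: "real \<Rightarrow> real"
  assumes der: "\<And>x. x \<in> {a..b} \<Longrightarrow> (f has_real_derivative f' x) (at x)"
    and fin: "finite {x \<in> {a..b}. f' x = 0}"
  shows "finite {x \<in> {a..b}. f x = 0} \<and> card {x \<in> {a..b}. f x = 0} \<le> Suc (card {x \<in> {a..b}. f' x = 0})"
proof (rule finite_if_finite_subsets_card_bdd)
  \<comment> \<open>The points found by Rolle's theorem stay below \<open>Max Z\<close>; so the next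
    one, between the old maximum and the new, is not yet among them.\<close>
  have *: "Z \<subseteq> {x \<in> {a..b}. f x = 0} \<Longrightarrow> Z \<noteq> {} \<Longrightarrow>
      \<exists>W \<subseteq> {x \<in> {a..b}. f' x = 0}. card Z = Suc (card W) \<and> (\<forall>w\<in>W. w < Max Z)"
    if "finite Z" for Z
    using that
  proof (induction Z rule: finite_linorder_max_induct)
    case (insert z Z)
    show ?case
    proof (cases "Z = {}")
      case False
      then obtain W where W: "W \<subseteq> {x \<in> {a..b}. f' x = 0}" "card Z = Suc (card W)" "\<forall>w\<in>W. w < Max Z"
        using insert by auto
      define y where "y = Max Z"
      have y: "y \<in> Z" "y < z" using insert False by (auto simp: y_def)
      then have yz: "y \<in> {a..b}" "f y = 0" "z \<in> {a..b}" "f z = 0" using insert by auto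
      have "\<exists>w>y. w < z \<and> DERIV f w :> 0"
      proof (rule Rolle)
        show "continuous_on {y..z} f"
          by (rule DERIV_continuous_on[where D=f']) (use der yz in \<open>auto intro: has_field_derivative_at_within\<close>)
        show "f differentiable at x" if "y < x" "x < z" for x
          using der[of x] that yz by (auto simp: real_differentiable_def)
      qed (use y yz in auto)
      then obtain w where w: "y < w" "w < z" "DERIV f w :> 0" by blast
      then have w0: "w \<in> {x \<in> {a..b}. f' x = 0}" using der[of w] yz DERIV_unique by force
      have "w \<notin> W" using W(3) w(1) by (force simp: y_def)
      moreover have "finite W" using W(1) fin finite_subset by blast
      moreover have "Max (insert z Z) = z" using insert(1) False y(2) by (simp add: y_def[symmetric])
      moreover have "z \<notin> Z" using insert by auto
      ultimately show ?thesis using W w w0 insert(1)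
        by (intro exI[of _ "insert w W"]) (auto simp: y_def)
    qed (auto intro!: exI[of _ "{}"])
  qed simp
  fix Z assume "Z \<subseteq> {x \<in> {a..b}. f x = 0}" "finite Z"
  then show "card Z \<le> Suc (card {x \<in> {a..b}. f' x = 0})"
    using *[of Z] card_mono[OF fin] by (cases "Z = {}") fastforce+
qed

text \<open>The imaginary part vanishes along the axis, and its derivative there is the imaginary
  part of the complex derivative. Thus reality passes to derivatives, and real calculus applies to
  the real part.\<close>

lemma deriv_real:
  assumes hol: "g holomorphic_on \<Omega>" and \<Omega>: "open \<Omega>" "of_real x \<in> \<Omega>"
    and real: "\<And>y. of_real y \<in> \<Omega> \<Longrightarrow> g (of_real y) \<in> \<real>"
  shows "deriv g (of_real x) \<in> \<real>"
    "((\<lambda>y. Re (g (of_real y))) has_real_derivative Re (deriv g (of_real x))) (at x)"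
proof -
  have "(g has_field_derivative deriv g (of_real x)) (at (of_real x))"
    using hol \<Omega> by (rule holomorphic_derivI)
  then have vd: "((\<lambda>y. g (of_real y)) has_vector_derivative deriv g (of_real x)) (at x)"
    by (rule has_vector_derivative_real_field)
  have re: "((\<lambda>y. Re (g (of_real y))) has_vector_derivative Re (deriv g (of_real x))) (at x)"
    by (rule bounded_linear.has_vector_derivative[OF bounded_linear_Re vd])
  then show "((\<lambda>y. Re (g (of_real y))) has_real_derivative Re (deriv g (of_real x))) (at x)"
    by (simp add: has_real_derivative_iff_has_vector_derivative)
  have im: "((\<lambda>y. Im (g (of_real y))) has_vector_derivative Im (deriv g (of_real x))) (at x)"
    by (rule bounded_linear.has_vector_derivative[OF bounded_linear_Im vd])
  have op: "open (of_real -` \<Omega> :: real set)"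
    by (intro open_vimage \<Omega> continuous_intros)
  have "((\<lambda>y. 0) has_vector_derivative Im (deriv g (of_real x))) (at x)"
    by (rule has_vector_derivative_transform_within_open[OF im op]) (use real \<Omega> in \<open>auto simp: complex_is_Real_iff\<close>)
  then have "Im (deriv g (of_real x)) = 0"
    using vector_derivative_unique_at[OF _ has_vector_derivative_const] by blast
  then show "deriv g (of_real x) \<in> \<real>" by (simp add: complex_is_Real_iff)
qed

text \<open>The operator \<open>z d/dz - k\<close> kills the monomial \<open>z\<^sup>k\<close>; on the positive axis it is
  differentiation of \<open>x\<^sup>-\<^sup>k g(x)\<close>, so Rolle's theorem bounds the number of zeros that it loses.\<close>

lemma card_zeros_near_sparse_polynomial:
  fixes g :: "'a \<Rightarrow> complex \<Rightarrow> complex" and c :: "nat \<Rightarrow> real"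
  assumes \<Omega>: "open \<Omega>" and ab: "0 < a" "of_real ` {a..b} \<subseteq> \<Omega>"
    and "finite S" "S \<noteq> {}" "\<And>k. k \<in> S \<Longrightarrow> c k \<noteq> 0"
    and "\<And>K. compact K \<Longrightarrow> K \<subseteq> \<Omega> \<Longrightarrow> uniform_limit K g (\<lambda>z. \<Sum>k\<in>S. of_real (c k) * z ^ k) F"
    and "\<forall>\<^sub>F e in F. g e holomorphic_on \<Omega> \<and> (\<forall>x. of_real x \<in> \<Omega> \<longrightarrow> g e (of_real x) \<in> \<real>)"
  shows "\<forall>\<^sub>F e in F. finite {x \<in> {a..b}. g e (of_real x) = 0} \<and> card {x \<in> {a..b}. g e (of_real x) = 0} < card S"
  using assms(4-)
proof (induction "card S" arbitrary: S c g)
  case 0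
  then show ?case by simp
next
  case (Suc m)
  define k0 where "k0 = Min S"
  have k0: "k0 \<in> S" using Suc by (simp add: k0_def)
  define g0 where "g0 z = (\<Sum>k\<in>S. of_real (c k) * z ^ k)" for z :: complex
  have holo0: "g0 holomorphic_on A" for A unfolding g0_def by (intro holomorphic_intros)
  have lim: "uniform_limit K g g0 F" if "compact K" "K \<subseteq> \<Omega>" for K
    unfolding g0_def using Suc.prems(4) that by blast
  have ev: "\<forall>\<^sub>F e in F. g e holomorphic_on \<Omega>" using Suc.prems(5) by eventually_elim auto
  have compab: "compact (of_real ` {a..b} :: complex set)"
    by (intro compact_continuous_image continuous_intros) auto
  show ?case
  proof (cases "S = {k0}")
    case True
    have ck: "c k0 \<noteq> 0" using Suc.prems(3) k0 by blast
    \<comment> \<open>A single monomial is at least \<open>\<bar>c k0\<bar> * a ^ k0\<close> in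
      modulus on \<open>{a..b}\<close>; a function closer to it than that has no zero there.\<close>
    have "0 < \<bar>c k0\<bar> * a ^ k0" using ck ab(1) by simp
    from uniform_limitD[OF lim[OF compab ab(2)] this]
    show ?thesis
    proof eventually_elim
      case (elim e)
      have "g e (of_real x) \<noteq> 0" if x: "x \<in> {a..b}" for x
      proof
        assume "g e (of_real x) = 0"
        then have "norm (g0 (of_real x)) < \<bar>c k0\<bar> * a ^ k0" using elim x by (force simp: dist_norm norm_minus_commute)
        moreover have "norm (g0 (of_real x)) = \<bar>c k0\<bar> * x ^ k0"
          using True x ab(1) by (simp add: g0_def norm_mult norm_power)
        moreover have "\<bar>c k0\<bar> * a ^ k0 \<le> \<bar>c k0\<bar> * x ^ k0"
          using x ab(1) by (intro mult_left_mono power_mono) auto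
        ultimately show False by simp
      qed
      then have "{x \<in> {a..b}. g e (of_real x) = 0} = {}" by blast
      then show ?case using True by (metis card.empty card.infinite card_gt_0_iff finite.emptyI Suc.prems(1) Suc.prems(2))
    qed
  next
    case False
    \<comment> \<open>The limit of \<open>h\<close> has the coefficients \<open>c' k\<close>, and
      among the \<open>k\<close> in \<open>S\<close> these vanish for \<open>k0\<close> only. So
      exactly one monomial disappears, and the others keep nonzero coefficients.\<close>
    define h where "h e z = z * deriv (g e) z - of_nat k0 * g e z" for e z
    define S' where "S' = S - {k0}"
    define c' where "c' k = c k * (of_nat k - of_nat k0)" for k
    have S': "card S' = m" "finite S'" "S' \<noteq> {}"
      using Suc.hyps(2) Suc.prems k0 False by (auto simp: S'_def)
    have dg0: "deriv g0 z = (\<Sum>k\<in>S. of_real (c k) * (of_nat k * z ^ (k - 1)))" for z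
      unfolding g0_def by (rule DERIV_imp_deriv) (auto intro!: derivative_eq_intros sum.cong)
    have h0: "(\<Sum>k\<in>S'. of_real (c' k) * z ^ k) = z * deriv g0 z - of_nat k0 * g0 z" for z
    proof -
      have "z * deriv g0 z - of_nat k0 * g0 z = (\<Sum>k\<in>S. of_real (c' k) * z ^ k)"
      proof -
        have "z * (of_real (c k) * (of_nat k * z ^ (k - 1))) - of_nat k0 * (of_real (c k) * z ^ k) = of_real (c' k) * z ^ k" for k
          by (cases k) (auto simp: c'_def algebra_simps)
        then show ?thesis by (simp add: dg0 g0_def sum_distrib_left sum_subtractf[symmetric])
      qed
      also have "\<dots> = (\<Sum>k\<in>S'. of_real (c' k) * z ^ k)"
        by (rule sum.mono_neutral_right) (use Suc.prems in \<open>auto simp: S'_def c'_def\<close>)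
      finally show ?thesis by simp
    qed
    have "\<forall>\<^sub>F e in F. finite {x \<in> {a..b}. h e (of_real x) = 0} \<and> card {x \<in> {a..b}. h e (of_real x) = 0} < card S'"
    proof (rule Suc.hyps(1)[of S' c' h])
      show "c' k \<noteq> 0" if "k \<in> S'" for k using that Suc.prems(3) by (auto simp: S'_def c'_def)
      show "uniform_limit K h (\<lambda>z. \<Sum>k\<in>S'. of_real (c' k) * z ^ k) F" if K: "compact K" "K \<subseteq> \<Omega>" for K
      proof -
        have b: "bounded (q ` K)" if "continuous_on K q" for q :: "complex \<Rightarrow> complex"
          using K(1) that compact_continuous_image compact_imp_bounded by blast
        have "uniform_limit K h (\<lambda>z. z * deriv g0 z - of_nat k0 * g0 z) F"
          unfolding h_def
          by (intro uniform_limit_intros uniform_lim_mult uniform_limit_deriv[OF \<Omega> lim ev holo0 K] lim[OF K] b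
              continuous_intros holomorphic_on_imp_continuous_on holo0 holomorphic_deriv[of g0 UNIV, THEN holomorphic_on_subset]) auto
        then show ?thesis by (simp add: h0)
      qed
      show "\<forall>\<^sub>F e in F. h e holomorphic_on \<Omega> \<and> (\<forall>x. of_real x \<in> \<Omega> \<longrightarrow> h e (of_real x) \<in> \<real>)"
        using Suc.prems(5)
      proof eventually_elim
        case (elim e)
        show ?case unfolding h_def using elim \<Omega> deriv_real(1)[of "g e" \<Omega>]
          by (auto intro!: holomorphic_intros)
      qed
    qed (use S' in auto)
    with Suc.prems(5) show ?thesis
    proof eventually_elim
      case (elim e)
      \<comment> \<open>On the positive interval \<open>f\<close> has the zeros of
        \<open>g e\<close>, and its derivative \<open>f'\<close> those of \<open>h e\<close>;
        Rolle's theorem adds at most one to the count of the induction hypothesis.\<close>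
      define f where "f x = Re (g e (of_real x)) / x ^ k0" for x
      define f' where "f' x = Re (h e (of_real x)) / x ^ Suc k0" for x
      have inO: "of_real x \<in> \<Omega>" if "x \<in> {a..b}" for x using that ab(2) by blast
      have hreal: "h e (of_real x) \<in> \<real>" if "x \<in> {a..b}" for x
        unfolding h_def using elim(1) \<Omega> inO[OF that] deriv_real(1)[of "g e" \<Omega> x] by auto
      have zf: "{x \<in> {a..b}. f x = 0} = {x \<in> {a..b}. g e (of_real x) = 0}"
        using elim(1) inO ab(1) by (auto simp: f_def complex_eq_iff complex_is_Real_iff)
      have zf': "{x \<in> {a..b}. f' x = 0} = {x \<in> {a..b}. h e (of_real x) = 0}"
        using hreal ab(1) by (auto simp: f'_def complex_eq_iff complex_is_Real_iff)
      have der: "(f has_real_derivative f' x) (at x)" if x: "x \<in> {a..b}" for x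
      proof -
        have x0: "x \<noteq> 0" using x ab(1) by auto
        have "((\<lambda>y. Re (g e (of_real y))) has_real_derivative Re (deriv (g e) (of_real x))) (at x)"
          using elim(1) \<Omega> inO[OF x] by (intro deriv_real(2)) auto
        then have "(f has_real_derivative (Re (deriv (g e) (of_real x)) * x ^ k0 - Re (g e (of_real x)) * (of_nat k0 * x ^ (k0 - 1))) / (x ^ k0 * x ^ k0)) (at x)"
          unfolding f_def by (intro DERIV_divide DERIV_pow[THEN DERIV_cong]) (use x0 in auto)
        also have "(Re (deriv (g e) (of_real x)) * x ^ k0 - Re (g e (of_real x)) * (of_nat k0 * x ^ (k0 - 1))) / (x ^ k0 * x ^ k0) = f' x"
          using x0 by (cases k0) (auto simp: f'_def h_def field_simps)
        finally show ?thesis .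
      qed
      from card_zeros_Rolle[OF der, of a b] elim(2) have "finite {x \<in> {a..b}. f x = 0} \<and> card {x \<in> {a..b}. f x = 0} \<le> Suc (card {x \<in> {a..b}. f' x = 0})"
        unfolding zf' by blast
      then show ?case using elim(2) S'(1) Suc.hyps(2) unfolding zf zf' by linarith
    qed
  qed
qed

section \<open>Holomorphic flows\<close>

lemma integral_in_Reals:
  assumes "f integrable_on S" "\<And>x. x \<in> S \<Longrightarrow> f x \<in> \<real>"
  shows "integral S f \<in> (\<real> :: complex set)"
proof -
  have "Im (integral S f) = integral S (Im \<circ> f)"
    using integral_linear[OF assms(1) bounded_linear_Im] by simp
  also have "\<dots> = integral S (\<lambda>_. 0)"
    by (rule integral_cong) (use assms(2) in \<open>auto simp: complex_is_Real_iff\<close>)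
  finally show ?thesis by (simp add: complex_is_Real_iff)
qed

text \<open>Picard iteration. The properties wanted of the flow are collected in \<open>ok\<close>,
  which holds for the constant flow, is preserved by the Picard operator \<open>P\<close> and passes
  to uniform limits. The estimate on \<open>u s z - u s w - (z - w)\<close> says that the flow is
  Lipschitz close to the identity; it later makes the return map increasing.\<close>

lemma holomorphic_flow:
  fixes F :: "real \<Rightarrow> complex \<Rightarrow> complex"
  assumes L: "0 \<le> L" and D: "open D" and E: "open E" and M: "0 \<le> M" and K: "0 \<le> K" "K * L \<le> 1 / 2"
    and cont: "continuous_on ({0..L} \<times> E) (\<lambda>(s, z). F s z)"
    and bound: "\<And>s z. s \<in> {0..L} \<Longrightarrow> z \<in> E \<Longrightarrow> norm (F s z) \<le> M"
    and lip: "\<And>s z w. s \<in> {0..L} \<Longrightarrow> z \<in> E \<Longrightarrow> w \<in> E \<Longrightarrow> norm (F s z - F s w) \<le> K * norm (z - w)"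
    and hol: "\<And>s. s \<in> {0..L} \<Longrightarrow> F s holomorphic_on E"
    and real: "\<And>s x. s \<in> {0..L} \<Longrightarrow> of_real x \<in> E \<Longrightarrow> F s (of_real x) \<in> \<real>"
    and start: "\<And>z. z \<in> D \<Longrightarrow> cball z (M * L) \<subseteq> E"
  obtains u where "\<And>z. z \<in> D \<Longrightarrow> u 0 z = z"
    "\<And>s z. s \<in> {0..L} \<Longrightarrow> z \<in> D \<Longrightarrow> norm (u s z - z) \<le> M * s"
    "\<And>s z. s \<in> {0..L} \<Longrightarrow> z \<in> D \<Longrightarrow> ((\<lambda>s. u s z) has_vector_derivative F s (u s z)) (at s within {0..L})"
    "\<And>s. s \<in> {0..L} \<Longrightarrow> u s holomorphic_on D"
    "\<And>s z w. s \<in> {0..L} \<Longrightarrow> z \<in> D \<Longrightarrow> w \<in> D \<Longrightarrow>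
       norm (u s z - u s w - (z - w)) \<le> 2 * K * L * norm (z - w)"
    "\<And>s x. s \<in> {0..L} \<Longrightarrow> of_real x \<in> D \<Longrightarrow> u s (of_real x) \<in> \<real>"
proof -
  have cF: "continuous_on S (\<lambda>p. F (a p) (b p))"
    if "continuous_on S a" "continuous_on S b" "\<And>p. p \<in> S \<Longrightarrow> a p \<in> {0..L}" "\<And>p. p \<in> S \<Longrightarrow> b p \<in> E"
    for S a and b :: "'d::topological_space \<Rightarrow> complex"
    using continuous_on_compose2[OF cont, of S "\<lambda>p. (a p, b p)"] that
    by (force intro: continuous_on_Pair)
  define ok where "ok v \<longleftrightarrow>
      (\<forall>z\<in>D. \<forall>s\<in>{0..L}. norm (v s z - z) \<le> M * s) \<and>
      (\<forall>z\<in>D. \<forall>s\<in>{0..L}. \<forall>s'\<in>{0..L}. norm (v s z - v s' z) \<le> M * \<bar>s - s'\<bar>) \<and>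
      (\<forall>z\<in>D. \<forall>w\<in>D. \<forall>s\<in>{0..L}. norm (v s z - v s w - (z - w)) \<le> 2 * K * L * norm (z - w)) \<and>
      (\<forall>s\<in>{0..L}. v s holomorphic_on D) \<and>
      (\<forall>x. \<forall>s\<in>{0..L}. of_real x \<in> D \<longrightarrow> v s (of_real x) \<in> \<real>)" for v
  have okE: "v s z \<in> E" if "ok v" "s \<in> {0..L}" "z \<in> D" for v s z
  proof -
    have "norm (v s z - z) \<le> M * s" using that by (auto simp: ok_def)
    also have "\<dots> \<le> M * L" using that M by (auto intro: mult_left_mono)
    finally have "v s z \<in> cball z (M * L)" by (simp add: dist_norm norm_minus_commute)
    then show ?thesis using start that by blast
  qed
  \<comment> \<open>The factor 2 bounds \<open>1 + 2 * K * L\<close>.\<close>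
  have oklip: "norm (v s z - v s w) \<le> 2 * norm (z - w)" if "ok v" "s \<in> {0..L}" "z \<in> D" "w \<in> D" for v s z w
  proof -
    have "norm (v s z - v s w - (z - w)) \<le> 2 * K * L * norm (z - w)" using that by (auto simp: ok_def)
    also have "\<dots> \<le> 1 * norm (z - w)" using K by (intro mult_right_mono) auto
    finally show ?thesis using norm_triangle_sub[of "v s z - v s w" "z - w"] by simp
  qed
  have okcont: "continuous_on {0..L} (\<lambda>s. F s (v s z))" if "ok v" "z \<in> D" for v z
  proof (rule cF)
    have "M-lipschitz_on {0..L} (\<lambda>s. v s z)"
      using that M by (auto simp: ok_def lipschitz_on_def dist_norm)
    then show "continuous_on {0..L} (\<lambda>s. v s z)" by (rule lipschitz_on_continuous_on)
  qed (use okE that in auto)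
  \<comment> \<open>The Lipschitz constants \<open>M\<close> in time and 2 in the initial value give
    joint continuity, on which the holomorphy of the Picard integral rests.\<close>
  have okjoint: "continuous_on ({0..L} \<times> D) (\<lambda>p. v (fst p) (snd p))" if "ok v" for v
  proof -
    have "(M + 2)-lipschitz_on ({0..L} \<times> D) (\<lambda>p. v (fst p) (snd p))"
    proof (rule lipschitz_onI)
      fix p q assume "p \<in> {0..L} \<times> D" "q \<in> {0..L} \<times> D"
      then obtain s z s' w where pq: "p = (s, z)" "q = (s', w)" "s \<in> {0..L}" "s' \<in> {0..L}" "z \<in> D" "w \<in> D" by auto
      have "dist (v s z) (v s' w) \<le> norm (v s z - v s' z) + norm (v s' z - v s' w)"
        by (metis dist_norm dist_triangle)
      also have "\<dots> \<le> M * \<bar>s - s'\<bar> + 2 * norm (z - w)"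
        using that pq by (intro add_mono oklip) (auto simp: ok_def)
      also have "\<dots> \<le> M * dist p q + 2 * dist p q"
        using M dist_fst_le[of p q] dist_snd_le[of p q]
        by (intro add_mono mult_left_mono) (auto simp: pq dist_norm)
      finally show "dist (v (fst p) (snd p)) (v (fst q) (snd q)) \<le> (M + 2) * dist p q"
        by (simp add: pq algebra_simps)
    qed (use M in auto)
    then show ?thesis by (rule lipschitz_on_continuous_on)
  qed
  define P where "P v s z = z + integral {0..s} (\<lambda>\<tau>. F \<tau> (v \<tau> z))" for v s z
  have int: "(\<lambda>\<tau>. F \<tau> (v \<tau> z)) integrable_on {a..b}" if "ok v" "z \<in> D" "0 \<le> a" "b \<le> L" for v z a b
    by (intro integrable_continuous_interval continuous_on_subset[OF okcont]) (use that in auto)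
  have okP: "ok (P v)" if v: "ok v" for v
    unfolding ok_def
  proof (intro conjI ballI allI impI)
    fix z s assume z: "z \<in> D" and s: "s \<in> {0..L}"
    have "norm (integral {0..s} (\<lambda>\<tau>. F \<tau> (v \<tau> z))) \<le> M * (s - 0)"
      by (rule integral_bound) (use s okE[OF v _ z] bound in \<open>auto intro!: continuous_on_subset[OF okcont[OF v z]]\<close>)
    then show "norm (P v s z - z) \<le> M * s" by (simp add: P_def)
  next
    fix z s s' assume z: "z \<in> D" and s: "s \<in> {0..L}" "s' \<in> {0..L}"
    have *: "norm (P v b z - P v a z) \<le> M * (b - a)" if "a \<le> b" "a \<in> {0..L}" "b \<in> {0..L}" for a b
    proof -
      have "integral {0..a} (\<lambda>\<tau>. F \<tau> (v \<tau> z)) + integral {a..b} (\<lambda>\<tau>. F \<tau> (v \<tau> z)) = integral {0..b} (\<lambda>\<tau>. F \<tau> (v \<tau> z))"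
        by (rule Henstock_Kurzweil_Integration.integral_combine) (use that int[OF v z] in auto)
      then have "P v b z - P v a z = integral {a..b} (\<lambda>\<tau>. F \<tau> (v \<tau> z))" by (simp add: P_def algebra_simps)
      also have "norm \<dots> \<le> M * (b - a)"
        by (rule integral_bound) (use that okE[OF v _ z] bound in \<open>auto intro!: continuous_on_subset[OF okcont[OF v z]]\<close>)
      finally show ?thesis .
    qed
    show "norm (P v s z - P v s' z) \<le> M * \<bar>s - s'\<bar>"
      using *[of s s'] *[of s' s] s by (cases "s \<le> s'") (auto simp: norm_minus_commute)
  next
    fix z w s assume z: "z \<in> D" and w: "w \<in> D" and s: "s \<in> {0..L}"
    have "norm (integral {0..s} (\<lambda>\<tau>. F \<tau> (v \<tau> z) - F \<tau> (v \<tau> w))) \<le> (K * (2 * norm (z - w))) * (s - 0)"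
    proof (rule integral_bound)
      show "continuous_on {0..s} (\<lambda>\<tau>. F \<tau> (v \<tau> z) - F \<tau> (v \<tau> w))"
        using s by (intro continuous_intros continuous_on_subset[OF okcont[OF v]] z w) auto
      fix t assume "t \<in> {0..s}"
      then have t: "t \<in> {0..L}" using s by auto
      have "norm (F t (v t z) - F t (v t w)) \<le> K * norm (v t z - v t w)"
        by (intro lip okE v t z w)
      also have "\<dots> \<le> K * (2 * norm (z - w))"
        using v t z w K by (intro mult_left_mono oklip) auto
      finally show "norm (F t (v t z) - F t (v t w)) \<le> K * (2 * norm (z - w))" .
    qed (use s in auto)
    also have "integral {0..s} (\<lambda>\<tau>. F \<tau> (v \<tau> z) - F \<tau> (v \<tau> w)) = (P v s z - P v s w) - (z - w)"
      using s int[OF v z] int[OF v w] by (subst integral_diff) (auto simp: P_def)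
    also have "(K * (2 * norm (z - w))) * (s - 0) \<le> (K * (2 * norm (z - w))) * L"
      using s K by (intro mult_left_mono) auto
    finally show "norm (P v s z - P v s w - (z - w)) \<le> 2 * K * L * norm (z - w)"
      by (simp add: mult_ac)
  next
    fix s assume s: "s \<in> {0..L}"
    have "(\<lambda>z. integral {0..s} (\<lambda>\<tau>. F \<tau> (v \<tau> z))) holomorphic_on D"
    proof (rule holomorphic_on_integral[OF D])
      show "continuous_on ({0..s} \<times> D) (\<lambda>(t, z). F t (v t z))"
        unfolding case_prod_beta
        by (intro cF continuous_intros continuous_on_subset[OF okjoint[OF v]]) (use s okE[OF v] in auto)
      fix t assume "t \<in> {0..s}"
      then have t: "t \<in> {0..L}" using s by auto
      have "(F t \<circ> v t) holomorphic_on D"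
        by (rule holomorphic_on_compose_gen[OF _ hol[OF t]]) (use v t okE[OF v t] in \<open>auto simp: ok_def\<close>)
      then show "(\<lambda>z. F t (v t z)) holomorphic_on D" by (simp add: o_def)
    qed
    then show "P v s holomorphic_on D" unfolding P_def by (intro holomorphic_intros)
  next
    fix x s assume s: "s \<in> {0..L}" and x: "complex_of_real x \<in> D"
    have "integral {0..s} (\<lambda>\<tau>. F \<tau> (v \<tau> (of_real x))) \<in> \<real>"
    proof (rule integral_in_Reals)
      fix t assume "t \<in> {0..s}"
      then have t: "t \<in> {0..L}" using s by auto
      have "v t (of_real x) \<in> \<real>" using v t x by (auto simp: ok_def)
      then obtain y where "v t (of_real x) = of_real y" by (auto elim: Reals_cases)
      then show "F t (v t (of_real x)) \<in> \<real>" using real[OF t, of y] okE[OF v t x] by simp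
    qed (use int[OF v x] s in auto)
    then show "P v s (of_real x) \<in> \<real>" by (simp add: P_def)
  qed
  define U where "U k = (P ^^ k) (\<lambda>s z. z)" for k
  have US: "U (Suc k) = P (U k)" for k by (simp add: U_def)
  have U0: "U 0 = (\<lambda>s z. z)" by (simp add: U_def)
  have okU: "ok (U k)" for k
  proof (induction k)
    case 0
    show ?case unfolding U0 ok_def using M K L by auto
  qed (simp add: US okP)
  \<comment> \<open>Since \<open>K * L \<le> 1 / 2\<close>, the Picard operator halves differences,
    whence the geometric majorant.\<close>
  have step: "norm (U (Suc k) s z - U k s z) \<le> M * L * (1/2) ^ k" if "s \<in> {0..L}" "z \<in> D" for k s z
    using that
  proof (induction k arbitrary: s)
    case 0
    have "norm (P (U 0) s z - z) \<le> M * s" using okP[OF okU[of 0]] 0 by (auto simp: ok_def)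
    also have "\<dots> \<le> M * L" using 0 M by (auto intro: mult_left_mono)
    finally show ?case by (simp add: US U0)
  next
    case (Suc k)
    have "norm (integral {0..s} (\<lambda>\<tau>. F \<tau> (U (Suc k) \<tau> z) - F \<tau> (U k \<tau> z))) \<le> (K * (M * L * (1/2) ^ k)) * (s - 0)"
    proof (rule integral_bound)
      show "continuous_on {0..s} (\<lambda>\<tau>. F \<tau> (U (Suc k) \<tau> z) - F \<tau> (U k \<tau> z))"
        using Suc.prems by (intro continuous_intros continuous_on_subset[OF okcont[OF okU]]) auto
      fix t assume "t \<in> {0..s}"
      then have t: "t \<in> {0..L}" using Suc.prems by auto
      have "norm (F t (U (Suc k) t z) - F t (U k t z)) \<le> K * norm (U (Suc k) t z - U k t z)"
        by (intro lip okE okU t Suc.prems)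
      also have "\<dots> \<le> K * (M * L * (1/2) ^ k)"
        using Suc.IH[OF t Suc.prems(2)] K by (intro mult_left_mono) auto
      finally show "norm (F t (U (Suc k) t z) - F t (U k t z)) \<le> K * (M * L * (1/2) ^ k)" .
    qed (use Suc.prems in auto)
    also have "integral {0..s} (\<lambda>\<tau>. F \<tau> (U (Suc k) \<tau> z) - F \<tau> (U k \<tau> z)) = U (Suc (Suc k)) s z - U (Suc k) s z"
    proof -
      have "U (Suc (Suc k)) s z = z + integral {0..s} (\<lambda>\<tau>. F \<tau> (U (Suc k) \<tau> z))"
        unfolding US[of "Suc k"] P_def ..
      moreover have "U (Suc k) s z = z + integral {0..s} (\<lambda>\<tau>. F \<tau> (U k \<tau> z))"
        unfolding US[of k] P_def ..
      ultimately show ?thesis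
        using Suc.prems(1) int[OF okU Suc.prems(2)] by (subst integral_diff) auto
    qed
    also have "(K * (M * L * (1/2) ^ k)) * (s - 0) \<le> M * L * (1/2) ^ Suc k"
    proof -
      have "K * s \<le> K * L" using Suc.prems K by (intro mult_left_mono) auto
      then have "K * s \<le> 1 / 2" using K by linarith
      from mult_right_mono[OF this, of "M * L * (1/2) ^ k"] M L show ?thesis by (simp add: mult_ac)
    qed
    finally show ?case .
  qed
  \<comment> \<open>The limit is written as a telescoping series so that the Weierstrass test gives
    uniform convergence.\<close>
  define u where "u s z = z + (\<Sum>i. U (Suc i) s z - U i s z)" for s z
  have "uniform_limit ({0..L} \<times> D) (\<lambda>n p. \<Sum>i<n. U (Suc i) (fst p) (snd p) - U i (fst p) (snd p))
      (\<lambda>p. \<Sum>i. U (Suc i) (fst p) (snd p) - U i (fst p) (snd p)) sequentially"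
    by (rule Weierstrass_m_test[where M="\<lambda>k. M * L * (1/2) ^ k"])
       (use step in \<open>auto intro!: summable_mult summable_geometric\<close>)
  then have "uniform_limit ({0..L} \<times> D) (\<lambda>n p. snd p + (\<Sum>i<n. U (Suc i) (fst p) (snd p) - U i (fst p) (snd p)))
      (\<lambda>p. snd p + (\<Sum>i. U (Suc i) (fst p) (snd p) - U i (fst p) (snd p))) sequentially"
    by (intro uniform_limit_intros)
  moreover have "snd p + (\<Sum>i<n. U (Suc i) (fst p) (snd p) - U i (fst p) (snd p)) = U n (fst p) (snd p)" for n p
    by (subst sum_lessThan_telescope) (simp add: U0)
  ultimately have unif: "uniform_limit ({0..L} \<times> D) (\<lambda>n p. U n (fst p) (snd p)) (\<lambda>p. u (fst p) (snd p)) sequentially"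
    by (simp add: u_def)
  have lim: "(\<lambda>n. U n s z) \<longlonglongrightarrow> u s z" if "s \<in> {0..L}" "z \<in> D" for s z
    using tendsto_uniform_limitI[OF unif, of "(s, z)"] that by simp
  have oku: "ok u" unfolding ok_def
  proof (intro conjI ballI allI impI)
    fix z s assume zs: "z \<in> D" "s \<in> {0..L}"
    show "norm (u s z - z) \<le> M * s"
      by (rule Lim_norm_ubound[OF _ tendsto_diff[OF lim tendsto_const]])
         (use zs okU in \<open>auto simp: ok_def\<close>)
  next
    fix z s s' assume zs: "z \<in> D" "s \<in> {0..L}" "s' \<in> {0..L}"
    show "norm (u s z - u s' z) \<le> M * \<bar>s - s'\<bar>"
      by (rule Lim_norm_ubound[OF _ tendsto_diff[OF lim lim]])
         (use zs okU in \<open>auto simp: ok_def\<close>)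
  next
    fix z w s assume zs: "z \<in> D" "w \<in> D" "s \<in> {0..L}"
    show "norm (u s z - u s w - (z - w)) \<le> 2 * K * L * norm (z - w)"
      by (rule Lim_norm_ubound[OF _ tendsto_diff[OF tendsto_diff[OF lim lim] tendsto_const]])
         (use zs okU in \<open>auto simp: ok_def\<close>)
  next
    fix s assume s: "s \<in> {0..L}"
    have ul: "uniform_limit D (\<lambda>n. U n s) (u s) sequentially"
    proof (rule uniform_limitI)
      fix e :: real assume "0 < e"
      from uniform_limitD[OF unif this] show "\<forall>\<^sub>F n in sequentially. \<forall>z\<in>D. dist (U n s z) (u s z) < e"
        by eventually_elim (use s in auto)
    qed
    show "u s holomorphic_on D"
    proof (rule holomorphic_uniform_sequence[OF D])
      show "U n s holomorphic_on D" for n using okU[of n] s by (auto simp: ok_def)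
      fix x assume "x \<in> D"
      then obtain d where "0 < d" "cball x d \<subseteq> D" using D open_contains_cball by blast
      then show "\<exists>d>0. cball x d \<subseteq> D \<and> uniform_limit (cball x d) (\<lambda>n. U n s) (u s) sequentially"
        using uniform_limit_on_subset[OF ul] by blast
    qed
  next
    fix x s assume s: "s \<in> {0..L}" "complex_of_real x \<in> D"
    show "u s (of_real x) \<in> \<real>"
      by (rule closed_sequentially[OF closed_complex_Reals _ lim[OF s]]) (use okU s in \<open>auto simp: ok_def\<close>)
  qed
  \<comment> \<open>\<open>U (Suc n)\<close> tends to \<open>u\<close> and, being
    \<open>P (U n)\<close>, also to \<open>P u\<close>.\<close>
  have fixp: "u s z = P u s z" if s: "s \<in> {0..L}" and z: "z \<in> D" for s z
  proof (rule LIMSEQ_unique[OF LIMSEQ_Suc[OF lim[OF s z]]], rule LIMSEQ_I)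
    fix e :: real assume e: "0 < e"
    from uniform_limitD[OF unif this] obtain N where N: "\<And>n \<tau>. N \<le> n \<Longrightarrow> \<tau> \<in> {0..L} \<Longrightarrow> dist (U n \<tau> z) (u \<tau> z) < e"
      unfolding eventually_sequentially using z by fastforce
    have "norm (U (Suc n) s z - P u s z) < e" if n: "N \<le> n" for n
    proof -
      have "norm (integral {0..s} (\<lambda>\<tau>. F \<tau> (U n \<tau> z) - F \<tau> (u \<tau> z))) \<le> (K * e) * (s - 0)"
      proof (rule integral_bound)
        show "continuous_on {0..s} (\<lambda>\<tau>. F \<tau> (U n \<tau> z) - F \<tau> (u \<tau> z))"
          using s by (intro continuous_intros continuous_on_subset[OF okcont] okU oku z) auto
        fix t assume "t \<in> {0..s}"
        then have t: "t \<in> {0..L}" using s by auto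
        have "norm (F t (U n t z) - F t (u t z)) \<le> K * norm (U n t z - u t z)"
          by (intro lip okE okU oku t z)
        also have "\<dots> \<le> K * e"
          using N[OF n t] K by (intro mult_left_mono) (auto simp: dist_norm)
        finally show "norm (F t (U n t z) - F t (u t z)) \<le> K * e" .
      qed (use s in auto)
      also have "integral {0..s} (\<lambda>\<tau>. F \<tau> (U n \<tau> z) - F \<tau> (u \<tau> z)) = U (Suc n) s z - P u s z"
        using s int[OF okU z] int[OF oku z] by (subst integral_diff) (auto simp: P_def US)
      also have "(K * e) * (s - 0) \<le> e / 2"
      proof -
        have "K * s \<le> K * L" using s K by (intro mult_left_mono) auto
        then have "K * s \<le> 1 / 2" using K by linarith
        from mult_right_mono[OF this, of e] e show ?thesis by (simp add: mult_ac)
      qed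
      finally show ?thesis using e by simp
    qed
    then show "\<exists>N. \<forall>n\<ge>N. norm (U (Suc n) s z - P u s z) < e" by blast
  qed
  show ?thesis
  proof (rule that[of u])
    show "((\<lambda>s. u s z) has_vector_derivative F s (u s z)) (at s within {0..L})" if s: "s \<in> {0..L}" and z: "z \<in> D" for s z
    proof -
      have "((\<lambda>s. integral {0..s} (\<lambda>\<tau>. F \<tau> (u \<tau> z))) has_vector_derivative F s (u s z)) (at s within {0..L})"
        by (rule integral_has_vector_derivative[OF okcont[OF oku z] s])
      then have "((\<lambda>s. P u s z) has_vector_derivative F s (u s z)) (at s within {0..L})"
        unfolding P_def by (auto intro!: derivative_eq_intros)
      then show ?thesis
        by (rule has_vector_derivative_transform[OF s, rotated]) (simp add: fixp z)
    qed
    show "u 0 z = z" if "z \<in> D" for z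
    proof -
      have "0 \<in> {0..L}" using L by simp
      then have "norm (u 0 z - z) \<le> M * 0" using oku that unfolding ok_def by blast
      then show ?thesis by simp
    qed
  qed (use oku in \<open>auto simp: ok_def\<close>)
qed

section \<open>Polar coordinates adapted to the center\<close>

locale center =
  fixes n :: nat and c :: real
  assumes n1: "n \<ge> 1" and c: "c < - 1 / 4"
begin

abbreviation V :: "plane \<Rightarrow> real" where "V \<equiv> inv_int_factor n c"
abbreviation H :: "plane \<Rightarrow> real" where "H \<equiv> first_integral n c"
abbreviation X0 :: "plane \<Rightarrow> plane" where "X0 \<equiv> center_field n c"

section \<open>The first integral through one complex function\<close>

definition \<delta> :: real where "\<delta> = sqrt (- (1 + 4 * c))"
definition \<mu> :: complex where "\<mu> = Complex (1/2) (\<delta>/2)"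
definition w :: "plane \<Rightarrow> complex" where "w z = of_real (snd z) + \<mu> * of_real (fst z ^ (2 * n))"
text \<open>Chosen so that the real part of \<open>\<nu> * Ln w\<close> is
  \<open>2 * ln (cmod w) - 2 * Arg w / \<delta>\<close>, the logarithm of the first
  integral.\<close>

definition \<nu> :: complex where "\<nu> = Complex 2 (2/\<delta>)"

lemma \<delta>_pos: "\<delta> > 0" and \<delta>2: "\<delta> * \<delta> = - (1 + 4 * c)"
  using c by (auto simp: \<delta>_def)

lemma w_Re: "Re (w z) = snd z + fst z ^ (2 * n) / 2"
  and w_Im: "Im (w z) = \<delta> / 2 * fst z ^ (2 * n)"
  by (simp_all add: w_def \<mu>_def)

text \<open>Completing the square. For \<open>c < - 1 / 4\<close> the two factors of
  \<open>V\<close> that are linear in \<open>y\<close> are complex conjugate, so their product is a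
  squared modulus; positivity off the origin follows.\<close>

lemma V_eq: "V z = (cmod (w z))\<^sup>2"
proof -
  have "fst z ^ (4 * n) = (fst z ^ (2 * n))\<^sup>2" by (simp add: power_mult[symmetric] mult.commute)
  moreover have "(\<delta> / 2 * X)\<^sup>2 = - (1 + 4 * c) / 4 * X\<^sup>2" for X
    using \<delta>2 by (simp add: power_mult_distrib power_divide power2_eq_square)
  moreover have "Y\<^sup>2 + X * Y - c * X\<^sup>2 = (Y + X / 2)\<^sup>2 + - (1 + 4 * c) / 4 * X\<^sup>2" for X Y
    by (simp add: power2_eq_square field_simps)
  ultimately show ?thesis
    unfolding cmod_power2 w_Re w_Im inv_int_factor_def case_prod_beta by simp
qed

lemma V_pos: "V z > 0" if "z \<noteq> 0"
proof -
  have "w z \<noteq> 0"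
  proof
    assume "w z = 0"
    then have "Re (w z) = 0" "Im (w z) = 0" by auto
    then have "fst z = 0" unfolding w_Im using \<delta>_pos by auto
    moreover from this \<open>Re (w z) = 0\<close> have "snd z = 0" unfolding w_Re using n1 by (simp add: power_0_left)
    ultimately have "fst z = 0" "snd z = 0" by auto
    then show False using that by (simp add: prod_eq_iff)
  qed
  then show ?thesis by (simp add: V_eq)
qed

lemma not_slit: "- \<i> * w z \<notin> \<real>\<^sub>\<le>\<^sub>0" if "z \<noteq> 0"
proof
  assume "- \<i> * w z \<in> \<real>\<^sub>\<le>\<^sub>0"
  then have "Im (w z) \<le> 0" "Re (w z) = 0" by (auto simp: complex_nonpos_Reals_iff)
  moreover have "0 \<le> Im (w z)" unfolding w_Im using \<delta>_pos by simp
  ultimately have "w z = 0" by (intro complex_eqI) auto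
  then show False using V_pos[OF that] by (simp add: V_eq)
qed

text \<open>Since \<open>Im w \<ge> 0\<close>, rotating by \<open>-\<i>\<close> moves \<open>w\<close> away from the branch cut, which makes the
  first integral manifestly smooth.\<close>

definition lnH :: "plane \<Rightarrow> real" where "lnH z = Re (\<nu> * Ln (- \<i> * w z)) - pi / \<delta>"

lemma \<mu>_eq: "\<mu> = (1 + \<i> * of_real \<delta>) / 2"
  by (simp add: \<mu>_def complex_eq_iff)

lemma H_eq: "H z = (cmod (w z))\<^sup>2 * exp (- 2 * Arg (w z) / \<delta>)"
  unfolding first_integral_def case_prod_beta Let_def w_def \<mu>_eq \<delta>_def ..

text \<open>The rotation moves the arguments from \<open>[0, pi]\<close> to
  \<open>[- pi / 2, pi / 2]\<close> and adds \<open>pi / \<delta>\<close> to the real part of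
  \<open>\<nu> * Ln w\<close>; this is what \<open>lnH\<close> subtracts.\<close>

lemma H_eq_exp: "H z = exp (lnH z)" if "z \<noteq> 0"
proof -
  have w0: "w z \<noteq> 0" using V_pos[OF that] by (auto simp: V_eq)
  have Im: "0 \<le> Im (w z)" unfolding w_Im using \<delta>_pos by simp
  have "Ln (- \<i> * w z) = Ln (w z) - \<i> * pi / 2"
  proof (rule Ln_unique)
    have "exp (Ln (w z) - \<i> * pi / 2) = exp (Ln (w z)) / exp (\<i> * complex_of_real (pi / 2))"
      by (subst exp_diff) simp
    also have "exp (\<i> * complex_of_real (pi / 2)) = \<i>"
      unfolding cis_conv_exp[symmetric] by simp
    finally show "exp (Ln (w z) - \<i> * pi / 2) = - \<i> * w z"
      using w0 by (simp add: field_simps)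
    have "0 \<le> Im (Ln (w z)) \<and> Im (Ln (w z)) \<le> pi" using Im_Ln_pos_le[OF w0] Im by simp
    then show "- pi < Im (Ln (w z) - \<i> * pi / 2)" "Im (Ln (w z) - \<i> * pi / 2) \<le> pi"
      using pi_gt_zero by (simp_all, linarith+)
  qed
  then have L: "Ln (- \<i> * w z) = ln (cmod (w z)) + \<i> * (Arg (w z) - pi / 2)"
    unfolding Ln_Arg[OF w0] by (simp add: algebra_simps)
  have "H z = (cmod (w z))\<^sup>2 * exp (- 2 * Arg (w z) / \<delta>)"
    by (rule H_eq)
  also have "(cmod (w z))\<^sup>2 = exp (2 * ln (cmod (w z)))"
    unfolding exp_double using w0 by simp
  also have "exp (2 * ln (cmod (w z))) * exp (- 2 * Arg (w z) / \<delta>) = exp (2 * ln (cmod (w z)) - 2 * Arg (w z) / \<delta>)"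
    by (simp add: exp_add[symmetric])
  also have "2 * ln (cmod (w z)) - 2 * Arg (w z) / \<delta> = lnH z"
  proof -
    have "Re (\<nu> * (of_real a + \<i> * (of_real b - of_real pi / 2))) = 2 * a - 2 / \<delta> * (b - pi / 2)" for a b
      by (simp add: \<nu>_def)
    then show ?thesis unfolding lnH_def L using \<delta>_pos by (simp add: diff_divide_distrib right_diff_distrib)
  qed
  finally show ?thesis .
qed

lemma H_zero: "H 0 = 0"
  using n1 by (simp add: H_eq w_def)

lemma continuous_on_w [continuous_intros]: "continuous_on S (f :: _::t2_space \<Rightarrow> _) \<Longrightarrow> continuous_on S (\<lambda>t. w (f t))"
  unfolding w_def by (intro continuous_intros)

lemma continuous_on_H: "continuous_on (UNIV - {0}) H"
proof -
  have "continuous_on (UNIV - {0}) (\<lambda>z. exp (lnH z))"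
    unfolding lnH_def by (intro continuous_intros) (use not_slit \<delta>_pos in auto)
  then show ?thesis by (subst continuous_on_cong[OF refl H_eq_exp]) auto
qed

text \<open>\<open>w\<close> is homogeneous of degree \<open>2 * n\<close> for the weights 1 and
  \<open>2 * n\<close>; a positive factor leaves its argument unchanged and enters \<open>H\<close>
  only through the squared modulus.\<close>

lemma H_scale:
  assumes "r > 0"
  shows "H (r * x, r ^ (2 * n) * y) = r ^ (4 * n) * H (x, y)"
proof -
  have "w (r * x, r ^ (2 * n) * y) = of_real (r ^ (2 * n)) * w (x, y)"
    by (simp add: w_def power_mult_distrib algebra_simps)
  moreover have "Arg (of_real (r ^ (2 * n)) * w (x, y)) = Arg (w (x, y))"
    using assms by (intro Arg_times_of_real) auto
  moreover have "(cmod (of_real (r ^ (2 * n)) * w (x, y)))\<^sup>2 = r ^ (4 * n) * (cmod (w (x, y)))\<^sup>2"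
  proof -
    have "r ^ (4 * n) = (r ^ (2 * n))\<^sup>2" by (simp add: power_mult[symmetric] mult.commute)
    then show ?thesis using assms by (simp add: norm_mult power_mult_distrib norm_power)
  qed
  ultimately show ?thesis by (simp only: H_eq mult.assoc)
qed

text \<open>\<open>exp (G \<phi>)\<close> is the factor by which the point \<open>(cos \<phi>, - sin \<phi>)\<close> of the unit circle has to be
  dilated to land on \<open>H = 1\<close>. The sign of the second coordinate makes \<open>\<phi>\<close> increase along the
  clockwise flow; \<open>\<kappa>\<close> is the factor of the change of time.\<close>

definition G :: "real \<Rightarrow> real" where "G \<phi> = - lnH (cos \<phi>, - sin \<phi>) / (4 * n)"
definition dG :: "real \<Rightarrow> real" where
  "dG \<phi> = cos \<phi> * (cos \<phi> ^ (2 * n) - sin \<phi> - 2 * n * c * sin \<phi> * (cos \<phi> ^ (2 * n - 1))\<^sup>2)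
     / (2 * n * V (cos \<phi>, - sin \<phi>))"
definition A :: "real \<Rightarrow> real" where "A \<phi> = exp (G \<phi>) * cos \<phi>"
definition B :: "real \<Rightarrow> real" where "B \<phi> = - (exp (G \<phi>) ^ (2 * n) * sin \<phi>)"
definition \<kappa> :: "real \<Rightarrow> real" where
  "\<kappa> \<phi> = ((cos \<phi>)\<^sup>2 + 2 * n * (sin \<phi>)\<^sup>2) / (2 * n * V (cos \<phi>, - sin \<phi>) * exp (G \<phi>) ^ (2 * n - 1))"
definition dA :: "real \<Rightarrow> real" where "dA \<phi> = \<kappa> \<phi> * (B \<phi> + A \<phi> ^ (2 * n))"
definition dB :: "real \<Rightarrow> real" where "dB \<phi> = \<kappa> \<phi> * (2 * n * c * A \<phi> ^ (4 * n - 1))"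
definition VV :: "real \<Rightarrow> real" where "VV \<phi> = V (A \<phi>, B \<phi>)"
definition E :: "real \<Rightarrow> real \<Rightarrow> plane" where "E \<phi> r = (r * A \<phi>, r ^ (2 * n) * B \<phi>)"

lemma circle_ne: "(cos \<phi>, - sin \<phi>) \<noteq> (0 :: plane)"
  using sin_zero_abs_cos_one[of \<phi>] by (auto simp: zero_prod_def)

lemma V1_pos: "V (cos \<phi>, - sin \<phi>) > 0"
  by (rule V_pos[OF circle_ne])

lemma G_deriv: "(G has_real_derivative dG \<phi>) (at \<phi>)"
proof -
  \<comment> \<open>With \<open>k\<close> for this power, all terms become polynomials in
    \<open>k\<close>, \<open>cos \<phi>\<close> and \<open>sin \<phi>\<close>, and the claim reduces
    to a ring identity.\<close>
  define k where "k = cos \<phi> ^ (2 * n - 1)"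
  have kC: "cos \<phi> ^ (2 * n) = k * cos \<phi>"
    unfolding k_def using n1 by (metis Suc_diff_1 mult_pos_pos power_Suc2 zero_less_numeral less_le_trans zero_less_one)
  define W where "W \<phi> = w (cos \<phi>, - sin \<phi>)" for \<phi>
  define W' where "W' = of_real (- cos \<phi>) + \<mu> * of_real (- (2 * n * k * sin \<phi>))"
  have "((\<lambda>\<phi>. cos \<phi> ^ (2 * n)) has_real_derivative - (2 * n * k * sin \<phi>)) (at \<phi>)"
    unfolding k_def by (auto intro!: derivative_eq_intros)
  moreover have "((\<lambda>\<phi>. - sin \<phi>) has_real_derivative - cos \<phi>) (at \<phi>)"
    by (auto intro!: derivative_eq_intros)
  ultimately have "(W has_vector_derivative W') (at \<phi>)"
    unfolding W_def W'_def w_def fst_conv snd_conv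
    by (intro has_vector_derivative_add has_vector_derivative_mult_right has_vector_derivative_of_real)
  then have "((\<lambda>\<phi>. - \<i> * W \<phi>) has_vector_derivative - \<i> * W') (at \<phi>)"
    by (rule has_vector_derivative_mult_right)
  moreover have "(Ln has_field_derivative inverse (- \<i> * W \<phi>)) (at (- \<i> * W \<phi>))"
    by (rule has_field_derivative_Ln) (use not_slit[OF circle_ne] in \<open>auto simp: W_def\<close>)
  ultimately have "(Ln \<circ> (\<lambda>\<phi>. - \<i> * W \<phi>) has_vector_derivative (- \<i> * W') * inverse (- \<i> * W \<phi>)) (at \<phi>)"
    by (rule field_vector_diff_chain_at)
  then have "((\<lambda>\<phi>. \<nu> * Ln (- \<i> * W \<phi>)) has_vector_derivative \<nu> * ((- \<i> * W') * inverse (- \<i> * W \<phi>))) (at \<phi>)"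
    by (intro has_vector_derivative_mult_right) (simp add: o_def)
  also have "(- \<i> * W') * inverse (- \<i> * W \<phi>) = W' / W \<phi>"
    by (simp add: field_simps)
  finally have "((\<lambda>\<phi>. Re (\<nu> * Ln (- \<i> * W \<phi>))) has_real_derivative Re (\<nu> * (W' / W \<phi>))) (at \<phi>)"
    unfolding has_real_derivative_iff_has_vector_derivative
    by (rule bounded_linear.has_vector_derivative[OF bounded_linear_Re])
  then have *: "(G has_real_derivative - Re (\<nu> * (W' / W \<phi>)) / (4 * n)) (at \<phi>)"
    unfolding G_def lnH_def W_def
    by (rule DERIV_cdivide[OF DERIV_minus[OF DERIV_diff[OF _ DERIV_const]], THEN DERIV_cong]) simp
  define v where "v = V (cos \<phi>, - sin \<phi>)"
  have v: "v > 0" and vW: "v = (cmod (W \<phi>))\<^sup>2" using V1_pos by (auto simp: v_def V_eq W_def)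
  have RW: "Re (W \<phi>) = - sin \<phi> + k * cos \<phi> / 2" and IW: "Im (W \<phi>) = \<delta> / 2 * (k * cos \<phi>)"
    by (simp_all add: W_def w_Re w_Im kC)
  have RW': "Re W' = - cos \<phi> - n * k * sin \<phi>" and IW': "Im W' = - \<delta> * n * k * sin \<phi>"
    by (simp_all add: W'_def \<mu>_def)
  have q: "Re (W' / W \<phi>) = (Re W' * Re (W \<phi>) + Im W' * Im (W \<phi>)) / v"
     "Im (W' / W \<phi>) = (Im W' * Re (W \<phi>) - Re W' * Im (W \<phi>)) / v"
    unfolding vW by (simp_all add: Re_divide Im_divide cmod_power2)
  \<comment> \<open>Multiplication by \<open>v\<close>, the squared modulus of
    \<open>W \<phi>\<close>, clears the denominator. The factor \<open>2 / \<delta>\<close> cancels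
    against the imaginary parts; elsewhere \<open>\<delta>\<close> occurs only as
    \<open>\<delta> * \<delta>\<close>.\<close>
  have "- Re (\<nu> * (W' / W \<phi>)) * v = - 2 * (Re W' * Re (W \<phi>) + Im W' * Im (W \<phi>)) + 2 / \<delta> * (Im W' * Re (W \<phi>) - Re W' * Im (W \<phi>))"
  proof -
    have r: "Re (\<nu> * Q) = 2 * Re Q - 2 / \<delta> * Im Q" for Q by (simp add: \<nu>_def)
    have "- Re (\<nu> * Q) * v = - 2 * (Re Q * v) + 2 / \<delta> * (Im Q * v)" for Q
      unfolding r by (simp add: algebra_simps)
    from this[of "W' / W \<phi>"] show ?thesis unfolding q using v by simp
  qed
  also have "2 / \<delta> * (Im W' * Re (W \<phi>) - Re W' * Im (W \<phi>)) =
      - 2 * n * k * sin \<phi> * (- sin \<phi> + k * cos \<phi> / 2) + (cos \<phi> + n * k * sin \<phi>) * (k * cos \<phi>)"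
    using \<delta>_pos by (simp add: RW IW RW' IW' field_simps)
  also have "Im W' * Im (W \<phi>) = (1 + 4 * c) * n * k * sin \<phi> * (k * cos \<phi>) / 2"
  proof -
    have "Im W' * Im (W \<phi>) = - (\<delta> * \<delta>) * n * k * sin \<phi> * (k * cos \<phi>) / 2" by (simp add: IW IW')
    then show ?thesis by (simp add: \<delta>2)
  qed
  finally have "- Re (\<nu> * (W' / W \<phi>)) * v = 2 * cos \<phi> * (k * cos \<phi> - sin \<phi> - 2 * n * c * sin \<phi> * k\<^sup>2)"
    by (simp add: RW RW' field_simps power2_eq_square)
  then have "- Re (\<nu> * (W' / W \<phi>)) / (4 * n) = dG \<phi>"
    unfolding dG_def kC k_def[symmetric] v_def[symmetric] using v n1 by (simp add: field_simps)
  with * show ?thesis by simp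
qed

text \<open>Up to signs and powers of \<open>exp (G \<phi>)\<close> the left sides are the
  derivatives of \<open>A\<close> and \<open>B\<close>, and the right sides are
  \<open>\<kappa> \<phi>\<close> times the components of the unperturbed field at
  \<open>(A \<phi>, B \<phi>)\<close>. So the curve \<open>H = 1\<close> is tangent to the
  field.\<close>

lemma dG_identities:
  fixes v D :: "real \<Rightarrow> real"
  defines "v \<equiv> \<lambda>\<phi>. V (cos \<phi>, - sin \<phi>)" and "D \<equiv> \<lambda>\<phi>. (cos \<phi>)\<^sup>2 + 2 * n * (sin \<phi>)\<^sup>2"
  shows "dG \<phi> * cos \<phi> - sin \<phi> = D \<phi> * (cos \<phi> ^ (2 * n) - sin \<phi>) / (2 * n * v \<phi>)"
    and "2 * n * dG \<phi> * sin \<phi> + cos \<phi> = - (D \<phi> * c * cos \<phi> ^ (4 * n - 1) / v \<phi>)"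
proof -
  define k where "k = cos \<phi> ^ (2 * n - 1)"
  obtain m where m: "n = Suc m" using n1 by (cases n) auto
  have kC: "cos \<phi> ^ (2 * n) = k * cos \<phi>" "cos \<phi> ^ (4 * n - 1) = k\<^sup>2 * cos \<phi>" "cos \<phi> ^ (4 * n) = k\<^sup>2 * (cos \<phi>)\<^sup>2"
    by (simp_all add: k_def m power2_eq_square flip: power_add) (simp_all add: field_simps power_add eval_nat_numeral)
  have v: "v \<phi> > 0" "v \<phi> = (sin \<phi>)\<^sup>2 - k * cos \<phi> * sin \<phi> - c * (k\<^sup>2 * (cos \<phi>)\<^sup>2)"
    using V1_pos[of \<phi>] by (auto simp: v_def inv_int_factor_def kC)
  have d: "dG \<phi> = cos \<phi> * (k * cos \<phi> - sin \<phi> - 2 * n * c * sin \<phi> * k\<^sup>2) / (2 * n * v \<phi>)"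
    unfolding dG_def kC k_def[symmetric] v_def ..
  have n0: "real n \<noteq> 0" using n1 by simp
  have "dG \<phi> * (2 * n * v \<phi>) = cos \<phi> * (k * cos \<phi> - sin \<phi> - 2 * n * c * sin \<phi> * k\<^sup>2)"
    using n0 v(1) by (simp add: d)
  then have d': "dG \<phi> * (n * v \<phi>) = cos \<phi> * (k * cos \<phi> - sin \<phi> - 2 * n * c * sin \<phi> * k\<^sup>2) / 2" by simp
  have "(dG \<phi> * cos \<phi> - sin \<phi>) * (2 * n * v \<phi>) = 2 * (dG \<phi> * (n * v \<phi>)) * cos \<phi> - 2 * n * sin \<phi> * v \<phi>"
    by (simp add: algebra_simps)
  also have "\<dots> = D \<phi> * (k * cos \<phi> - sin \<phi>)"
    unfolding d' unfolding D_def v(2) by (simp add: field_simps power2_eq_square)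
  finally show "dG \<phi> * cos \<phi> - sin \<phi> = D \<phi> * (cos \<phi> ^ (2 * n) - sin \<phi>) / (2 * n * v \<phi>)"
    unfolding kC using n0 v(1) by (simp add: field_simps)
  have "(2 * n * dG \<phi> * sin \<phi> + cos \<phi>) * v \<phi> = 2 * (dG \<phi> * (n * v \<phi>)) * sin \<phi> + cos \<phi> * v \<phi>"
    by (simp add: algebra_simps)
  also have "\<dots> = - (D \<phi> * c * (k\<^sup>2 * cos \<phi>))"
    unfolding d' unfolding D_def v(2) by (simp add: field_simps power2_eq_square)
  finally show "2 * n * dG \<phi> * sin \<phi> + cos \<phi> = - (D \<phi> * c * cos \<phi> ^ (4 * n - 1) / v \<phi>)"
    unfolding kC using v(1) by (simp add: field_simps)
qed

lemma A_deriv: "(A has_real_derivative dA \<phi>) (at \<phi>)"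
proof -
  have "(A has_real_derivative exp (G \<phi>) * (dG \<phi> * cos \<phi> - sin \<phi>)) (at \<phi>)"
    unfolding A_def by (auto intro!: derivative_eq_intros G_deriv simp: algebra_simps)
  also have "exp (G \<phi>) * (dG \<phi> * cos \<phi> - sin \<phi>) = dA \<phi>"
  proof -
    have "exp (G \<phi>) ^ (2 * n) = exp (G \<phi>) * exp (G \<phi>) ^ (2 * n - 1)"
      using n1 by (intro power_minus_mult[symmetric, THEN trans]) auto
    then have "B \<phi> + A \<phi> ^ (2 * n) = exp (G \<phi>) * exp (G \<phi>) ^ (2 * n - 1) * (cos \<phi> ^ (2 * n) - sin \<phi>)"
      by (simp add: A_def B_def power_mult_distrib algebra_simps)
    then show ?thesis unfolding dG_identities dA_def \<kappa>_def by (simp add: mult_ac)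
  qed
  finally show ?thesis .
qed

lemma B_deriv: "(B has_real_derivative dB \<phi>) (at \<phi>)"
proof -
  have e: "exp (G \<phi>) ^ (2 * n) = exp (G \<phi>) * exp (G \<phi>) ^ (2 * n - 1)"
    using n1 by (intro power_minus_mult[symmetric, THEN trans]) auto
  have "(B has_real_derivative - (exp (G \<phi>) ^ (2 * n) * (2 * n * dG \<phi> * sin \<phi> + cos \<phi>))) (at \<phi>)"
    unfolding B_def by (rule derivative_eq_intros G_deriv refl)+ (insert e, simp add: algebra_simps)
  also have "- (exp (G \<phi>) ^ (2 * n) * (2 * n * dG \<phi> * sin \<phi> + cos \<phi>)) = dB \<phi>"
  proof -
    have "4 * n - 1 = 2 * n + (2 * n - 1)" using n1 by simp
    then have "A \<phi> ^ (4 * n - 1) = exp (G \<phi>) ^ (2 * n) * exp (G \<phi>) ^ (2 * n - 1) * cos \<phi> ^ (4 * n - 1)"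
      unfolding A_def power_mult_distrib by (simp add: power_add)
    then show ?thesis unfolding dG_identities dB_def \<kappa>_def using n1 by simp
  qed
  finally show ?thesis .
qed

lemma \<kappa>_pos: "\<kappa> \<phi> > 0"
proof -
  have "(cos \<phi>)\<^sup>2 + 2 * n * (sin \<phi>)\<^sup>2 > 0"
    using circle_ne[of \<phi>] n1 by (auto simp: zero_prod_def intro: add_pos_nonneg add_nonneg_pos)
  then show ?thesis unfolding \<kappa>_def using V1_pos[of \<phi>] n1 by simp
qed

lemma AB_ne: "(A \<phi>, B \<phi>) \<noteq> (0 :: plane)"
  using circle_ne[of \<phi>] by (auto simp: zero_prod_def A_def B_def)

lemma VV_pos: "VV \<phi> > 0"
  unfolding VV_def by (rule V_pos[OF AB_ne])

lemma V_scale: "V (r * x, r ^ (2 * n) * y) = r ^ (4 * n) * V (x, y)"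
proof -
  have "r ^ (4 * n) = r ^ (2 * n) * r ^ (2 * n)" by (simp flip: power_add)
  moreover have "(r * x) ^ (4 * n) = r ^ (4 * n) * x ^ (4 * n)" by (rule power_mult_distrib)
  ultimately show ?thesis
    by (simp add: inv_int_factor_def power_mult_distrib power2_eq_square algebra_simps)
qed

lemma V_E: "V (E \<phi> r) = r ^ (4 * n) * VV \<phi>"
  by (simp add: E_def V_scale VV_def)

text \<open>The determinant of the Euler field \<open>(x, 2 n y)\<close> of the scaling with the
  unperturbed field is \<open>- 2 n V\<close>. As \<open>V\<close> has no zero off the origin, the
  radial and the angular direction are independent everywhere.\<close>

lemma wronskian: "A \<phi> * dB \<phi> - 2 * n * B \<phi> * dA \<phi> = - (2 * n * \<kappa> \<phi> * VV \<phi>)"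
proof -
  obtain m where m: "4 * n = Suc m" using n1 by (cases "4 * n") auto
  show ?thesis
    unfolding dA_def dB_def VV_def inv_int_factor_def case_prod_conv m diff_Suc_1 by (simp add: algebra_simps power2_eq_square)
qed

lemma continuous_G [continuous_intros]: "continuous_on S (f :: _::t2_space \<Rightarrow> _) \<Longrightarrow> continuous_on S (\<lambda>t. G (f t))"
  by (rule continuous_on_compose2[OF DERIV_continuous_on[of UNIV G dG]]) (auto intro: G_deriv)

lemma continuous_A [continuous_intros]: "continuous_on S (f :: _::t2_space \<Rightarrow> _) \<Longrightarrow> continuous_on S (\<lambda>t. A (f t))"
  and continuous_B [continuous_intros]: "continuous_on S (f :: _::t2_space \<Rightarrow> _) \<Longrightarrow> continuous_on S (\<lambda>t. B (f t))"
  unfolding A_def B_def by (auto intro!: continuous_intros)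

lemma continuous_V [continuous_intros]: "continuous_on S (f :: _::t2_space \<Rightarrow> _) \<Longrightarrow> continuous_on S (\<lambda>t. V (f t))"
  unfolding inv_int_factor_def case_prod_beta by (intro continuous_intros)

lemma continuous_VV [continuous_intros]: "continuous_on S (f :: _::t2_space \<Rightarrow> _) \<Longrightarrow> continuous_on S (\<lambda>t. VV (f t))"
  unfolding VV_def by (auto intro!: continuous_intros)

lemma continuous_\<kappa> [continuous_intros]: "continuous_on S (f :: _::t2_space \<Rightarrow> _) \<Longrightarrow> continuous_on S (\<lambda>t. \<kappa> (f t))"
  unfolding \<kappa>_def using V1_pos n1 by (auto intro!: continuous_intros simp: less_imp_neq[symmetric])

lemma continuous_dA [continuous_intros]: "continuous_on S (f :: _::t2_space \<Rightarrow> _) \<Longrightarrow> continuous_on S (\<lambda>t. dA (f t))"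
  and continuous_dB [continuous_intros]: "continuous_on S (f :: _::t2_space \<Rightarrow> _) \<Longrightarrow> continuous_on S (\<lambda>t. dB (f t))"
  unfolding dA_def dB_def by (auto intro!: continuous_intros)

lemma continuous_E [continuous_intros]:
  "continuous_on S (f :: _::t2_space \<Rightarrow> _) \<Longrightarrow> continuous_on S g \<Longrightarrow> continuous_on S (\<lambda>t. E (f t) (g t))"
  unfolding E_def by (intro continuous_intros)

lemma periodic:
  fixes k :: int
  shows "A (\<phi> + 2 * pi * k) = A \<phi>" "B (\<phi> + 2 * pi * k) = B \<phi>" "\<kappa> (\<phi> + 2 * pi * k) = \<kappa> \<phi>"
    "VV (\<phi> + 2 * pi * k) = VV \<phi>" "dA (\<phi> + 2 * pi * k) = dA \<phi>" "dB (\<phi> + 2 * pi * k) = dB \<phi>"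
    "E (\<phi> + 2 * pi * k) r = E \<phi> r"
proof -
  have sc: "sin (\<phi> + 2 * pi * k) = sin \<phi>" "cos (\<phi> + 2 * pi * k) = cos \<phi>"
    using sin_cos_eq_iff[of "\<phi> + 2 * pi * k" \<phi>] by blast+
  then have "G (\<phi> + 2 * pi * k) = G \<phi>" by (simp add: G_def)
  with sc show "A (\<phi> + 2 * pi * k) = A \<phi>" "B (\<phi> + 2 * pi * k) = B \<phi>" "\<kappa> (\<phi> + 2 * pi * k) = \<kappa> \<phi>"
    "VV (\<phi> + 2 * pi * k) = VV \<phi>" "dA (\<phi> + 2 * pi * k) = dA \<phi>" "dB (\<phi> + 2 * pi * k) = dB \<phi>"
    "E (\<phi> + 2 * pi * k) r = E \<phi> r"
    by (simp_all add: A_def B_def \<kappa>_def VV_def dA_def dB_def E_def)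
qed

text \<open>The unperturbed system is invariant under changing the signs of \<open>x\<close> and of
  time together; on the angle this acts as the reflection of the circle in the
  \<open>y\<close>-axis.\<close>

lemma reflection:
  "A (pi - \<phi>) = - A \<phi>" "B (pi - \<phi>) = B \<phi>" "\<kappa> (pi - \<phi>) = \<kappa> \<phi>" "VV (pi - \<phi>) = VV \<phi>"
  "dA (pi - \<phi>) = dA \<phi>" "dB (pi - \<phi>) = - dB \<phi>"
proof -
  have "w (cos (pi - \<phi>), - sin (pi - \<phi>)) = w (cos \<phi>, - sin \<phi>)" by (simp add: w_def)
  then have G: "G (pi - \<phi>) = G \<phi>" and V1: "V (cos (pi - \<phi>), - sin (pi - \<phi>)) = V (cos \<phi>, - sin \<phi>)"
    by (simp_all only: G_def lnH_def V_eq)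
  show A: "A (pi - \<phi>) = - A \<phi>" and B: "B (pi - \<phi>) = B \<phi>" by (simp_all add: A_def B_def G)
  show \<kappa>: "\<kappa> (pi - \<phi>) = \<kappa> \<phi>" unfolding \<kappa>_def V1 G by simp
  show "VV (pi - \<phi>) = VV \<phi>" by (simp add: VV_def A B inv_int_factor_def)
  have odd: "odd (4 * n - 1)" using n1 by simp
  show "dA (pi - \<phi>) = dA \<phi>" unfolding dA_def A B \<kappa> by simp
  show "dB (pi - \<phi>) = - dB \<phi>" unfolding dB_def A \<kappa> power_minus_odd[OF odd] by simp
qed

lemma H_E: "H (E \<phi> r) = r ^ (4 * n)" if "r > 0"
proof -
  have "E \<phi> r = ((r * exp (G \<phi>)) * cos \<phi>, (r * exp (G \<phi>)) ^ (2 * n) * (- sin \<phi>))"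
    by (simp add: E_def A_def B_def power_mult_distrib)
  also have "H \<dots> = (r * exp (G \<phi>)) ^ (4 * n) * H (cos \<phi>, - sin \<phi>)"
    by (rule H_scale) (use that in simp)
  also have "\<dots> = r ^ (4 * n) * (exp (4 * n * G \<phi>) * exp (lnH (cos \<phi>, - sin \<phi>)))"
    by (simp add: power_mult_distrib H_eq_exp[OF circle_ne] flip: exp_of_nat_mult)
  also have "4 * n * G \<phi> = - lnH (cos \<phi>, - sin \<phi>)" using n1 by (simp add: G_def)
  finally show ?thesis by (simp add: exp_minus)
qed

section \<open>Polar coordinates are bijective up to full turns\<close>

lemma E_ne: "E \<phi> r \<noteq> 0" if "r > 0"
  using AB_ne[of \<phi>] that by (auto simp: E_def zero_prod_def)

lemma E_surj:
  assumes "z \<noteq> 0"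
  obtains \<phi> r where "0 \<le> \<phi>" "\<phi> < 2 * pi" "0 < r" "z = E \<phi> r"
proof -
  obtain x y where z: "z = (x, y)" by fastforce
  \<comment> \<open>The dilation that brings \<open>z\<close> to the unit circle solves
    \<open>(x / \<rho>)\<^sup>2 + (y / \<rho> ^ (2 * n))\<^sup>2 = 1\<close>, here multiplied by
    \<open>\<rho> ^ (4 * n)\<close>. For \<open>y = 0\<close> the product has the spurious root 0,
    so this case is solved explicitly.\<close>
  obtain \<rho> where \<rho>: "0 < \<rho>" "\<rho> ^ (4 * n) = x\<^sup>2 * \<rho> ^ (4 * n - 2) + y\<^sup>2"
  proof (cases "y = 0")
    case True
    have "x \<noteq> 0" using assms True z by (auto simp: zero_prod_def)
    moreover have "\<bar>x\<bar> ^ (4 * n) = \<bar>x\<bar> ^ (4 * n - 2) * x\<^sup>2"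
    proof -
      have "4 * n = 4 * n - 2 + 2" using n1 by simp
      then show ?thesis by (metis power2_abs power_add)
    qed
    ultimately show ?thesis using True that[of "\<bar>x\<bar>"] by simp
  next
    case False
    define p where "p \<rho> = \<rho> ^ (4 * n) - (x\<^sup>2 * \<rho> ^ (4 * n - 2) + y\<^sup>2)" for \<rho>
    \<comment> \<open>\<open>M\<close> is at least 1 and its square at least
      \<open>x\<^sup>2 + y\<^sup>2\<close>, which makes \<open>p M\<close> nonnegative.\<close>
    define M where "M = 1 + \<bar>x\<bar> + \<bar>y\<bar>"
    have M: "1 \<le> M" by (simp add: M_def)
    have "p 0 \<le> 0" using n1 by (simp add: p_def power_0_left)
    moreover have "0 \<le> p M"
    proof -
      have "x\<^sup>2 + y\<^sup>2 \<le> M\<^sup>2" by (simp add: M_def power2_sum power2_eq_square algebra_simps)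
      then have "y\<^sup>2 \<le> 1 * (M\<^sup>2 - x\<^sup>2)" by simp
      also have "1 * (M\<^sup>2 - x\<^sup>2) \<le> M ^ (4 * n - 2) * (M\<^sup>2 - x\<^sup>2)"
        using \<open>x\<^sup>2 + y\<^sup>2 \<le> M\<^sup>2\<close> zero_le_power2[of y]
        by (intro mult_right_mono one_le_power M) linarith
      also have "\<dots> = p M + y\<^sup>2"
      proof -
        have "4 * n = 4 * n - 2 + 2" using n1 by simp
        then have "M ^ (4 * n) = M ^ (4 * n - 2) * M\<^sup>2" by (metis power_add)
        then show ?thesis by (simp add: p_def algebra_simps)
      qed
      finally show ?thesis by simp
    qed
    moreover have "continuous_on {0..M} p" unfolding p_def by (intro continuous_intros)
    ultimately obtain \<rho> where "0 \<le> \<rho>" "p \<rho> = 0" using IVT'[of p 0 0 M] M by auto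
    moreover from this have "\<rho> \<noteq> 0" using False n1 by (auto simp: p_def power_0_left)
    ultimately show ?thesis using that[of \<rho>] by (simp add: p_def)
  qed
  have "(x / \<rho>)\<^sup>2 + (- y / \<rho> ^ (2 * n))\<^sup>2 = 1"
  proof -
    have e: "4 * n = 4 * n - 2 + 2" using n1 by simp
    have p4: "\<rho> ^ (4 * n) = \<rho> ^ (4 * n - 2) * \<rho>\<^sup>2" by (subst e) (rule power_add)
    have "(- y / \<rho> ^ (2 * n))\<^sup>2 = y\<^sup>2 / \<rho> ^ (4 * n)"
      by (simp add: power_divide power_mult[symmetric] mult.commute)
    moreover have "(x / \<rho>)\<^sup>2 = x\<^sup>2 * \<rho> ^ (4 * n - 2) / \<rho> ^ (4 * n)"
      unfolding p4 using \<rho>(1) by (simp add: power_divide)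
    ultimately have "(x / \<rho>)\<^sup>2 + (- y / \<rho> ^ (2 * n))\<^sup>2 = (x\<^sup>2 * \<rho> ^ (4 * n - 2) + y\<^sup>2) / \<rho> ^ (4 * n)"
      by (simp only: add_divide_distrib)
    also have "\<dots> = 1" unfolding \<rho>(2)[symmetric] using \<rho>(1) by simp
    finally show ?thesis .
  qed
  then obtain \<phi> where \<phi>: "0 \<le> \<phi>" "\<phi> < 2 * pi" "x / \<rho> = cos \<phi>" "- y / \<rho> ^ (2 * n) = sin \<phi>"
    using sincos_total_2pi[of "x / \<rho>" "- y / \<rho> ^ (2 * n)"] by metis
  have "z = E \<phi> (\<rho> / exp (G \<phi>))"
    using \<rho>(1) \<phi>(3,4) by (simp add: z E_def A_def B_def power_divide field_simps)
  then show ?thesis using that \<phi> \<rho>(1) by (metis divide_pos_pos exp_gt_zero)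
qed

text \<open>\<open>H\<close> determines the radius. The two points of the unit circle then differ by
  a dilation with factor \<open>q\<close>, and for \<open>q \<noteq> 1\<close> a dilation strictly
  shrinks or strictly enlarges the norm, hence leaves the circle.\<close>

lemma E_eq_iff:
  assumes "r > 0" "r' > 0"
  shows "E \<phi> r = E \<phi>' r' \<longleftrightarrow> r = r' \<and> (\<exists>k::int. \<phi> = \<phi>' + 2 * pi * k)"
proof
  assume eq: "E \<phi> r = E \<phi>' r'"
  have "r ^ (4 * n) = r' ^ (4 * n)" using H_E[OF assms(1)] H_E[OF assms(2)] eq by metis
  then have r: "r = r'" using assms n1 by (simp add: power_eq_iff_eq_base)
  define q where "q = exp (G \<phi>') / exp (G \<phi>)"
  have q0: "q > 0" by (simp add: q_def)
  have cs: "cos \<phi> = q * cos \<phi>'" "sin \<phi> = q ^ (2 * n) * sin \<phi>'"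
    using eq r assms by (auto simp: E_def A_def B_def q_def field_simps power_divide)
  have one: "1 = q\<^sup>2 * (cos \<phi>')\<^sup>2 + (q ^ (2 * n))\<^sup>2 * (sin \<phi>')\<^sup>2"
    using sin_cos_squared_add2[of \<phi>] by (simp add: cs power_mult_distrib)
  have "q = 1"
  proof (rule ccontr)
    assume "q \<noteq> 1"
    then consider "q < 1" | "q > 1" by linarith
    then show False
    proof cases
      case 1
      then have "q\<^sup>2 < 1" "(q ^ (2 * n))\<^sup>2 < 1" using q0 n1 by (auto simp: power_less_one_iff abs_square_less_1)
      then have "(cos \<phi>')\<^sup>2 * q\<^sup>2 + (sin \<phi>')\<^sup>2 * (q ^ (2 * n))\<^sup>2 < 1"
        by (rule convex_bound_lt) auto
      then show False using one by (simp add: mult.commute)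
    next
      case 2
      then have "- q\<^sup>2 < - 1" "- (q ^ (2 * n))\<^sup>2 < - 1" using n1 by (auto intro!: one_less_power)
      then have "(cos \<phi>')\<^sup>2 * (- q\<^sup>2) + (sin \<phi>')\<^sup>2 * (- (q ^ (2 * n))\<^sup>2) < - 1"
        by (rule convex_bound_lt) auto
      then show False using one by (simp add: mult.commute)
    qed
  qed
  then show "r = r' \<and> (\<exists>k::int. \<phi> = \<phi>' + 2 * pi * k)"
    using r cs sin_cos_eq_iff[of \<phi> \<phi>'] by simp
qed (auto simp: periodic)

lemma E_cross_section: "E \<phi> r \<in> cross_section \<longleftrightarrow> (\<exists>k::int. \<phi> = 2 * pi * k)" if r: "r > 0"
proof
  assume "E \<phi> r \<in> cross_section"
  then have "sin \<phi> = 0" "cos \<phi> > 0" using r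
    by (auto simp: cross_section_def E_def A_def B_def zero_less_mult_iff)
  then have "sin \<phi> = sin 0 \<and> cos \<phi> = cos 0" using sin_zero_abs_cos_one by fastforce
  then show "\<exists>k::int. \<phi> = 2 * pi * k" using sin_cos_eq_iff[of \<phi> 0] by simp
next
  assume "\<exists>k::int. \<phi> = 2 * pi * k"
  then obtain k :: int where "\<phi> = 0 + 2 * pi * k" by auto
  then show "E \<phi> r \<in> cross_section" using periodic(7)[of 0 k r] r
    by (simp add: cross_section_def E_def A_def B_def)
qed

end

section \<open>Flows depending on a small parameter\<close>

lemma lipschitz_on_bounded_const: "lipschitz_on_bounded (\<lambda>_. k)"
  unfolding lipschitz_on_bounded_def by (auto intro!: exI[of _ 0] lipschitz_onI)

lemma lipschitz_on_bounded_fst: "lipschitz_on_bounded fst"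
  and lipschitz_on_bounded_snd: "lipschitz_on_bounded snd"
  unfolding lipschitz_on_bounded_def
  by (intro allI impI exI[of _ 1] lipschitz_onI; simp add: dist_fst_le dist_snd_le)+

lemma lipschitz_on_bounded_add:
  fixes f g :: "'a::metric_space \<Rightarrow> 'b::real_normed_vector"
  assumes "lipschitz_on_bounded f" "lipschitz_on_bounded g"
  shows "lipschitz_on_bounded (\<lambda>x. f x + g x)"
  using assms unfolding lipschitz_on_bounded_def by (blast intro: lipschitz_on_add)

lemma lipschitz_on_bounded_mult:
  fixes f g :: "'a::heine_borel \<Rightarrow> real"
  assumes "lipschitz_on_bounded f" "lipschitz_on_bounded g"
  shows "lipschitz_on_bounded (\<lambda>x. f x * g x)"
  unfolding lipschitz_on_bounded_def
proof (intro allI impI)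
  fix S :: "'a set" assume S: "bounded S"
  obtain L where L: "L-lipschitz_on S f" using assms(1) S unfolding lipschitz_on_bounded_def by blast
  obtain M where M: "M-lipschitz_on S g" using assms(2) S unfolding lipschitz_on_bounded_def by blast
  obtain a where a: "\<And>x. x \<in> S \<Longrightarrow> \<bar>f x\<bar> \<le> a"
    using bounded_uniformly_continuous_image[OF lipschitz_on_uniformly_continuous[OF L] S]
    by (auto simp: bounded_iff)
  obtain b where b: "\<And>x. x \<in> S \<Longrightarrow> \<bar>g x\<bar> \<le> b"
    using bounded_uniformly_continuous_image[OF lipschitz_on_uniformly_continuous[OF M] S]
    by (auto simp: bounded_iff)
  have "(\<bar>a\<bar> * M + \<bar>b\<bar> * L)-lipschitz_on S (\<lambda>x. f x * g x)"
  proof (rule lipschitz_onI)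
    fix x y assume xy: "x \<in> S" "y \<in> S"
    have "dist (f x * g x) (f y * g y) = \<bar>f x * (g x - g y) + g y * (f x - f y)\<bar>"
      by (simp add: dist_real_def algebra_simps)
    also have "\<dots> \<le> \<bar>f x\<bar> * \<bar>g x - g y\<bar> + \<bar>g y\<bar> * \<bar>f x - f y\<bar>"
      by (metis abs_mult abs_triangle_ineq)
    also have "\<dots> \<le> \<bar>a\<bar> * (M * dist x y) + \<bar>b\<bar> * (L * dist x y)"
      using a[OF xy(1)] b[OF xy(2)] lipschitz_onD[OF L xy] lipschitz_onD[OF M xy]
      by (intro add_mono mult_mono) (auto simp: dist_real_def)
    finally show "dist (f x * g x) (f y * g y) \<le> (\<bar>a\<bar> * M + \<bar>b\<bar> * L) * dist x y"
      by (simp add: algebra_simps)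
  qed (use lipschitz_on_nonneg[OF L] lipschitz_on_nonneg[OF M] in auto)
  then show "\<exists>L. L-lipschitz_on S (\<lambda>x. f x * g x)" by blast
qed

lemma lipschitz_on_bounded_power:
  fixes f :: "'a::heine_borel \<Rightarrow> real"
  shows "lipschitz_on_bounded f \<Longrightarrow> lipschitz_on_bounded (\<lambda>x. f x ^ k)"
  by (induction k) (auto intro: lipschitz_on_bounded_mult lipschitz_on_bounded_const)

lemma lipschitz_on_bounded_Pair:
  assumes "lipschitz_on_bounded f" "lipschitz_on_bounded g"
  shows "lipschitz_on_bounded (\<lambda>x. (f x, g x))"
  unfolding lipschitz_on_bounded_def
proof (intro allI impI)
  fix S :: "'a set" assume S: "bounded S"
  obtain L where L: "L-lipschitz_on S f" using assms(1) S unfolding lipschitz_on_bounded_def by blast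
  obtain M where M: "M-lipschitz_on S g" using assms(2) S unfolding lipschitz_on_bounded_def by blast
  have "(L + M)-lipschitz_on S (\<lambda>x. (f x, g x))"
  proof (rule lipschitz_onI)
    fix x y assume xy: "x \<in> S" "y \<in> S"
    have "dist (f x, g x) (f y, g y) \<le> dist (f x) (f y) + dist (g x) (g y)"
      by (simp add: dist_Pair_Pair sqrt_sum_squares_le_sum)
    also have "\<dots> \<le> L * dist x y + M * dist x y"
      using lipschitz_onD[OF L xy] lipschitz_onD[OF M xy] by (rule add_mono)
    finally show "dist (f x, g x) (f y, g y) \<le> (L + M) * dist x y" by (simp add: algebra_simps)
  qed (use lipschitz_on_nonneg[OF L] lipschitz_on_nonneg[OF M] in auto)
  then show "\<exists>L. L-lipschitz_on S (\<lambda>x. (f x, g x))" by blast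
qed

lemmas lipschitz_on_bounded_intros = lipschitz_on_bounded_const lipschitz_on_bounded_fst
  lipschitz_on_bounded_snd lipschitz_on_bounded_add lipschitz_on_bounded_mult
  lipschitz_on_bounded_power lipschitz_on_bounded_Pair

lemma lipschitz_on_bounded_bieval: "lipschitz_on_bounded (bieval p)"
proof -
  have uni: "lipschitz_on_bounded (\<lambda>z::plane. poly q (fst z))" for q :: "real poly"
    by (induction q) (auto intro!: lipschitz_on_bounded_intros)
  have "lipschitz_on_bounded (\<lambda>z::plane. poly (poly p [:snd z:]) (fst z))"
    by (induction p) (auto intro!: lipschitz_on_bounded_intros uni)
  then show ?thesis by (simp add: bieval_def[abs_def])
qed

lemma lipschitz_on_bounded_perturbed_field: "lipschitz_on_bounded (perturbed_field n c P Q e)"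
proof -
  have "lipschitz_on_bounded (\<lambda>z. (snd z + fst z ^ (2 * n) + e * bieval (Q e) z,
      2 * real n * c * fst z ^ (4 * n - 1) + (- e) * bieval (P e) z))"
    by (intro lipschitz_on_bounded_intros lipschitz_on_bounded_bieval)
  then show ?thesis by (simp add: perturbed_field_def case_prod_beta[abs_def])
qed

section \<open>Polynomials in two variables as finite double sums\<close>

lemma degree_le_if_total_degree_le:
  assumes "total_degree_le d p"
  shows "degree p \<le> d" "degree (coeff p j) \<le> d"
proof -
  show "degree p \<le> d"
  proof (rule degree_le, intro allI impI)
    fix j assume "d < j"
    then show "coeff p j = 0" using assms by (intro poly_eqI) (force simp: total_degree_le_def)
  qed
  show "degree (coeff p j) \<le> d"
    using assms by (intro degree_le) (force simp: total_degree_le_def)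
qed

lemma poly_eq_sum_le:
  fixes x :: "'a::comm_semiring_1"
  assumes "degree p \<le> d" shows "poly p x = (\<Sum>i\<le>d. coeff p i * x ^ i)"
  unfolding poly_altdef using assms by (intro sum.mono_neutral_left) (auto simp: coeff_eq_0)

lemma bieval_eq_sum:
  assumes "total_degree_le d p"
  shows "bieval p (x, y) = (\<Sum>j\<le>d. \<Sum>i\<le>d. coeff (coeff p j) i * x ^ i * y ^ j)"
proof -
  have "poly p [:y:] = (\<Sum>j\<le>d. coeff p j * [:y:] ^ j)"
    by (rule poly_eq_sum_le) (rule degree_le_if_total_degree_le[OF assms])
  then have "bieval p (x, y) = (\<Sum>j\<le>d. poly (coeff p j) x * y ^ j)"
    by (simp add: bieval_def poly_sum)
  also have "\<dots> = (\<Sum>j\<le>d. \<Sum>i\<le>d. coeff (coeff p j) i * x ^ i * y ^ j)"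
    by (intro sum.cong refl)
       (simp add: poly_eq_sum_le[OF degree_le_if_total_degree_le(2)[OF assms]] sum_distrib_right)
  finally show ?thesis .
qed

lemma uniform_limit_tendsto_const:
  "(f \<longlongrightarrow> l) F \<Longrightarrow> uniform_limit S (\<lambda>n x. f n) (\<lambda>x. l) F"
  by (rule uniform_limitI) (auto dest: tendstoD elim: eventually_mono)

text \<open>A rectangle rather than a union of discs, because it is convex: a bound of the
  derivative is then a Lipschitz constant.\<close>

definition complex_box :: "real \<Rightarrow> real \<Rightarrow> real \<Rightarrow> complex set" where
  "complex_box a b r = box (Complex (a - r) (- r)) (Complex (b + r) r)"

definition complex_cbox :: "real \<Rightarrow> real \<Rightarrow> real \<Rightarrow> complex set" where
  "complex_cbox a b r = cbox (Complex (a - r) (- r)) (Complex (b + r) r)"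

lemma cball_subset_complex_box:
  assumes "z \<in> complex_box a b r" "r + s \<le> t" shows "cball z s \<subseteq> complex_box a b t"
proof
  fix w assume "w \<in> cball z s"
  then have "\<bar>Re w - Re z\<bar> \<le> s" "\<bar>Im w - Im z\<bar> \<le> s"
    using abs_Re_le_cmod[of "w - z"] abs_Im_le_cmod[of "w - z"] by (auto simp: dist_norm norm_minus_commute)
  then show "w \<in> complex_box a b t"
    using assms by (auto simp: complex_box_def in_box_complex_iff abs_le_iff)
qed

text \<open>Three nested boxes share the work: \<open>F e\<close> is bounded on the box of margin
  \<open>3 * \<rho>\<close>, hence by Cauchy's inequality Lipschitz on that of margin
  \<open>2 * \<rho>\<close>, and for small \<open>e\<close> solutions starting within margin
  \<open>\<rho>\<close> do not leave the second box. The doubled interval of angles leaves room for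
  a full turn from every starting angle \<open>t\<close>. The radius moves only by a multiple of
  \<open>e\<close>, so to first order the displacement is \<open>e\<close> times the integral of
  \<open>F 0\<close> at the initial value.\<close>

lemma small_parameter_flow:
  fixes F :: "real \<Rightarrow> real \<Rightarrow> complex \<Rightarrow> complex"
  assumes L: "0 < L" and \<rho>: "0 < \<rho>"
    and lim: "uniform_limit ({0..2*L} \<times> complex_cbox a b (3*\<rho>)) (\<lambda>e p. F e (fst p) (snd p)) (\<lambda>p. F 0 (fst p) (snd p)) (nhds 0)"
    and reg: "\<forall>\<^sub>F e in nhds 0. continuous_on ({0..2*L} \<times> complex_cbox a b (3*\<rho>)) (\<lambda>p. F e (fst p) (snd p)) \<and>
        (\<forall>t\<in>{0..2*L}. F e t holomorphic_on complex_box a b (3*\<rho>)) \<and>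
        (\<forall>t\<in>{0..2*L}. \<forall>x. of_real x \<in> complex_box a b (3*\<rho>) \<longrightarrow> F e t (of_real x) \<in> \<real>)"
  obtains u C where "0 \<le> C" "\<forall>\<^sub>F e in nhds 0. \<bar>e\<bar> * C * L \<le> \<rho> \<and> (\<forall>t\<in>{0..L}.
      (\<forall>z\<in>complex_box a b \<rho>. u e t 0 z = z) \<and>
      (\<forall>s\<in>{0..L}. \<forall>z\<in>complex_box a b \<rho>. norm (u e t s z - z) \<le> \<bar>e\<bar> * C * s) \<and>
      (\<forall>s\<in>{0..L}. \<forall>z\<in>complex_box a b \<rho>.
         ((\<lambda>s. u e t s z) has_vector_derivative of_real e * F e (t + s) (u e t s z)) (at s within {0..L})) \<and>
      (\<forall>s\<in>{0..L}. u e t s holomorphic_on complex_box a b \<rho>) \<and>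
      (\<forall>s\<in>{0..L}. \<forall>z\<in>complex_box a b \<rho>. \<forall>w\<in>complex_box a b \<rho>. 2 * norm (u e t s z - u e t s w - (z - w)) \<le> norm (z - w)) \<and>
      (\<forall>s\<in>{0..L}. \<forall>x. of_real x \<in> complex_box a b \<rho> \<longrightarrow> u e t s (of_real x) \<in> \<real>))"
    "uniform_limit (complex_box a b \<rho>) (\<lambda>e z. (u e 0 L z - z) / of_real e) (\<lambda>z. integral {0..L} (\<lambda>s. F 0 s z)) (at 0)"
proof -
  define R where "R k = complex_box a b (k * \<rho>)" for k :: real
  define C3 where "C3 = {0..2*L} \<times> complex_cbox a b (3*\<rho>)"
  have R1: "complex_box a b \<rho> = R 1" by (simp add: R_def)
  have opR: "open (R k)" and cvR: "convex (R k)" for k by (auto simp: R_def complex_box_def)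
  have Rsub: "R 3 \<subseteq> complex_cbox a b (3*\<rho>)" by (simp add: R_def complex_box_def complex_cbox_def box_subset_cbox)
  have Rmono: "R k \<subseteq> R l" if "k \<le> l" for k l
  proof -
    have "k * \<rho> \<le> l * \<rho>" using that \<rho> by (intro mult_right_mono) auto
    then show ?thesis by (auto simp: R_def complex_box_def in_box_complex_iff)
  qed
  have cpt: "compact C3" by (auto simp: C3_def complex_cbox_def intro!: compact_Times)
  obtain M0 where M0: "\<And>p. p \<in> C3 \<Longrightarrow> norm (F 0 (fst p) (snd p)) \<le> M0"
  proof -
    have "continuous_on C3 (\<lambda>p. F 0 (fst p) (snd p))"
      using eventually_nhds_x_imp_x[OF reg] by (simp add: C3_def)
    then have "bounded ((\<lambda>p. F 0 (fst p) (snd p)) ` C3)"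
      using cpt compact_continuous_image compact_imp_bounded by blast
    then show ?thesis using that by (auto simp: bounded_iff)
  qed
  define M where "M = \<bar>M0\<bar> + 1"
  have M: "M > 0" by (simp add: M_def)
  \<comment> \<open>The last two conditions keep the solutions in the middle box and make twice the
    Lipschitz constant times \<open>L\<close> at most 1/2.\<close>
  define good where "good e \<longleftrightarrow> (\<forall>p\<in>C3. norm (F e (fst p) (snd p)) \<le> M) \<and>
      continuous_on C3 (\<lambda>p. F e (fst p) (snd p)) \<and>
      (\<forall>t\<in>{0..2*L}. F e t holomorphic_on R 3) \<and>
      (\<forall>t\<in>{0..2*L}. \<forall>x. of_real x \<in> R 3 \<longrightarrow> F e t (of_real x) \<in> \<real>) \<and>
      \<bar>e\<bar> * M * L \<le> \<rho> \<and> \<bar>e\<bar> * (M / \<rho>) * L \<le> 1 / 4" for e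
  have small: "\<forall>\<^sub>F e in nhds 0. \<bar>e\<bar> * x \<le> y" if "0 < y" for x y :: real
  proof -
    have "((\<lambda>e. \<bar>e\<bar> * x) \<longlongrightarrow> \<bar>0\<bar> * x) (nhds 0)"
      by (intro tendsto_intros filterlim_ident)
    then have "\<forall>\<^sub>F e in nhds 0. \<bar>e\<bar> * x < y" using that by (intro order_tendstoD) auto
    then show ?thesis by eventually_elim simp
  qed
  have good: "\<forall>\<^sub>F e in nhds 0. good e"
    using reg uniform_limitD[OF lim zero_less_one] small[OF \<rho>, of "M * L"] small[of "1/4" "M / \<rho> * L", simplified]
  proof eventually_elim
    case (elim e)
    have "norm (F e (fst p) (snd p)) \<le> M" if p: "p \<in> C3" for p
    proof -
      have "dist (F e (fst p) (snd p)) (F 0 (fst p) (snd p)) < 1" using elim(2) p by (auto simp: C3_def)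
      then show ?thesis using M0[OF p] norm_triangle_sub[of "F e (fst p) (snd p)" "F 0 (fst p) (snd p)"]
        by (simp add: M_def dist_norm)
    qed
    then show ?case unfolding good_def C3_def R_def using elim by (auto simp: mult.assoc)
  qed
  have lipF: "norm (F e t z - F e t w) \<le> M / \<rho> * norm (z - w)"
    if g: "good e" and t: "t \<in> {0..2*L}" and zw: "z \<in> R 2" "w \<in> R 2" for e t z w
  proof (rule field_differentiable_bound[OF cvR[of 2]])
    fix \<zeta> assume \<zeta>: "\<zeta> \<in> R 2"
    have sub: "cball \<zeta> \<rho> \<subseteq> R 3" unfolding R_def
      by (rule cball_subset_complex_box[OF \<zeta>[unfolded R_def]]) simp
    have hol: "F e t holomorphic_on R 3" using g t by (auto simp: good_def)
    show "(F e t has_field_derivative deriv (F e t) \<zeta>) (at \<zeta> within R 2)"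
      using holomorphic_derivI[OF hol opR] \<zeta> Rmono[of 2 3] by (auto intro: has_field_derivative_at_within)
    have "norm ((deriv ^^ 1) (F e t) \<zeta>) \<le> fact 1 * M / \<rho> ^ 1"
    proof (rule Cauchy_inequality)
      show "F e t holomorphic_on ball \<zeta> \<rho>" using hol order.trans[OF ball_subset_cball sub] by (rule holomorphic_on_subset)
      show "continuous_on (cball \<zeta> \<rho>) (F e t)"
        using holomorphic_on_subset[OF hol sub] by (rule holomorphic_on_imp_continuous_on)
      fix x assume "norm (\<zeta> - x) = \<rho>"
      then have "x \<in> R 3" using sub by (auto simp: dist_norm)
      then have "(t, x) \<in> C3" using t Rsub by (auto simp: C3_def)
      then show "norm (F e t x) \<le> M" using g by (force simp: good_def)
    qed (rule \<rho>)
    then show "norm (deriv (F e t) \<zeta>) \<le> M / \<rho>" by simp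
  qed (use zw in auto)
  define ok where "ok e t v \<longleftrightarrow>
      (\<forall>z\<in>R 1. v 0 z = z) \<and>
      (\<forall>s\<in>{0..L}. \<forall>z\<in>R 1. norm (v s z - z) \<le> \<bar>e\<bar> * M * s) \<and>
      (\<forall>s\<in>{0..L}. \<forall>z\<in>R 1.
         ((\<lambda>s. v s z) has_vector_derivative of_real e * F e (t + s) (v s z)) (at s within {0..L})) \<and>
      (\<forall>s\<in>{0..L}. v s holomorphic_on R 1) \<and>
      (\<forall>s\<in>{0..L}. \<forall>z\<in>R 1. \<forall>w\<in>R 1. 2 * norm (v s z - v s w - (z - w)) \<le> norm (z - w)) \<and>
      (\<forall>s\<in>{0..L}. \<forall>x. of_real x \<in> R 1 \<longrightarrow> v s (of_real x) \<in> \<real>)" for e t v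
  have ex: "\<exists>v. ok e t v" if g: "good e" and t: "t \<in> {0..L}" for e t
  proof -
    have dom: "t + s \<in> {0..2*L}" if "s \<in> {0..L}" for s using t that by auto
    have inC3: "(t + s, z) \<in> C3" if "s \<in> {0..L}" "z \<in> R 2" for s z
      using dom[OF that(1)] that(2) Rsub Rmono[of 2 3] by (auto simp: C3_def)
    show ?thesis
    proof (rule holomorphic_flow[of L "R 1" "R 2" "\<bar>e\<bar> * M" "\<bar>e\<bar> * (M / \<rho>)" "\<lambda>s z. of_real e * F e (t + s) z"])
      have "continuous_on ({0..L} \<times> R 2) (\<lambda>p. F e (fst (t + fst p, snd p)) (snd (t + fst p, snd p)))"
        by (rule continuous_on_compose2[of C3 "\<lambda>p. F e (fst p) (snd p)"])
           (use g inC3 in \<open>auto simp: good_def intro!: continuous_intros\<close>)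
      then show "continuous_on ({0..L} \<times> R 2) (\<lambda>(s, z). of_real e * F e (t + s) z)"
        by (auto simp: case_prod_beta intro!: continuous_intros)
      show "norm (of_real e * F e (t + s) z) \<le> \<bar>e\<bar> * M" if "s \<in> {0..L}" "z \<in> R 2" for s z
        using g inC3[OF that] by (force simp: norm_mult good_def intro!: mult_left_mono)
      show "norm (of_real e * F e (t + s) z - of_real e * F e (t + s) w) \<le> \<bar>e\<bar> * (M / \<rho>) * norm (z - w)"
        if "s \<in> {0..L}" "z \<in> R 2" "w \<in> R 2" for s z w
        using mult_left_mono[OF lipF[OF g dom[OF that(1)] that(2,3)], of "\<bar>e\<bar>"]
        by (simp add: norm_mult mult.assoc flip: right_diff_distrib)
      show "(\<lambda>z. of_real e * F e (t + s) z) holomorphic_on R 2" if "s \<in> {0..L}" for s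
      proof -
        have "F e (t + s) holomorphic_on R 3" using g dom[OF that] by (simp add: good_def)
        then have "F e (t + s) holomorphic_on R 2" by (rule holomorphic_on_subset) (rule Rmono, simp)
        then show ?thesis by (intro holomorphic_on_mult holomorphic_on_const)
      qed
      show "of_real e * F e (t + s) (of_real x) \<in> \<real>" if "s \<in> {0..L}" "of_real x \<in> R 2" for s x
        using g dom[OF that(1)] that(2) Rmono[of 2 3] by (intro Reals_mult) (auto simp: good_def)
      show "cball z (\<bar>e\<bar> * M * L) \<subseteq> R 2" if "z \<in> R 1" for z
        unfolding R_def
        by (rule cball_subset_complex_box[OF that[unfolded R_def]]) (use g \<rho> in \<open>auto simp: good_def\<close>)
    next
      fix v
      assume "\<And>z. z \<in> R 1 \<Longrightarrow> v 0 z = z"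
        "\<And>s z. s \<in> {0..L} \<Longrightarrow> z \<in> R 1 \<Longrightarrow> norm (v s z - z) \<le> \<bar>e\<bar> * M * s"
        "\<And>s z. s \<in> {0..L} \<Longrightarrow> z \<in> R 1 \<Longrightarrow> ((\<lambda>s. v s z) has_vector_derivative of_real e * F e (t + s) (v s z)) (at s within {0..L})"
        "\<And>s. s \<in> {0..L} \<Longrightarrow> v s holomorphic_on R 1"
        and lip: "\<And>s z w. s \<in> {0..L} \<Longrightarrow> z \<in> R 1 \<Longrightarrow> w \<in> R 1 \<Longrightarrow>
          norm (v s z - v s w - (z - w)) \<le> 2 * (\<bar>e\<bar> * (M / \<rho>)) * L * norm (z - w)"
        and
        "\<And>s x. s \<in> {0..L} \<Longrightarrow> of_real x \<in> R 1 \<Longrightarrow> v s (of_real x) \<in> \<real>"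
      moreover have "2 * norm (v s z - v s w - (z - w)) \<le> norm (z - w)" if "s \<in> {0..L}" "z \<in> R 1" "w \<in> R 1" for s z w
      proof -
        have "2 * norm (v s z - v s w - (z - w)) \<le> (4 * (\<bar>e\<bar> * (M / \<rho>) * L)) * norm (z - w)"
          using mult_left_mono[OF lip[OF that], of 2] by (simp add: mult_ac)
        also have "\<dots> \<le> 1 * norm (z - w)"
        proof (rule mult_right_mono)
          have "\<bar>e\<bar> * (M / \<rho>) * L \<le> 1 / 4" using g by (simp only: good_def)
          then show "4 * (\<bar>e\<bar> * (M / \<rho>) * L) \<le> 1" by linarith
        qed simp
        finally show ?thesis by simp
      qed
      ultimately show "\<exists>v. ok e t v" unfolding ok_def by blast
    qed (use L M \<rho> g opR in \<open>auto simp: good_def\<close>)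
  qed
  define u where "u e t = (SOME v. ok e t v)" for e t
  have u: "ok e t (u e t)" if "good e" "t \<in> {0..L}" for e t
    unfolding u_def using ex[OF that] by (rule someI_ex)
  have lim_u: "uniform_limit (R 1) (\<lambda>e z. (u e 0 L z - z) / of_real e) (\<lambda>z. integral {0..L} (\<lambda>s. F 0 s z)) (at 0)"
  proof (rule uniform_limitI)
    fix \<eta> :: real assume \<eta>: "0 < \<eta>"
    \<comment> \<open>Two errors of at most \<open>\<delta>\<close> are integrated over the length
      \<open>L\<close>: one from replacing \<open>F e\<close> by \<open>F 0\<close>, one from
      replacing the solution by its initial value. Together they stay below
      \<open>\<eta>\<close>.\<close>
    define \<delta> where "\<delta> = \<eta> / (3 * L)"
    have \<delta>: "\<delta> > 0" using \<eta> L by (simp add: \<delta>_def)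
    \<comment> \<open>Neighbourhoods of 0 contain 0 itself, so \<open>F 0\<close> has the bounds of
      \<open>good\<close> as well.\<close>
    have good0: "good 0" using good by (rule eventually_nhds_x_imp_x)
    have "\<forall>\<^sub>F e in nhds 0. e \<noteq> 0 \<longrightarrow> (\<forall>z\<in>R 1. dist ((u e 0 L z - z) / of_real e) (integral {0..L} (\<lambda>s. F 0 s z)) < \<eta>)"
      using good uniform_limitD[OF lim \<delta>] small[OF \<delta>, of "M * L * (M / \<rho>)"]
    proof eventually_elim
      case (elim e)
      show ?case
      proof (intro impI ballI)
        fix z assume e: "e \<noteq> 0" and z: "z \<in> R 1"
        define v where "v s = u e 0 s z" for s
        have L0: "0 \<in> {0..L}" using L by simp
        note oku = u[OF elim(1) L0, unfolded ok_def]
        have v2: "v s \<in> R 2" if "s \<in> {0..L}" for s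
        proof -
          have "norm (v s - z) \<le> \<bar>e\<bar> * M * s" using oku that z by (auto simp: v_def)
          also have "\<dots> \<le> \<bar>e\<bar> * M * L" using that M by (intro mult_left_mono) auto
          also have "\<dots> \<le> \<rho>" using elim(1) by (simp add: good_def)
          finally have "v s \<in> cball z \<rho>" by (simp add: dist_norm norm_minus_commute)
          then show ?thesis using cball_subset_complex_box[of z a b \<rho> \<rho> "2*\<rho>"] z by (auto simp: R_def)
        qed
        have z2: "z \<in> R 2" using z Rmono[of 1 2] by auto
        have dv: "(v has_vector_derivative of_real e * F e s (v s)) (at s within {0..L})" if "s \<in> {0..L}" for s
          using oku that z unfolding v_def by force
        have contv: "continuous_on {0..L} v"
          using dv by (rule continuous_on_vector_derivative)
        have contF: "continuous_on {0..L} (\<lambda>s. F e' s (q s))" if g': "good e'" and cq: "continuous_on {0..L} q" and qR: "\<And>s. s \<in> {0..L} \<Longrightarrow> q s \<in> R 2" for e' q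
        proof -
          have qC: "(s, q s) \<in> C3" if "s \<in> {0..L}" for s
          proof -
            have "q s \<in> complex_cbox a b (3*\<rho>)" using qR[OF that] Rmono[of 2 3] Rsub by auto
            then show ?thesis using that L by (auto simp: C3_def)
          qed
          have "continuous_on {0..L} (\<lambda>s. F e' (fst (s, q s)) (snd (s, q s)))"
            by (rule continuous_on_compose2[of C3 "\<lambda>p. F e' (fst p) (snd p)"])
               (use g' cq qC in \<open>auto simp: good_def intro!: continuous_intros\<close>)
          then show ?thesis by simp
        qed
        have c1: "continuous_on {0..L} (\<lambda>s. F e s (v s))" by (rule contF[OF elim(1) contv v2])
        have c2: "continuous_on {0..L} (\<lambda>s. F 0 s z)" by (rule contF[OF good0 continuous_on_const z2])
        have "((\<lambda>s. of_real e * F e s (v s)) has_integral (v L - v 0)) {0..L}"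
          by (rule fundamental_theorem_of_calculus) (use L dv in auto)
        then have "((\<lambda>s. (1 / of_real e) * (of_real e * F e s (v s))) has_integral (1 / of_real e) * (v L - v 0)) {0..L}"
          by (rule has_integral_mult_right)
        then have "((\<lambda>s. F e s (v s)) has_integral (u e 0 L z - z) / of_real e) {0..L}"
          using e z oku by (simp add: v_def)
        then have eq: "(u e 0 L z - z) / of_real e = integral {0..L} (\<lambda>s. F e s (v s))" by (simp add: integral_unique)
        have "norm (integral {0..L} (\<lambda>s. F e s (v s) - F 0 s z)) \<le> (2 * \<delta>) * (L - 0)"
        proof (rule integral_bound)
          fix s assume s: "s \<in> {0..L}"
          then have s2: "s \<in> {0..2*L}" by auto
          have "norm (F e s (v s) - F 0 s (v s)) \<le> \<delta>"
            using elim(2) s2 v2[OF s] Rmono[of 2 3] Rsub by (force simp: dist_norm less_imp_le)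
          moreover have "norm (F 0 s (v s) - F 0 s z) \<le> \<delta>"
          proof -
            have "norm (F 0 s (v s) - F 0 s z) \<le> M / \<rho> * norm (v s - z)"
              by (rule lipF[OF good0 s2 v2[OF s] z2])
            also have "\<dots> \<le> M / \<rho> * (\<bar>e\<bar> * M * L)"
            proof (rule mult_left_mono)
              have "norm (v s - z) \<le> \<bar>e\<bar> * M * s" using oku s z by (auto simp: v_def)
              also have "\<dots> \<le> \<bar>e\<bar> * M * L" using s M by (intro mult_left_mono) auto
              finally show "norm (v s - z) \<le> \<bar>e\<bar> * M * L" .
            qed (use M \<rho> in auto)
            finally show ?thesis using elim(3) by (simp add: mult_ac)
          qed
          ultimately show "norm (F e s (v s) - F 0 s z) \<le> 2 * \<delta>"
            using norm_triangle_ineq[of "F e s (v s) - F 0 s (v s)" "F 0 s (v s) - F 0 s z"] by simp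
        qed (use L in \<open>auto intro!: continuous_intros c1 c2\<close>)
        also have "integral {0..L} (\<lambda>s. F e s (v s) - F 0 s z) = (u e 0 L z - z) / of_real e - integral {0..L} (\<lambda>s. F 0 s z)"
          unfolding eq by (rule integral_diff) (rule integrable_continuous_interval[OF c1], rule integrable_continuous_interval[OF c2])
        also have "(2 * \<delta>) * (L - 0) < \<eta>" using \<eta> L by (simp add: \<delta>_def)
        finally show "dist ((u e 0 L z - z) / of_real e) (integral {0..L} (\<lambda>s. F 0 s z)) < \<eta>"
          by (simp add: dist_norm)
      qed
    qed
    then show "\<forall>\<^sub>F e in at 0. \<forall>z\<in>R 1. dist ((u e 0 L z - z) / of_real e) (integral {0..L} (\<lambda>s. F 0 s z)) < \<eta>"
      by (simp add: eventually_at_filter)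
  qed
  show ?thesis
  proof (rule that[of M u])
    show "0 \<le> M" using M by simp
    show "uniform_limit (complex_box a b \<rho>) (\<lambda>e z. (u e 0 L z - z) / of_real e) (\<lambda>z. integral {0..L} (\<lambda>s. F 0 s z)) (at 0)"
      unfolding R1 by (rule lim_u)
    show "\<forall>\<^sub>F e in nhds 0. \<bar>e\<bar> * M * L \<le> \<rho> \<and> (\<forall>t\<in>{0..L}.
      (\<forall>z\<in>complex_box a b \<rho>. u e t 0 z = z) \<and>
      (\<forall>s\<in>{0..L}. \<forall>z\<in>complex_box a b \<rho>. norm (u e t s z - z) \<le> \<bar>e\<bar> * M * s) \<and>
      (\<forall>s\<in>{0..L}. \<forall>z\<in>complex_box a b \<rho>.
         ((\<lambda>s. u e t s z) has_vector_derivative of_real e * F e (t + s) (u e t s z)) (at s within {0..L})) \<and>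
      (\<forall>s\<in>{0..L}. u e t s holomorphic_on complex_box a b \<rho>) \<and>
      (\<forall>s\<in>{0..L}. \<forall>z\<in>complex_box a b \<rho>. \<forall>w\<in>complex_box a b \<rho>. 2 * norm (u e t s z - u e t s w - (z - w)) \<le> norm (z - w)) \<and>
      (\<forall>s\<in>{0..L}. \<forall>x. of_real x \<in> complex_box a b \<rho> \<longrightarrow> u e t s (of_real x) \<in> \<real>))"
      using good
    proof eventually_elim
      case (elim e)
      have "\<bar>e\<bar> * M * L \<le> \<rho>" using elim by (simp add: good_def)
      then show ?case unfolding R1 using u[OF elim] unfolding ok_def by blast
    qed
  qed
qed

lemma uniform_limit_sum:
  assumes "\<And>i. i \<in> I \<Longrightarrow> uniform_limit S (f i) (l i) F"
  shows "uniform_limit S (\<lambda>n x. \<Sum>i\<in>I. f i n x) (\<lambda>x. \<Sum>i\<in>I. l i x :: 'b::real_normed_vector) F"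
  using assms by (induction I rule: infinite_finite_induct) (auto intro!: uniform_limit_intros)

section \<open>The radial equation\<close>

text \<open>Here \<open>m\<close> stands for \<open>2 * n\<close>, \<open>k\<close> for
  \<open>r ^ (2 * n - 1)\<close>, and \<open>p\<close>, \<open>q\<close> for the values of the
  perturbation. After multiplication by \<open>D\<close> the terms combine to the Wronskian, and
  what remains is one common multiple of the two components of the perturbed field.\<close>

lemma polar_identity:
  fixes A B dA dB V \<kappa> D m k r e p q :: real
  assumes "D \<noteq> 0" "\<kappa> \<noteq> 0"
    and wr: "A * dB - m * B * dA = - (m * \<kappa> * V)"
    and D: "D = m * V * (r * k * k) + e * (m * k * B * q + A * p)"
  shows "- (e * (r * dA * p + r * k * dB * q)) / D * A + r * dA = \<kappa> * m * V * (r * k) / D * (r * k * (dA / \<kappa>) + e * q)"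
    and "m * k * (- (e * (r * dA * p + r * k * dB * q)) / D) * B + r * k * dB
      = \<kappa> * m * V * (r * k) / D * (r * k * k * (dB / \<kappa>) - e * p)"
proof -
  have g: "(x / D * y + z) * D = x * y + z * D" "(u * (x / D) * y + z) * D = u * x * y + z * D" for u x y z
    using assms(1) by (simp_all add: distrib_right)
  have w: "m * \<kappa> * V = m * B * dA - A * dB" using wr by simp
  have "(- (e * (r * dA * p + r * k * dB * q)) / D * A + r * dA) * D
      = - (e * (r * dA * p + r * k * dB * q)) * A + r * dA * (m * V * (r * k * k) + e * (m * k * B * q + A * p))"
    unfolding g unfolding D ..
  also have "\<dots> = m * V * (r * k) * (r * k * dA) + e * q * (r * k) * (m * B * dA - A * dB)"
    by (simp add: algebra_simps)
  also have "\<dots> = \<kappa> * m * V * (r * k) * (r * k * (dA / \<kappa>) + e * q)"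
    unfolding w[symmetric] using assms(2) by (simp add: field_simps)
  finally show "- (e * (r * dA * p + r * k * dB * q)) / D * A + r * dA = \<kappa> * m * V * (r * k) / D * (r * k * (dA / \<kappa>) + e * q)"
    using assms(1) by (simp add: eq_divide_eq)
  have "(m * k * (- (e * (r * dA * p + r * k * dB * q)) / D) * B + r * k * dB) * D
      = m * k * - (e * (r * dA * p + r * k * dB * q)) * B + r * k * dB * (m * V * (r * k * k) + e * (m * k * B * q + A * p))"
    unfolding g unfolding D ..
  also have "\<dots> = m * V * (r * k) * (r * k * k * dB) - e * p * (r * k) * (m * B * dA - A * dB)"
    by (simp add: algebra_simps)
  also have "\<dots> = \<kappa> * m * V * (r * k) * (r * k * k * (dB / \<kappa>) - e * p)"
    unfolding w[symmetric] using assms(2) by (simp add: field_simps)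
  finally show "m * k * (- (e * (r * dA * p + r * k * dB * q)) / D) * B + r * k * dB
      = \<kappa> * m * V * (r * k) / D * (r * k * k * (dB / \<kappa>) - e * p)"
    using assms(1) by (simp add: eq_divide_eq)
qed

text \<open>The degree bound \<open>d\<close> is common to all small \<open>e\<close>, so that both
  families are sums over one finite index set and converge as soon as their coefficients do.\<close>

locale perturbation = center +
  fixes P Q :: "real \<Rightarrow> real poly poly" and d :: nat
  assumes degP: "\<forall>\<^sub>F e in nhds 0. total_degree_le d (P e)"
    and degQ: "\<forall>\<^sub>F e in nhds 0. total_degree_le d (Q e)"
    and coeffP: "((\<lambda>e. coeff (coeff (P e) j) i) \<longlongrightarrow> coeff (coeff (P 0) j) i) (nhds 0)"
    and coeffQ: "((\<lambda>e. coeff (coeff (Q e) j) i) \<longlongrightarrow> coeff (coeff (Q 0) j) i) (nhds 0)"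
begin

definition cev :: "real poly poly \<Rightarrow> complex \<Rightarrow> complex \<Rightarrow> complex" where
  "cev p x y = (\<Sum>j\<le>d. \<Sum>i\<le>d. of_real (coeff (coeff p j) i) * x ^ i * y ^ j)"

text \<open>With \<open>x = z A\<close> and \<open>y = z ^ (2 * n) B\<close>, Cramer's rule
  expresses the radial and the angular velocity: \<open>e * num\<close> and \<open>- den\<close> are
  the two numerators over the same determinant. The unperturbed part of the first has cancelled,
  because the curves of constant radius are unperturbed orbits.\<close>

definition num :: "real \<Rightarrow> real \<Rightarrow> complex \<Rightarrow> complex" where
  "num e \<phi> z = z * of_real (dA \<phi>) * cev (P e) (z * of_real (A \<phi>)) (z ^ (2 * n) * of_real (B \<phi>))
     + z ^ (2 * n) * of_real (dB \<phi>) * cev (Q e) (z * of_real (A \<phi>)) (z ^ (2 * n) * of_real (B \<phi>))"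

definition den :: "real \<Rightarrow> real \<Rightarrow> complex \<Rightarrow> complex" where
  "den e \<phi> z = of_real (real (2 * n) * VV \<phi>) * z ^ (4 * n - 1)
     + of_real e * (of_real (real (2 * n)) * z ^ (2 * n - 1) * of_real (B \<phi>) * cev (Q e) (z * of_real (A \<phi>)) (z ^ (2 * n) * of_real (B \<phi>))
       + of_real (A \<phi>) * cev (P e) (z * of_real (A \<phi>)) (z ^ (2 * n) * of_real (B \<phi>)))"

definition F :: "real \<Rightarrow> real \<Rightarrow> complex \<Rightarrow> complex" where
  "F e \<phi> z = - num e \<phi> z / den e \<phi> z"

definition rnum :: "real \<Rightarrow> real \<Rightarrow> real \<Rightarrow> real" where
  "rnum e \<phi> r = r * dA \<phi> * bieval (P e) (E \<phi> r) + r ^ (2 * n) * dB \<phi> * bieval (Q e) (E \<phi> r)"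

definition rden :: "real \<Rightarrow> real \<Rightarrow> real \<Rightarrow> real" where
  "rden e \<phi> r = real (2 * n) * VV \<phi> * r ^ (4 * n - 1)
     + e * (real (2 * n) * r ^ (2 * n - 1) * B \<phi> * bieval (Q e) (E \<phi> r) + A \<phi> * bieval (P e) (E \<phi> r))"

abbreviation X :: "real \<Rightarrow> plane \<Rightarrow> plane" where "X \<equiv> perturbed_field n c P Q"

lemma cev_of_real: "total_degree_le d p \<Longrightarrow> cev p (of_real x) (of_real y) = of_real (bieval p (x, y))"
  by (simp add: cev_def bieval_eq_sum)

lemma num_of_real:
  assumes "total_degree_le d (P e)" "total_degree_le d (Q e)"
  shows "num e \<phi> (of_real r) = of_real (rnum e \<phi> r)" "den e \<phi> (of_real r) = of_real (rden e \<phi> r)"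
  using assms cev_of_real[of _ "r * A \<phi>" "r ^ (2 * n) * B \<phi>"]
  by (simp_all add: num_def den_def rnum_def rden_def E_def)

text \<open>The link between the radial equation and the field: the curve in the plane is an orbit
  up to its speed, and the factor is the time per unit angle.\<close>

lemma polar_derivative:
  assumes dv: "(v has_real_derivative - (e * rnum e (t + s) (v s)) / rden e (t + s) (v s)) (at s within S)"
    and D: "rden e (t + s) (v s) \<noteq> 0"
  shows "((\<lambda>s. E (t + s) (v s)) has_vector_derivative
     (\<kappa> (t + s) * real (2 * n) * VV (t + s) * v s ^ (2 * n) / rden e (t + s) (v s)) *\<^sub>R X e (E (t + s) (v s))) (at s within S)"
proof -
  define \<phi> where "\<phi> = t + s"
  define r where "r = v s"
  define k where "k = r ^ (2 * n - 1)"
  obtain m where m: "n = Suc m" using n1 by (cases n) auto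
  have rk: "r ^ (2 * n) = r * k" "r ^ (4 * n - 1) = r * k * k"
    by (simp_all add: k_def m numeral_3_eq_3 flip: power_add power_Suc)
  have ts: "((\<lambda>s. t + s) has_real_derivative 1) (at s within S)"
    by (auto intro!: derivative_eq_intros)
  have d1: "((\<lambda>s. A (t + s)) has_real_derivative dA \<phi>) (at s within S)"
    using DERIV_chain2[of A "dA (t + s)" "\<lambda>s. t + s" s 1 S, OF A_deriv ts] by (simp add: \<phi>_def)
  have d2: "((\<lambda>s. B (t + s)) has_real_derivative dB \<phi>) (at s within S)"
    using DERIV_chain2[of B "dB (t + s)" "\<lambda>s. t + s" s 1 S, OF B_deriv ts] by (simp add: \<phi>_def)
  define v' where "v' = - (e * rnum e \<phi> r) / rden e \<phi> r"
  have dv': "(v has_real_derivative v') (at s within S)" using dv by (simp add: v'_def \<phi>_def r_def)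
  define p where "p = bieval (P e) (E \<phi> r)"
  define q where "q = bieval (Q e) (E \<phi> r)"
  have v'eq: "v' = - (e * (r * dA \<phi> * p + r * k * dB \<phi> * q)) / rden e \<phi> r"
    unfolding v'_def rnum_def p_def q_def rk ..
  have Deq: "rden e \<phi> r = real (2 * n) * VV \<phi> * (r * k * k) + e * (real (2 * n) * k * B \<phi> * q + A \<phi> * p)"
    unfolding rden_def p_def q_def rk k_def[symmetric] ..
  have D0: "rden e \<phi> r \<noteq> 0" using D by (simp add: \<phi>_def r_def)
  have k0: "\<kappa> \<phi> \<noteq> 0" using \<kappa>_pos[of \<phi>] by simp
  note id = polar_identity[OF D0 _ wronskian[of \<phi>] Deq, folded v'eq]
  define \<sigma> where "\<sigma> = \<kappa> \<phi> * real (2 * n) * VV \<phi> * (r * k) / rden e \<phi> r"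
  have X: "X e (E \<phi> r) = (r * k * (dA \<phi> / \<kappa> \<phi>) + e * q, r * k * k * (dB \<phi> / \<kappa> \<phi>) - e * p)"
  proof -
    have q: "dA \<phi> / \<kappa> \<phi> = B \<phi> + A \<phi> ^ (2 * n)" "dB \<phi> / \<kappa> \<phi> = 2 * n * c * A \<phi> ^ (4 * n - 1)"
      using k0 by (simp_all add: dA_def dB_def)
    show ?thesis
      unfolding q perturbed_field_def p_def q_def E_def case_prod_conv power_mult_distrib rk by (simp add: distrib_left)
  qed
  have "((\<lambda>s. v s * A (t + s)) has_real_derivative v' * A \<phi> + r * dA \<phi>) (at s within S)"
    by (rule DERIV_cong[OF DERIV_mult[OF dv' d1]]) (simp add: r_def \<phi>_def)
  also have "v' * A \<phi> + r * dA \<phi> = \<sigma> * fst (X e (E \<phi> r))"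
    unfolding X \<sigma>_def using id(1)[OF k0] by (simp add: mult_ac)
  finally have f1: "((\<lambda>s. v s * A (t + s)) has_real_derivative \<sigma> * fst (X e (E \<phi> r))) (at s within S)" .
  have "((\<lambda>s. v s ^ (2 * n)) has_real_derivative real (2 * n) * k * v') (at s within S)"
    by (rule DERIV_cong[OF DERIV_power[OF dv']]) (simp add: k_def r_def)
  from DERIV_mult[OF this d2] have "((\<lambda>s. v s ^ (2 * n) * B (t + s)) has_real_derivative real (2 * n) * k * v' * B \<phi> + r * k * dB \<phi>) (at s within S)"
    by (rule DERIV_cong) (simp add: \<phi>_def flip: rk r_def)
  also have "real (2 * n) * k * v' * B \<phi> + r * k * dB \<phi> = \<sigma> * snd (X e (E \<phi> r))"
    unfolding X \<sigma>_def using id(2)[OF k0] by (simp add: mult_ac)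
  finally have f2: "((\<lambda>s. v s ^ (2 * n) * B (t + s)) has_real_derivative \<sigma> * snd (X e (E \<phi> r))) (at s within S)" .
  have "((\<lambda>s. (v s * A (t + s), v s ^ (2 * n) * B (t + s))) has_vector_derivative
      (\<sigma> * fst (X e (E \<phi> r)), \<sigma> * snd (X e (E \<phi> r)))) (at s within S)"
    using f1 f2 unfolding has_real_derivative_iff_has_vector_derivative by (rule has_vector_derivative_Pair)
  also have "(\<sigma> * fst (X e (E \<phi> r)), \<sigma> * snd (X e (E \<phi> r))) = \<sigma> *\<^sub>R X e (E \<phi> r)"
    by (simp add: scaleR_prod_def)
  finally show ?thesis unfolding E_def[symmetric] \<sigma>_def rk[symmetric] by (simp add: \<phi>_def r_def)
qed

section \<open>Uniform convergence and holomorphy of the radial field\<close>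

lemma bounded_image: "compact K \<Longrightarrow> continuous_on K q \<Longrightarrow> bounded (q ` K)"
  by (rule compact_imp_bounded[OF compact_continuous_image])

lemma continuous_on_cev [continuous_intros]:
  "continuous_on S f \<Longrightarrow> continuous_on S g \<Longrightarrow> continuous_on S (\<lambda>x. cev p (f x) (g x))"
  unfolding cev_def by (intro continuous_intros)

lemma continuous_on_num: "continuous_on K (\<lambda>p. num e (fst p) (snd p))"
  and continuous_on_den: "continuous_on K (\<lambda>p. den e (fst p) (snd p))"
  unfolding num_def den_def by (intro continuous_intros)+

lemma uniform_limit_cev:
  assumes K: "compact K" and f: "continuous_on K f" and g: "continuous_on K g"
    and co: "\<And>j i. ((\<lambda>e. coeff (coeff (R e) j) i) \<longlongrightarrow> coeff (coeff (R 0) j) i) (nhds 0)"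
  shows "uniform_limit K (\<lambda>e p. cev (R e) (f p) (g p)) (\<lambda>p. cev (R 0) (f p) (g p)) (nhds 0)"
  unfolding cev_def
  by (intro uniform_limit_sum uniform_limit_const uniform_lim_mult
      uniform_limit_tendsto_const tendsto_of_real co bounded_image K continuous_intros f g)

lemma uniform_limit_num_den:
  assumes K: "compact K"
  shows "uniform_limit K (\<lambda>e p. num e (fst p) (snd p)) (\<lambda>p. num 0 (fst p) (snd p)) (nhds 0)"
    and "uniform_limit K (\<lambda>e p. den e (fst p) (snd p)) (\<lambda>p. den 0 (fst p) (snd p)) (nhds 0)"
proof -
  have c: "uniform_limit K (\<lambda>e p. cev (R e) (snd p * of_real (A (fst p))) (snd p ^ (2 * n) * of_real (B (fst p))))
      (\<lambda>p. cev (R 0) (snd p * of_real (A (fst p))) (snd p ^ (2 * n) * of_real (B (fst p)))) (nhds 0)"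
    if "\<And>j i. ((\<lambda>e. coeff (coeff (R e) j) i) \<longlongrightarrow> coeff (coeff (R 0) j) i) (nhds 0)" for R
    by (rule uniform_limit_cev[OF K _ _ that]) (intro continuous_intros)+
  have k: "uniform_limit K (\<lambda>e p. q p) q (nhds 0)" for q :: "real \<times> complex \<Rightarrow> complex"
    by (rule uniform_limit_const)
  show "uniform_limit K (\<lambda>e p. num e (fst p) (snd p)) (\<lambda>p. num 0 (fst p) (snd p)) (nhds 0)"
    unfolding num_def
    by (intro uniform_limit_add uniform_lim_mult c coeffP coeffQ k bounded_image K continuous_intros)
  have "uniform_limit K (\<lambda>e p. of_real e) (\<lambda>p. of_real 0 :: complex) (nhds 0)"
    by (intro uniform_limit_tendsto_const tendsto_of_real filterlim_ident)
  then show "uniform_limit K (\<lambda>e p. den e (fst p) (snd p)) (\<lambda>p. den 0 (fst p) (snd p)) (nhds 0)"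
    unfolding den_def
    by (intro uniform_limit_add uniform_lim_mult c coeffP coeffQ k bounded_image K continuous_intros)
qed

text \<open>The margin \<open>3 * (a / 4)\<close> keeps real parts positive, away from the
  singularity at radius 0. On the compact set \<open>den 0\<close> then has modulus at least some
  \<open>m > 0\<close>, and \<open>den e\<close> stays within \<open>m\<close> of it for small
  \<open>e\<close>; at real radii this preserves the sign.\<close>

lemma F_regular:
  assumes a: "0 < a" "a \<le> b"
  defines "K \<equiv> {0..2 * (2 * pi)} \<times> complex_cbox a b (3 * (a / 4))"
  shows "uniform_limit K (\<lambda>e p. F e (fst p) (snd p)) (\<lambda>p. F 0 (fst p) (snd p)) (nhds 0)"
    and "\<forall>\<^sub>F e in nhds 0. total_degree_le d (P e) \<and> total_degree_le d (Q e) \<and>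
        continuous_on K (\<lambda>p. F e (fst p) (snd p)) \<and>
        (\<forall>t\<in>{0..2 * (2 * pi)}. F e t holomorphic_on complex_box a b (3 * (a / 4))) \<and>
        (\<forall>t\<in>{0..2 * (2 * pi)}. \<forall>x. of_real x \<in> complex_box a b (3 * (a / 4)) \<longrightarrow> F e t (of_real x) \<in> \<real>) \<and>
        (\<forall>t\<in>{0..2 * (2 * pi)}. \<forall>r. of_real r \<in> complex_box a b (3 * (a / 4)) \<longrightarrow> 0 < r \<and> 0 < rden e t r)"
proof -
  have K: "compact K" by (auto simp: K_def complex_cbox_def intro!: compact_Times)
  have zpos: "Re z > 0" if "z \<in> complex_cbox a b (3 * (a / 4))" for z
    using that a(1) by (auto simp: complex_cbox_def in_cbox_complex_iff)
  have sub: "complex_box a b (3 * (a / 4)) \<subseteq> complex_cbox a b (3 * (a / 4))"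
    by (simp add: complex_box_def complex_cbox_def box_subset_cbox)
  have den0: "den 0 \<phi> z = of_real (real (2 * n) * VV \<phi>) * z ^ (4 * n - 1)" for \<phi> z by (simp add: den_def)
  obtain m where m: "0 < m" "\<And>p. p \<in> K \<Longrightarrow> m \<le> norm (den 0 (fst p) (snd p))"
  proof -
    have ne: "K \<noteq> {}"
    proof -
      have "(0, of_real a) \<in> K" using a by (auto simp: K_def complex_cbox_def in_cbox_complex_iff)
      then show ?thesis by auto
    qed
    obtain p0 where p0: "p0 \<in> K" "\<And>p. p \<in> K \<Longrightarrow> norm (den 0 (fst p0) (snd p0)) \<le> norm (den 0 (fst p) (snd p))"
      using continuous_attains_inf[OF K ne continuous_on_norm[OF continuous_on_den]] by blast
    have "snd p0 \<noteq> 0" using zpos[of "snd p0"] p0(1) by (auto simp: K_def)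
    then have "norm (den 0 (fst p0) (snd p0)) > 0" using VV_pos[of "fst p0"] n1 by (simp add: den0)
    then show ?thesis using that p0(2) by blast
  qed
  show "uniform_limit K (\<lambda>e p. F e (fst p) (snd p)) (\<lambda>p. F 0 (fst p) (snd p)) (nhds 0)"
    unfolding F_def
    by (intro uniform_lim_divide[where b=m] uniform_limit_uminus uniform_limit_num_den K m bounded_image continuous_intros
        continuous_on_num)
  have "\<forall>\<^sub>F e in nhds 0. \<forall>p\<in>K. dist (den e (fst p) (snd p)) (den 0 (fst p) (snd p)) < m"
    by (rule uniform_limitD[OF uniform_limit_num_den(2)[OF K] m(1)])
  then show "\<forall>\<^sub>F e in nhds 0. total_degree_le d (P e) \<and> total_degree_le d (Q e) \<and>
        continuous_on K (\<lambda>p. F e (fst p) (snd p)) \<and>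
        (\<forall>t\<in>{0..2 * (2 * pi)}. F e t holomorphic_on complex_box a b (3 * (a / 4))) \<and>
        (\<forall>t\<in>{0..2 * (2 * pi)}. \<forall>x. of_real x \<in> complex_box a b (3 * (a / 4)) \<longrightarrow> F e t (of_real x) \<in> \<real>) \<and>
        (\<forall>t\<in>{0..2 * (2 * pi)}. \<forall>r. of_real r \<in> complex_box a b (3 * (a / 4)) \<longrightarrow> 0 < r \<and> 0 < rden e t r)"
    using degP degQ
  proof eventually_elim
    case (elim e)
    have ne: "den e t z \<noteq> 0" if "t \<in> {0..2 * (2 * pi)}" "z \<in> complex_cbox a b (3 * (a / 4))" for t z
    proof -
      have "(t, z) \<in> K" using that by (simp add: K_def)
      with elim(1) m(2) show ?thesis by (force simp: dist_norm)
    qed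
    show ?case
    proof (intro conjI ballI allI impI)
      show "continuous_on K (\<lambda>p. F e (fst p) (snd p))"
        unfolding F_def by (intro continuous_intros continuous_on_num continuous_on_den) (use ne in \<open>auto simp: K_def\<close>)
      show "F e t holomorphic_on complex_box a b (3 * (a / 4))" if "t \<in> {0..2 * (2 * pi)}" for t
        unfolding F_def num_def[abs_def] den_def[abs_def] cev_def
        apply (intro holomorphic_intros)
        using ne[OF that] sub by (auto simp: den_def cev_def)
      show "F e t (of_real x) \<in> \<real>" for t x
        unfolding F_def num_of_real[OF elim(2,3)] by (metis Reals_divide Reals_minus Reals_of_real)
      fix t r assume t: "t \<in> {0..2 * (2 * pi)}" and r: "complex_of_real r \<in> complex_box a b (3 * (a / 4))"
      then have Kin: "(t, of_real r) \<in> K" using sub by (auto simp: K_def)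
      show r0: "0 < r" using zpos[of "of_real r"] r sub by auto
      have "\<bar>rden e t r - real (2 * n) * VV t * r ^ (4 * n - 1)\<bar> = norm (den e t (of_real r) - den 0 t (of_real r))"
        unfolding num_of_real[OF elim(2,3)] den0 by (metis norm_of_real of_real_diff of_real_mult of_real_power)
      also have "\<dots> < m" using elim(1) Kin by (force simp: dist_norm)
      also have "m \<le> norm (den 0 t (of_real r))" using m(2)[OF Kin] by simp
      also have "\<dots> = real (2 * n) * VV t * r ^ (4 * n - 1)"
        unfolding den0 using VV_pos[of t] r0 by (simp add: norm_mult norm_power)
      finally show "0 < rden e t r" by linarith
    qed (use elim in auto)
  qed
qed

end

lemma continuous_on_bieval [continuous_intros]:
  assumes f: "continuous_on S f" shows "continuous_on S (\<lambda>x. bieval p (f x))"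
proof -
  have "bieval (pCons a q) z = poly a (fst z) + snd z * bieval q z" for a q z
    by (simp add: bieval_def)
  moreover have "bieval 0 z = 0" for z by (simp add: bieval_def)
  ultimately show ?thesis
    by (induction p) (auto intro!: continuous_intros f continuous_on_fst continuous_on_snd)
qed

context perturbation
begin

lemma continuous_on_rden:
  "continuous_on S (f :: real \<Rightarrow> real) \<Longrightarrow> continuous_on S g \<Longrightarrow> continuous_on S (\<lambda>s. rden e (f s) (g s))"
  unfolding rden_def by (intro continuous_intros)

lemma F_of_real:
  assumes "total_degree_le d (P e)" "total_degree_le d (Q e)"
  shows "F e \<phi> (of_real r) = of_real (- rnum e \<phi> r / rden e \<phi> r)"
  by (simp add: F_def num_of_real[OF assms])

text \<open>The time per unit angle along the perturbed solution through
  \<open>E \<phi> r\<close>.\<close>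

definition rate :: "real \<Rightarrow> real \<Rightarrow> real \<Rightarrow> real" where
  "rate e \<phi> r = \<kappa> \<phi> * real (2 * n) * VV \<phi> * r ^ (2 * n) / rden e \<phi> r"

text \<open>A function \<open>v\<close> on \<open>[0, 2 \<pi>]\<close> traces, from the angle \<open>t\<close> on, one turn of a solution of the
  perturbed system; \<open>\<eta>\<close> is the angle as a function of time.\<close>

definition transit :: "real \<Rightarrow> real \<Rightarrow> (real \<Rightarrow> real) \<Rightarrow> bool" where
  "transit e t v \<longleftrightarrow> (\<exists>T \<eta>. 0 < T \<and> \<eta> 0 = 0 \<and> \<eta> T = 2 * pi \<and> strict_mono_on {0..T} \<eta> \<and>
     \<eta> ` {0..T} = {0..2 * pi} \<and> solution_on (X e) (\<lambda>\<tau>. E (t + \<eta> \<tau>) (v (\<eta> \<tau>))) {0..T} \<and>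
     (\<forall>\<tau>\<in>{0..T}. (\<eta> has_real_derivative 1 / rate e (t + \<eta> \<tau>) (v (\<eta> \<tau>))) (at \<tau> within {0..T})))"

lemma transitI:
  assumes der: "\<And>s. s \<in> {0..2 * pi} \<Longrightarrow>
      (v has_real_derivative - (e * rnum e (t + s) (v s)) / rden e (t + s) (v s)) (at s within {0..2 * pi})"
    and pos: "\<And>s. s \<in> {0..2 * pi} \<Longrightarrow> 0 < v s" "\<And>s. s \<in> {0..2 * pi} \<Longrightarrow> 0 < rden e (t + s) (v s)"
  shows "transit e t v"
proof -
  define \<sigma> where "\<sigma> s = rate e (t + s) (v s)" for s
  have cv: "continuous_on {0..2 * pi} v"
    by (rule DERIV_continuous_on) (rule der)
  have c\<sigma>: "continuous_on {0..2 * pi} \<sigma>"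
    unfolding \<sigma>_def rate_def using pos(2)
    by (intro continuous_intros continuous_on_rden cv) force
  have \<sigma>0: "0 < \<sigma> s" if "s \<in> {0..2 * pi}" for s
    unfolding \<sigma>_def rate_def using pos[OF that] \<kappa>_pos VV_pos n1 by simp
  obtain s0 where s0: "s0 \<in> {0..2 * pi}" "\<And>s. s \<in> {0..2 * pi} \<Longrightarrow> \<sigma> s0 \<le> \<sigma> s"
    using continuous_attains_inf[OF _ _ c\<sigma>] by auto
  show ?thesis
  proof (rule reparametrization[of "2 * pi" \<sigma> "\<sigma> s0" "\<lambda>s. E (t + s) (v s)" "X e"])
    show "((\<lambda>s. E (t + s) (v s)) has_vector_derivative \<sigma> s *\<^sub>R X e (E (t + s) (v s))) (at s within {0..2 * pi})"
      if "s \<in> {0..2 * pi}" for s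
      unfolding \<sigma>_def rate_def by (rule polar_derivative[OF der[OF that]]) (use pos(2)[OF that] in simp)
    fix T \<eta> assume "0 < T" "\<eta> 0 = 0" "\<eta> T = 2 * pi" "strict_mono_on {0..T} \<eta>" "\<eta> ` {0..T} = {0..2 * pi}"
      "solution_on (X e) ((\<lambda>s. E (t + s) (v s)) \<circ> \<eta>) {0..T}"
      "\<And>\<tau>. \<tau> \<in> {0..T} \<Longrightarrow> (\<eta> has_real_derivative 1 / \<sigma> (\<eta> \<tau>)) (at \<tau> within {0..T})"
    then show ?thesis unfolding transit_def \<sigma>_def o_def by blast
  qed (use c\<sigma> s0 \<sigma>0 in auto)
qed

text \<open>\<open>v e t s r\<close> is the radius at the angle \<open>t + s\<close> of the orbit
  with radius \<open>r\<close> at the angle \<open>t\<close>, and \<open>g e\<close> is the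
  displacement over the full turn from angle 0, divided by \<open>e\<close>. The other starting
  angles are there to carry arbitrary points of a periodic orbit to the cross-section.\<close>

lemma radial_flow:
  assumes a: "0 < a" "a \<le> b"
  obtains v :: "real \<Rightarrow> real \<Rightarrow> real \<Rightarrow> real \<Rightarrow> real" and g :: "real \<Rightarrow> complex \<Rightarrow> complex" and C :: real
  where "0 \<le> C"
    "\<forall>\<^sub>F e in nhds 0.
      (\<forall>t\<in>{0..2 * pi}. \<forall>r\<in>{a..b}. v e t 0 r = r \<and>
         (\<forall>s\<in>{0..2 * pi}. \<bar>v e t s r - r\<bar> \<le> \<bar>e\<bar> * C \<and> 0 < v e t s r) \<and>
         continuous_on {0..2 * pi} (\<lambda>s. v e t s r) \<and> transit e t (\<lambda>s. v e t s r)) \<and>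
      (\<forall>r\<in>{a..b}. \<forall>r'\<in>{a..b}. r < r' \<longrightarrow> v e 0 (2 * pi) r < v e 0 (2 * pi) r') \<and>
      g e holomorphic_on complex_box a b (a / 4) \<and>
      (\<forall>x. of_real x \<in> complex_box a b (a / 4) \<longrightarrow> g e (of_real x) \<in> \<real>) \<and>
      (\<forall>r\<in>{a..b}. g e (of_real r) = of_real ((v e 0 (2 * pi) r - r) / e))"
    "uniform_limit (complex_box a b (a / 4)) g (\<lambda>z. integral {0..2 * pi} (\<lambda>s. F 0 s z)) (at 0)"
proof -
  note reg = F_regular(2)[OF a] and lim = F_regular(1)[OF a]
  have reg': "\<forall>\<^sub>F e in nhds 0. continuous_on ({0..2*(2*pi)} \<times> complex_cbox a b (3*(a/4))) (\<lambda>p. F e (fst p) (snd p)) \<and>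
        (\<forall>t\<in>{0..2*(2*pi)}. F e t holomorphic_on complex_box a b (3*(a/4))) \<and>
        (\<forall>t\<in>{0..2*(2*pi)}. \<forall>x. of_real x \<in> complex_box a b (3*(a/4)) \<longrightarrow> F e t (of_real x) \<in> \<real>)"
    using reg by eventually_elim blast
  have L: "0 < 2 * pi" and \<rho>: "0 < a / 4" using a by auto
  obtain u C where C: "0 \<le> C" and u: "\<forall>\<^sub>F e in nhds 0. \<bar>e\<bar> * C * (2*pi) \<le> a/4 \<and> (\<forall>t\<in>{0..2*pi}.
      (\<forall>z\<in>complex_box a b (a/4). u e t 0 z = z) \<and>
      (\<forall>s\<in>{0..2*pi}. \<forall>z\<in>complex_box a b (a/4). norm (u e t s z - z) \<le> \<bar>e\<bar> * C * s) \<and>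
      (\<forall>s\<in>{0..2*pi}. \<forall>z\<in>complex_box a b (a/4).
         ((\<lambda>s. u e t s z) has_vector_derivative of_real e * F e (t + s) (u e t s z)) (at s within {0..2*pi})) \<and>
      (\<forall>s\<in>{0..2*pi}. u e t s holomorphic_on complex_box a b (a/4)) \<and>
      (\<forall>s\<in>{0..2*pi}. \<forall>z\<in>complex_box a b (a/4). \<forall>w\<in>complex_box a b (a/4).
         2 * norm (u e t s z - u e t s w - (z - w)) \<le> norm (z - w)) \<and>
      (\<forall>s\<in>{0..2*pi}. \<forall>x. of_real x \<in> complex_box a b (a/4) \<longrightarrow> u e t s (of_real x) \<in> \<real>))"
    and ulim: "uniform_limit (complex_box a b (a/4)) (\<lambda>e z. (u e 0 (2*pi) z - z) / of_real e) (\<lambda>z. integral {0..2*pi} (\<lambda>s. F 0 s z)) (at 0)"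
    by (rule small_parameter_flow[OF L \<rho> lim reg'])
  define v where "v e t s r = Re (u e t s (of_real r))" for e t s r
  define g where "g e z = (u e 0 (2*pi) z - z) / of_real e" for e z
  have in_box: "complex_of_real r \<in> complex_box a b (a/4)" if "r \<in> {a..b}" for r
    using that a by (auto simp: complex_box_def in_box_complex_iff)
  show ?thesis
  proof (rule that[of "C * (2 * pi)" v g])
    show "0 \<le> C * (2 * pi)" using C by simp
    show "uniform_limit (complex_box a b (a/4)) g (\<lambda>z. integral {0..2*pi} (\<lambda>s. F 0 s z)) (at 0)"
      using ulim by (simp add: g_def[abs_def])
    show "\<forall>\<^sub>F e in nhds 0.
      (\<forall>t\<in>{0..2 * pi}. \<forall>r\<in>{a..b}. v e t 0 r = r \<and>
         (\<forall>s\<in>{0..2 * pi}. \<bar>v e t s r - r\<bar> \<le> \<bar>e\<bar> * (C * (2 * pi)) \<and> 0 < v e t s r) \<and>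
         continuous_on {0..2 * pi} (\<lambda>s. v e t s r) \<and> transit e t (\<lambda>s. v e t s r)) \<and>
      (\<forall>r\<in>{a..b}. \<forall>r'\<in>{a..b}. r < r' \<longrightarrow> v e 0 (2 * pi) r < v e 0 (2 * pi) r') \<and>
      g e holomorphic_on complex_box a b (a / 4) \<and>
      (\<forall>x. of_real x \<in> complex_box a b (a / 4) \<longrightarrow> g e (of_real x) \<in> \<real>) \<and>
      (\<forall>r\<in>{a..b}. g e (of_real r) = of_real ((v e 0 (2 * pi) r - r) / e))"
      using reg u
    proof eventually_elim
      case (elim e)
      note deg = elim(1)[THEN conjunct1] elim(1)[THEN conjunct2, THEN conjunct1]
      have uv: "u e t s (of_real r) = of_real (v e t s r)" if "t \<in> {0..2*pi}" "s \<in> {0..2*pi}" "r \<in> {a..b}" for t s r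
      proof -
        have "u e t s (of_real r) \<in> \<real>" using elim(2) that in_box by blast
        then show ?thesis by (simp add: v_def of_real_Re)
      qed
      have close: "\<bar>v e t s r - r\<bar> \<le> \<bar>e\<bar> * (C * (2 * pi))" "\<bar>v e t s r - r\<bar> \<le> a/4"
        if "t \<in> {0..2*pi}" "s \<in> {0..2*pi}" "r \<in> {a..b}" for t s r
      proof -
        have "norm (u e t s (of_real r) - of_real r) \<le> \<bar>e\<bar> * C * s" using elim(2) that in_box by blast
        also have "\<dots> \<le> \<bar>e\<bar> * C * (2 * pi)" using that C by (intro mult_left_mono) auto
        finally show "\<bar>v e t s r - r\<bar> \<le> \<bar>e\<bar> * (C * (2 * pi))"
          unfolding uv[OF that] by (simp add: mult.assoc flip: of_real_diff)
        also have "\<dots> \<le> a/4" using elim(2) by (simp add: mult.assoc)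
        finally show "\<bar>v e t s r - r\<bar> \<le> a/4" .
      qed
      have box3: "complex_of_real (v e t s r) \<in> complex_box a b (3 * (a / 4))"
        if "t \<in> {0..2*pi}" "s \<in> {0..2*pi}" "r \<in> {a..b}" for t s r
      proof -
        have "v e t s r - r \<le> a/4" "r - v e t s r \<le> a/4" using close(2)[OF that] by linarith+
        then show ?thesis using that(3) a by (auto simp: complex_box_def in_box_complex_iff)
      qed
      have pos: "0 < v e t s r" "0 < rden e (t + s) (v e t s r)" if "t \<in> {0..2*pi}" "s \<in> {0..2*pi}" "r \<in> {a..b}" for t s r
      proof -
        have "t + s \<in> {0..2 * (2 * pi)}" using that by auto
        then show "0 < v e t s r" "0 < rden e (t + s) (v e t s r)" using elim(1) box3[OF that] by blast+
      qed
      have der: "((\<lambda>s. v e t s r) has_real_derivative - (e * rnum e (t + s) (v e t s r)) / rden e (t + s) (v e t s r)) (at s within {0..2 * pi})"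
        if "t \<in> {0..2*pi}" "s \<in> {0..2*pi}" "r \<in> {a..b}" for t s r
      proof -
        have "((\<lambda>s. u e t s (of_real r)) has_vector_derivative of_real e * F e (t + s) (u e t s (of_real r))) (at s within {0..2*pi})"
          using elim(2) that in_box by blast
        then have "((\<lambda>s. Re (u e t s (of_real r))) has_vector_derivative Re (of_real e * F e (t + s) (u e t s (of_real r)))) (at s within {0..2*pi})"
          by (rule bounded_linear.has_vector_derivative[OF bounded_linear_Re])
        moreover have "Re (of_real e * F e (t + s) (u e t s (of_real r))) = - (e * rnum e (t + s) (v e t s r)) / rden e (t + s) (v e t s r)"
          unfolding uv[OF that] F_of_real[OF deg] by (simp flip: of_real_mult)
        ultimately show ?thesis by (simp add: has_real_derivative_iff_has_vector_derivative v_def)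
      qed
      have z0: "(0::real) \<in> {0..2*pi}" "2*pi \<in> {0..2*pi}" by auto
      show ?case
      proof (intro conjI ballI allI impI)
        fix t r assume t: "t \<in> {0..2 * pi}" and r: "r \<in> {a..b}"
        show "v e t 0 r = r" using elim(2) t in_box[OF r] by (simp add: v_def)
        show "continuous_on {0..2 * pi} (\<lambda>s. v e t s r)"
          by (rule DERIV_continuous_on) (rule der[OF t _ r])
        show "transit e t (\<lambda>s. v e t s r)"
          by (rule transitI) (use der[OF t _ r] pos[OF t _ r] in auto)
        fix s assume s: "s \<in> {0..2 * pi}"
        show "\<bar>v e t s r - r\<bar> \<le> \<bar>e\<bar> * (C * (2 * pi))" "0 < v e t s r"
          using close[OF t s r] pos[OF t s r] by auto
      next
        fix r r' assume r: "r \<in> {a..b}" "r' \<in> {a..b}" and lt: "r < r'"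
        \<comment> \<open>The turn differs from the identity by a map with Lipschitz constant 1/2,
          hence is strictly increasing.\<close>
        have "2 * norm (u e 0 (2*pi) (of_real r) - u e 0 (2*pi) (of_real r') - (of_real r - of_real r')) \<le> norm (complex_of_real r - of_real r')"
          using elim(2) z0 in_box[OF r(1)] in_box[OF r(2)] by blast
        then have "2 * \<bar>v e 0 (2*pi) r - v e 0 (2*pi) r' - (r - r')\<bar> \<le> \<bar>r - r'\<bar>"
          unfolding uv[OF z0 r(1)] uv[OF z0 r(2)] by (metis norm_of_real of_real_diff)
        moreover have "\<bar>r - r'\<bar> = r' - r" using lt by simp
        ultimately have "2 * (v e 0 (2*pi) r - v e 0 (2*pi) r' - (r - r')) \<le> r' - r"
          using abs_ge_self[of "v e 0 (2*pi) r - v e 0 (2*pi) r' - (r - r')"] by (metis abs_ge_self abs_mult abs_numeral order_trans)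
        then have "2 * v e 0 (2*pi) r - 2 * v e 0 (2*pi) r' \<le> r - r'" by (simp add: algebra_simps)
        then show "v e 0 (2 * pi) r < v e 0 (2 * pi) r'" using lt by simp
      next
        show "g e holomorphic_on complex_box a b (a / 4)"
        \<comment> \<open>The claim includes \<open>e = 0\<close>, where division by 0 turns
          \<open>g e\<close> into the zero function.\<close>
        proof (cases "e = 0")
          case False
          have "u e 0 (2*pi) holomorphic_on complex_box a b (a / 4)" using elim(2) z0 by blast
          then show ?thesis unfolding g_def[abs_def] using False by (intro holomorphic_intros) auto
        qed (simp add: g_def[abs_def])
        show "g e (of_real x) \<in> \<real>" if "of_real x \<in> complex_box a b (a / 4)" for x
        proof -
          have "u e 0 (2*pi) (of_real x) \<in> \<real>" using elim(2) z0 that by blast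
          then show ?thesis unfolding g_def by (intro Reals_divide Reals_diff Reals_of_real)
        qed
        show "g e (of_real r) = of_real ((v e 0 (2 * pi) r - r) / e)" if "r \<in> {a..b}" for r
          unfolding g_def uv[OF z0 that] by simp
      qed
    qed
  qed
qed

end

section \<open>Limit cycles as isolated closed solutions of the radial equation\<close>

lemma solution_on_subset: "solution_on X \<phi> I \<Longrightarrow> J \<subseteq> I \<Longrightarrow> solution_on X \<phi> J"
  unfolding solution_on_def by (blast intro: has_vector_derivative_within_subset)

lemma solution_on_shift:
  assumes "solution_on X \<phi> UNIV" shows "solution_on X (\<lambda>t. \<phi> (t0 + t)) UNIV"
  unfolding solution_on_def
proof
  fix t
  have "((\<lambda>t. t0 + t) has_vector_derivative 1) (at t)" by (auto intro!: derivative_eq_intros)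
  moreover have "(\<phi> has_vector_derivative X (\<phi> (t0 + t))) (at (t0 + t))"
    using assms by (auto simp: solution_on_def)
  ultimately have "(\<phi> \<circ> (\<lambda>t. t0 + t) has_vector_derivative 1 *\<^sub>R X (\<phi> (t0 + t))) (at t)"
    by (rule vector_diff_chain_at)
  then show "((\<lambda>t. \<phi> (t0 + t)) has_vector_derivative X (\<phi> (t0 + t))) (at t within UNIV)"
    by (simp add: o_def)
qed

lemma periodic_add_of_nat:
  assumes "\<And>t. \<phi> (t + T) = (\<phi> t :: 'a)" shows "\<phi> (t + real k * T) = \<phi> t"
proof (induction k)
  case (Suc k)
  then show ?case using assms[of "t + real k * T"] by (simp add: algebra_simps)
qed simp

lemma range_periodic:
  fixes \<phi> :: "real \<Rightarrow> 'a"
  assumes T: "0 < T" and per: "\<And>t. \<phi> (t + T) = \<phi> t"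
  shows "range \<phi> = \<phi> ` {0..T}"
proof (intro equalityI subsetI)
  fix z assume "z \<in> range \<phi>"
  then obtain t where z: "z = \<phi> t" by auto
  define k where "k = \<lfloor>t / T\<rfloor>"
  have k: "0 \<le> t - of_int k * T" "t - of_int k * T \<le> T"
    using floor_divide_lower[OF T, of t] floor_divide_upper[OF T, of t] by (auto simp: k_def algebra_simps)
  have "\<phi> (t - of_int k * T) = \<phi> t"
  proof (cases "0 \<le> k")
    case True
    then show ?thesis using periodic_add_of_nat[of \<phi> T "t - of_int k * T" "nat k", OF per] by simp
  next
    case False
    then show ?thesis using periodic_add_of_nat[of \<phi> T t "nat (- k)", OF per] by simp
  qed
  then show "z \<in> \<phi> ` {0..T}" using k z by (metis atLeastAtMost_iff imageI)
qed auto

text \<open>A self-map of \<open>A\<close> cannot move the least element down or the greatest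
  element up; the intermediate value theorem then gives a fixed point between them, possibly outside
  \<open>A\<close>.\<close>

lemma fixed_point_between_invariant:
  fixes R :: "real \<Rightarrow> real"
  assumes A: "compact A" "A \<noteq> {}" "A \<subseteq> {a..b}" "R ` A \<subseteq> A" and R: "continuous_on {a..b} R"
  obtains m M r where "m \<in> A" "M \<in> A" "m \<le> r" "r \<le> M" "R r = r"
proof -
  obtain m where m: "m \<in> A" "\<And>x. x \<in> A \<Longrightarrow> m \<le> x" using compact_attains_inf[OF A(1,2)] by blast
  obtain M where M: "M \<in> A" "\<And>x. x \<in> A \<Longrightarrow> x \<le> M" using compact_attains_sup[OF A(1,2)] by blast
  have "R m - m \<ge> 0" "R M - M \<le> 0" using m M A(4) by fastforce+
  moreover have "continuous_on {m..M} (\<lambda>r. R r - r)"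
    using m(1) M(1) A(3) by (intro continuous_intros continuous_on_subset[OF R]) auto
  moreover have "m \<le> M" using m M by blast
  ultimately obtain r where "m \<le> r" "r \<le> M" "R r - r = 0"
    using IVT2'[of "\<lambda>r. R r - r" M 0 m] by auto
  then show ?thesis using that m(1) M(1) by simp
qed

lemma no_int_multiple: "0 < x \<Longrightarrow> x < 2 * pi \<Longrightarrow> x \<noteq> 2 * pi * real_of_int k"
proof
  assume "0 < x" "x < 2 * pi" "x = 2 * pi * real_of_int k"
  then have "0 < k" "k < 1" by (auto simp: zero_less_mult_iff)
  then show False by linarith
qed

context perturbation
begin

lemma transit_unique:
  assumes "transit e t v"
  obtains T \<eta> where "0 < T" "\<eta> 0 = 0" "\<eta> T = 2 * pi" "strict_mono_on {0..T} \<eta>" "\<eta> ` {0..T} = {0..2 * pi}"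
    "solution_on (X e) (\<lambda>\<tau>. E (t + \<eta> \<tau>) (v (\<eta> \<tau>))) {0..T}"
    "\<And>\<tau>. \<tau> \<in> {0..T} \<Longrightarrow> (\<eta> has_real_derivative 1 / rate e (t + \<eta> \<tau>) (v (\<eta> \<tau>))) (at \<tau> within {0..T})"
    "\<And>\<phi> T' \<tau>. solution_on (X e) \<phi> {0..T'} \<Longrightarrow> \<phi> 0 = E t (v 0) \<Longrightarrow> 0 \<le> \<tau> \<Longrightarrow> \<tau> \<le> T \<Longrightarrow> \<tau> \<le> T' \<Longrightarrow>
        \<phi> \<tau> = E (t + \<eta> \<tau>) (v (\<eta> \<tau>))"
proof -
  obtain T \<eta> where T: "0 < T" "\<eta> 0 = 0" "\<eta> T = 2 * pi" "strict_mono_on {0..T} \<eta>" "\<eta> ` {0..T} = {0..2 * pi}"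
    "solution_on (X e) (\<lambda>\<tau>. E (t + \<eta> \<tau>) (v (\<eta> \<tau>))) {0..T}"
    "\<And>\<tau>. \<tau> \<in> {0..T} \<Longrightarrow> (\<eta> has_real_derivative 1 / rate e (t + \<eta> \<tau>) (v (\<eta> \<tau>))) (at \<tau> within {0..T})"
    using assms unfolding transit_def by blast
  show ?thesis
  proof (rule that[OF T])
    fix \<phi> T' \<tau> assume *: "solution_on (X e) \<phi> {0..T'}" "\<phi> 0 = E t (v 0)" "0 \<le> \<tau>" "\<tau> \<le> T" "\<tau> \<le> T'"
    show "\<phi> \<tau> = E (t + \<eta> \<tau>) (v (\<eta> \<tau>))"
      by (rule solution_unique[OF lipschitz_on_bounded_perturbed_field
              solution_on_subset[OF *(1)] solution_on_subset[OF T(6)], where T=\<tau>])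
         (use * T(2) in auto)
  qed
qed

lemma E_2pi: "E (2 * pi) r = E 0 r"
  using periodic(7)[of 0 1 r] by simp

lemma E_cross: "0 < r \<Longrightarrow> E 0 r \<in> cross_section"
  using E_cross_section[of r 0] by (auto intro: exI[of _ 0])

text \<open>By uniqueness the solution follows the turn. Before the time \<open>T\<close> its angle
  is strictly between 0 and \<open>2 * pi\<close>, off the section, and at \<open>T\<close> it is on
  the section; so the first return comes neither earlier nor later.\<close>

lemma first_return_transit:
  assumes tr: "transit e 0 v" and pos: "\<And>s. s \<in> {0..2 * pi} \<Longrightarrow> 0 < v s"
    and ret: "first_return (X e) cross_section (E 0 (v 0)) q"
  shows "q = E 0 (v (2 * pi))"
proof -
  obtain T \<eta> where T: "0 < T" "\<eta> 0 = 0" "\<eta> T = 2 * pi" "strict_mono_on {0..T} \<eta>" "\<eta> ` {0..T} = {0..2 * pi}"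
    and un: "\<And>\<phi> T' \<tau>. solution_on (X e) \<phi> {0..T'} \<Longrightarrow> \<phi> 0 = E 0 (v 0) \<Longrightarrow> 0 \<le> \<tau> \<Longrightarrow> \<tau> \<le> T \<Longrightarrow> \<tau> \<le> T' \<Longrightarrow>
        \<phi> \<tau> = E (0 + \<eta> \<tau>) (v (\<eta> \<tau>))"
    by (rule transit_unique[OF tr]) (rule that)
  obtain \<phi> T' where \<phi>: "q \<in> cross_section" "0 < T'" "solution_on (X e) \<phi> {0..T'}" "\<phi> 0 = E 0 (v 0)" "\<phi> T' = q"
     "\<forall>t\<in>{0<..<T'}. \<phi> t \<notin> cross_section"
    using ret unfolding first_return_def by blast
  have v2: "0 < v (2 * pi)" using pos by simp
  consider "T < T'" | "T' < T" | "T' = T" by linarith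
  then show ?thesis
  proof cases
    case 1
    then have "\<phi> T = E 0 (v (2 * pi))" using un[OF \<phi>(3,4), of T] T by (simp add: E_2pi)
    then have "\<phi> T \<in> cross_section" using E_cross[OF v2] by simp
    then show ?thesis using \<phi>(6) 1 T(1) by auto
  next
    case 2
    have \<eta>: "\<eta> T' \<in> {0..2 * pi}" "0 < \<eta> T'" "\<eta> T' < 2 * pi"
      using T(5) 2 \<phi>(2) strict_mono_onD[OF T(4), of 0 T'] strict_mono_onD[OF T(4), of T' T] T(2,3) by auto
    have "q = E (\<eta> T') (v (\<eta> T'))" using un[OF \<phi>(3,4), of T'] 2 \<phi>(2,5) by simp
    then obtain k :: int where "\<eta> T' = 2 * pi * k" using \<phi>(1) E_cross_section[OF pos[OF \<eta>(1)]] by auto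
    then show ?thesis using no_int_multiple[OF \<eta>(2,3)] by blast
  next
    case 3
    then show ?thesis using un[OF \<phi>(3,4), of T] T \<phi>(5) by (simp add: E_2pi)
  qed
qed

text \<open>The angle increases strictly during the turn, so no point is repeated before the orbit
  closes; this also rules out a constant solution.\<close>

lemma closed_transit:
  assumes tr: "transit e 0 v" and closed: "v (2 * pi) = v 0" and pos: "\<And>s. s \<in> {0..2 * pi} \<Longrightarrow> 0 < v s"
  obtains T \<zeta> where "0 < T" "solution_on (X e) \<zeta> UNIV" "\<And>t. \<zeta> (t + T) = \<zeta> t" "\<zeta> 0 = E 0 (v 0)"
    "range \<zeta> = (\<lambda>s. E s (v s)) ` {0..2 * pi}" "inj_on \<zeta> {0..<T}"
    "periodic_orbit (X e) ((\<lambda>s. E s (v s)) ` {0..2 * pi})"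
proof -
  obtain T \<eta> where T: "0 < T" "\<eta> 0 = 0" "\<eta> T = 2 * pi" "strict_mono_on {0..T} \<eta>" "\<eta> ` {0..T} = {0..2 * pi}"
    and sol: "solution_on (X e) (\<lambda>\<tau>. E (0 + \<eta> \<tau>) (v (\<eta> \<tau>))) {0..T}"
    by (rule transit_unique[OF tr]) (rule that)
  have "(\<lambda>\<tau>. E (0 + \<eta> \<tau>) (v (\<eta> \<tau>))) T = (\<lambda>\<tau>. E (0 + \<eta> \<tau>) (v (\<eta> \<tau>))) 0"
    by (simp add: T closed E_2pi)
  then obtain \<zeta> where \<zeta>: "solution_on (X e) \<zeta> UNIV" "\<And>t. \<zeta> (t + T) = \<zeta> t"
      "\<And>t. t \<in> {0..T} \<Longrightarrow> \<zeta> t = E (0 + \<eta> t) (v (\<eta> t))" "range \<zeta> = (\<lambda>\<tau>. E (0 + \<eta> \<tau>) (v (\<eta> \<tau>))) ` {0..T}"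
    by (rule periodic_extension[OF T(1) sol]) (rule that)
  have range: "range \<zeta> = (\<lambda>s. E s (v s)) ` {0..2 * pi}"
    unfolding \<zeta>(4) T(5)[symmetric] by (simp add: image_image)
  have inj: "inj_on \<zeta> {0..<T}"
  proof (rule inj_onI)
    fix x y assume xy: "x \<in> {0..<T}" "y \<in> {0..<T}" "\<zeta> x = \<zeta> y"
    have \<eta>: "\<eta> x \<in> {0..2 * pi}" "\<eta> y \<in> {0..2 * pi}" using xy T(5) by auto
    have \<eta>2: "\<eta> x < 2 * pi" "\<eta> y < 2 * pi"
      using strict_mono_onD[OF T(4), of x T] strict_mono_onD[OF T(4), of y T] xy T(1,3) by auto
    have "E (\<eta> x) (v (\<eta> x)) = E (\<eta> y) (v (\<eta> y))" using xy \<zeta>(3) by simp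
    then obtain k :: int where k: "\<eta> x = \<eta> y + 2 * pi * k" using E_eq_iff pos \<eta> by blast
    have "k = 0"
    proof (rule ccontr)
      assume "k \<noteq> 0"
      then have "1 \<le> real_of_int k \<or> 1 \<le> - real_of_int k" by linarith
      then show False
      proof
        assume "1 \<le> real_of_int k"
        then have "2 * pi * 1 \<le> 2 * pi * real_of_int k" by (intro mult_left_mono) auto
        then show False using k \<eta> \<eta>2 unfolding atLeastAtMost_iff by linarith
      next
        assume "1 \<le> - real_of_int k"
        then have "2 * pi * 1 \<le> 2 * pi * (- real_of_int k)" by (intro mult_left_mono) auto
        then show False using k \<eta> \<eta>2 unfolding atLeastAtMost_iff by linarith
      qed
    qed
    then have "\<eta> x = \<eta> y" using k by simp
    then show "x = y" using strict_mono_onD[OF T(4), of x y] strict_mono_onD[OF T(4), of y x] xy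
      by (cases x y rule: linorder_cases) auto
  qed
  have nc: "\<not> \<zeta> constant_on UNIV"
  proof
    assume "\<zeta> constant_on UNIV"
    then have "\<zeta> 0 = \<zeta> (T/2)" by (auto simp: constant_on_def)
    then show False using inj_onD[OF inj, of 0 "T/2"] T(1) by auto
  qed
  show ?thesis
  proof (rule that[OF T(1) \<zeta>(1,2) _ range inj])
    show "\<zeta> 0 = E 0 (v 0)" using \<zeta>(3)[of 0] T by simp
    show "periodic_orbit (X e) ((\<lambda>s. E s (v s)) ` {0..2 * pi})"
      unfolding periodic_orbit_def using T(1) \<zeta>(1,2) nc range by blast
  qed
qed

text \<open>No other periodic orbit may lie in \<open>U\<close>, not even one that closes only after
  several turns. The radii at which such an orbit crosses the section form a compact set invariant
  under the return map. Since this map is increasing with the isolated fixed point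
  \<open>r0\<close>, the set must contain \<open>r0\<close>, and uniqueness of solutions identifies
  the orbit.\<close>

lemma limit_cycleI:
  assumes a: "0 < a"
    and v: "\<And>t r. t \<in> {0..2 * pi} \<Longrightarrow> r \<in> {a..b} \<Longrightarrow> v t 0 r = r"
      "\<And>t s r. t \<in> {0..2 * pi} \<Longrightarrow> s \<in> {0..2 * pi} \<Longrightarrow> r \<in> {a..b} \<Longrightarrow> 0 < v t s r"
      "\<And>t r. t \<in> {0..2 * pi} \<Longrightarrow> r \<in> {a..b} \<Longrightarrow> transit e t (\<lambda>s. v t s r)"
    and mono: "\<And>r r'. r \<in> {a..b} \<Longrightarrow> r' \<in> {a..b} \<Longrightarrow> r < r' \<Longrightarrow> v 0 (2 * pi) r < v 0 (2 * pi) r'"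
    and cont: "continuous_on {a..b} (v 0 (2 * pi))"
    and r0: "r0 \<in> {a..b}" "v 0 (2 * pi) r0 = r0" "\<And>s. s \<in> {0..2 * pi} \<Longrightarrow> v 0 s r0 \<in> {a<..<b}"
    and \<epsilon>: "0 < \<epsilon>" "\<And>r. r \<in> {a..b} \<Longrightarrow> \<bar>r - r0\<bar> < \<epsilon> \<Longrightarrow> v 0 (2 * pi) r = r \<Longrightarrow> r = r0"
  shows "limit_cycle (X e) ((\<lambda>s. E s (v 0 s r0)) ` {0..2 * pi})"
proof -
  define \<Gamma> where "\<Gamma> = (\<lambda>s. E s (v 0 s r0)) ` {0..2 * pi}"
  have z0: "(0::real) \<in> {0..2 * pi}" "2 * pi \<in> {0..2 * pi}" by auto
  obtain T \<zeta> where \<zeta>: "0 < T" "solution_on (X e) \<zeta> UNIV" "\<And>t. \<zeta> (t + T) = \<zeta> t" "\<zeta> 0 = E 0 (v 0 0 r0)"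
    "range \<zeta> = \<Gamma>" "periodic_orbit (X e) \<Gamma>"
    unfolding \<Gamma>_def
    by (rule closed_transit[OF v(3)[OF z0(1) r0(1)]]) (use v(1,2)[OF z0(1)] r0 in auto)
  \<comment> \<open>\<open>U\<close> is the annulus between two level curves with the part of the
    section at distance at least \<open>\<epsilon>\<close> from \<open>r0\<close> cut out, so orbits
    inside \<open>U\<close> cross the section only near \<open>r0\<close>.\<close>
  define C where "C = E 0 ` ({a..b} - ball r0 \<epsilon>)"
  define U where "U = ((UNIV - {0}) \<inter> H -` {a ^ (4 * n)<..<b ^ (4 * n)}) - C"
  have openU: "open U" unfolding U_def
  proof (rule open_Diff)
    show "open ((UNIV - {0}) \<inter> H -` {a ^ (4 * n)<..<b ^ (4 * n)})"
      by (rule continuous_open_preimage[OF continuous_on_H]) (auto intro: open_Diff)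
    have "compact ({a..b} - ball r0 \<epsilon>)" by (intro compact_diff) auto
    then have "compact C" unfolding C_def
      by (intro compact_continuous_image continuous_intros) auto
    then show "closed C" by (rule compact_imp_closed)
  qed
  have n4: "0 < 4 * n" using n1 by simp
  have inU: "r \<in> {a<..<b}" if "E t r \<in> U" "0 < r" for t r
  proof -
    have *: "a ^ (4 * n) < r ^ (4 * n)" "r ^ (4 * n) < b ^ (4 * n)" using that H_E by (auto simp: U_def)
    have "a < r" using power_less_imp_less_base[OF *(1)] that by simp
    moreover from this have "r < b" using power_less_imp_less_base[OF *(2)] a
      by (metis "*"(2) a atLeastAtMost_iff dual_order.trans less_eq_real_def r0(1))
    ultimately show ?thesis by simp
  qed
  have \<Gamma>U: "\<Gamma> \<subseteq> U"
  proof
    fix z assume "z \<in> \<Gamma>"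
    then obtain s where s: "s \<in> {0..2 * pi}" "z = E s (v 0 s r0)" by (auto simp: \<Gamma>_def)
    note p = v(2)[OF z0(1) s(1) r0(1)]
    have "a ^ (4 * n) < v 0 s r0 ^ (4 * n)" "v 0 s r0 ^ (4 * n) < b ^ (4 * n)"
      using r0(3)[OF s(1)] a p n4 by (auto intro!: power_strict_mono)
    moreover have "z \<notin> C"
    proof
      assume "z \<in> C"
      then obtain r where r: "r \<in> {a..b}" "r \<notin> ball r0 \<epsilon>" "E s (v 0 s r0) = E 0 r" using s by (auto simp: C_def)
      then have "r = v 0 s r0" "\<exists>k::int. s = 0 + 2 * pi * k" using E_eq_iff[OF p, of r s 0] a by auto
      then have "s = 0 \<or> s = 2 * pi" using s(1) no_int_multiple[of s] by force
      then have "r = r0" using \<open>r = v 0 s r0\<close> r0(2) v(1)[OF z0(1) r0(1)] by auto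
      then show False using r(2) \<epsilon>(1) by simp
    qed
    ultimately show "z \<in> U" using E_ne[OF p, of s] s(2) H_E[OF p, of s] by (auto simp: U_def)
  qed
  have "\<gamma> = \<Gamma>" if per: "periodic_orbit (X e) \<gamma>" and sub: "\<gamma> \<subseteq> U" for \<gamma>
  proof -
    obtain \<phi> T' where \<phi>: "0 < T'" "solution_on (X e) \<phi> UNIV" "\<And>t. \<phi> (t + T') = \<phi> t" "\<gamma> = range \<phi>"
      using per unfolding periodic_orbit_def by blast
    have cpt: "compact \<gamma>"
    proof -
      have "continuous_on {0..T'} \<phi>"
        using solution_on_subset[OF \<phi>(2), of "{0..T'}"] unfolding solution_on_def
        by (auto intro: continuous_on_vector_derivative)
      then show ?thesis unfolding \<phi>(4) range_periodic[of T' \<phi>, OF \<phi>(1,3)] by (intro compact_continuous_image) auto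
    qed
    define A where "A = {a..b} \<inter> E 0 -` \<gamma>"
    have "compact A" unfolding A_def
      by (intro compact_Int_closed continuous_closed_vimage compact_imp_closed[OF cpt])
         (auto intro!: continuous_on_interior[of UNIV] continuous_intros)
    have Aball: "\<bar>r - r0\<bar> < \<epsilon>" if "r \<in> A" for r
    proof -
      have "E 0 r \<notin> C" "r \<in> {a..b}" using that sub by (auto simp: A_def U_def)
      then show ?thesis by (auto simp: C_def dist_real_def abs_minus_commute)
    qed
    \<comment> \<open>With \<open>s = 2 * pi - t\<close> this carries any point of the orbit to the
      section; with \<open>t = 0\<close> and \<open>s = 2 * pi\<close> it is the return map.\<close>
    have reach: "E (t + s) (v t s r) \<in> \<gamma>" if at: "\<phi> t0 = E t r" and t: "t \<in> {0..2 * pi}" and s: "s \<in> {0..2 * pi}" and r: "r \<in> {a..b}" for t0 t s r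
    proof -
      obtain T1 \<eta> where T: "0 < T1" "\<eta> ` {0..T1} = {0..2 * pi}"
        and un: "\<And>\<phi> T' \<tau>. solution_on (X e) \<phi> {0..T'} \<Longrightarrow> \<phi> 0 = E t (v t 0 r) \<Longrightarrow> 0 \<le> \<tau> \<Longrightarrow> \<tau> \<le> T1 \<Longrightarrow> \<tau> \<le> T' \<Longrightarrow>
          \<phi> \<tau> = E (t + \<eta> \<tau>) (v t (\<eta> \<tau>) r)"
        by (rule transit_unique[OF v(3)[OF t r]]) (rule that)
      obtain \<tau> where \<tau>: "\<tau> \<in> {0..T1}" "\<eta> \<tau> = s" using T(2) s by (metis imageE)
      have "\<phi> (t0 + \<tau>) = E (t + \<eta> \<tau>) (v t (\<eta> \<tau>) r)"
        by (rule un[of "\<lambda>x. \<phi> (t0 + x)" T1, OF solution_on_subset[OF solution_on_shift[OF \<phi>(2)]]])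
           (use \<tau> at v(1)[OF t r] in auto)
      then show ?thesis using \<tau>(2) \<phi>(4) by (metis rangeI)
    qed
    have point: "\<exists>t\<in>{0..2 * pi}. \<exists>r\<in>{a..b}. z = E t r" if "z \<in> \<gamma>" for z
    proof -
      have "z \<noteq> 0" "z \<in> U" using that sub by (auto simp: U_def)
      then obtain t r where "0 \<le> t" "t < 2 * pi" "0 < r" "z = E t r" by (elim E_surj)
      then show ?thesis using inU[of t r] \<open>z \<in> U\<close> by force
    qed
    have toA: "r \<in> A" if "E 0 r \<in> \<gamma>" "0 < r" for r
      using inU[of 0 r] that sub by (force simp: A_def)
    have "A \<noteq> {}"
    proof -
      obtain t r where tr: "t \<in> {0..2 * pi}" "r \<in> {a..b}" "\<phi> 0 = E t r" using point[of "\<phi> 0"] \<phi>(4) by auto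
      have s: "2 * pi - t \<in> {0..2 * pi}" using tr(1) by auto
      have "E 0 (v t (2 * pi - t) r) \<in> \<gamma>"
        using reach[OF tr(3,1) s tr(2)] by (simp add: E_2pi)
      then show ?thesis using toA v(2)[OF tr(1) s tr(2)] by blast
    qed
    have RA: "v 0 (2 * pi) r \<in> A" if r: "r \<in> A" for r
    proof -
      obtain t0 where "\<phi> t0 = E 0 r" using r \<phi>(4) by (auto simp: A_def)
      moreover have "r \<in> {a..b}" using r by (simp add: A_def)
      ultimately have "E 0 (v 0 (2 * pi) r) \<in> \<gamma>" using reach[of t0 0 r "2 * pi"] z0 by (simp add: E_2pi)
      then show ?thesis using toA v(2)[OF z0] r by (simp add: A_def)
    qed
    have "r0 \<in> A"
    proof (rule ccontr)
      assume nA: "r0 \<notin> A"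
      \<comment> \<open>An invariant compact set on one side of \<open>r0\<close> would produce a
        fixed point between its extremes, hence on the same side and still within
        \<open>\<epsilon>\<close> of \<open>r0\<close>.\<close>
      have no: False if A': "A' \<subseteq> A" "compact A'" "A' \<noteq> {}" "v 0 (2 * pi) ` A' \<subseteq> A'"
        and side: "(\<forall>r\<in>A'. r0 < r) \<or> (\<forall>r\<in>A'. r < r0)" for A'
      proof -
        have "A' \<subseteq> {a..b}" using A'(1) by (auto simp: A_def)
        then obtain m M r where r: "m \<in> A'" "M \<in> A'" "m \<le> r" "r \<le> M" "v 0 (2 * pi) r = r"
          using fixed_point_between_invariant[OF A'(2,3) _ A'(4) cont] by blast
        have "\<bar>m - r0\<bar> < \<epsilon>" "\<bar>M - r0\<bar> < \<epsilon>" using r A'(1) Aball by auto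
        then have "\<bar>r - r0\<bar> < \<epsilon>" using r(3,4) by (auto simp: abs_less_iff)
        moreover have "r \<in> {a..b}" using r A'(1) by (force simp: A_def)
        ultimately have "r = r0" using \<epsilon>(2) r(5) by blast
        then show False using side r by force
      qed
      have ne: "r \<noteq> r0" if "r \<in> A" for r using that nA by auto
      have Aab: "r \<in> {a..b}" if "r \<in> A" for r using that by (simp add: A_def)
      \<comment> \<open>Monotonicity keeps either side of the fixed point \<open>r0\<close>
        invariant.\<close>
      have "A \<inter> {r0..} = {}"
      proof (rule ccontr)
        assume "A \<inter> {r0..} \<noteq> {}"
        moreover have "v 0 (2 * pi) r \<in> A \<inter> {r0..}" if "r \<in> A \<inter> {r0..}" for r
          using mono[OF r0(1), of r] that RA Aab ne[of r] r0(2) by force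
        ultimately show False using no[of "A \<inter> {r0..}"] \<open>compact A\<close> ne by (force intro: compact_Int_closed)
      qed
      moreover have "A \<inter> {..r0} = {}"
      proof (rule ccontr)
        assume "A \<inter> {..r0} \<noteq> {}"
        moreover have "v 0 (2 * pi) r \<in> A \<inter> {..r0}" if "r \<in> A \<inter> {..r0}" for r
          using mono[OF _ r0(1), of r] that RA Aab ne[of r] r0(2) by force
        ultimately show False using no[of "A \<inter> {..r0}"] \<open>compact A\<close> ne by (force intro: compact_Int_closed)
      qed
      ultimately show False using \<open>A \<noteq> {}\<close> by force
    qed
    then obtain t0 where t0: "\<phi> t0 = E 0 r0" using \<phi>(4) by (auto simp: A_def)
    have agree: "\<phi> (t0 + t) = \<zeta> t" if "0 \<le> t" for t
      by (rule solution_unique[OF lipschitz_on_bounded_perturbed_field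
              solution_on_subset[OF solution_on_shift[OF \<phi>(2)]] solution_on_subset[OF \<zeta>(2)], where T=t])
         (use that t0 \<zeta>(4) v(1)[OF z0(1) r0(1)] in auto)
    show "\<gamma> = \<Gamma>"
    proof (intro equalityI subsetI)
      fix z assume "z \<in> \<gamma>"
      then obtain t where z: "z = \<phi> t" using \<phi>(4) by auto
      \<comment> \<open>The solutions are known to agree only forwards from \<open>t0\<close>, so
        \<open>t\<close> is first moved beyond \<open>t0\<close> by whole periods.\<close>
      obtain k :: nat where "(t0 - t) / T' < real k" using reals_Archimedean2 by blast
      then have "t0 \<le> t + real k * T'" using \<phi>(1) by (simp add: divide_less_eq)
      then have "\<phi> (t + real k * T') = \<zeta> (t + real k * T' - t0)"
        using agree[of "t + real k * T' - t0"] by simp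
      then show "z \<in> \<Gamma>" using z periodic_add_of_nat[of \<phi> T' t k, OF \<phi>(3)] \<zeta>(5) by (metis rangeI)
    next
      fix z assume "z \<in> \<Gamma>"
      then obtain t where "t \<in> {0..T}" "z = \<zeta> t" using range_periodic[of T \<zeta>, OF \<zeta>(1,3)] \<zeta>(5) by auto
      then show "z \<in> \<gamma>" using agree[of t] \<phi>(4) by (metis atLeastAtMost_iff rangeI)
    qed
  qed
  then show ?thesis unfolding limit_cycle_def \<Gamma>_def[symmetric]
    using \<zeta>(6) openU \<Gamma>U by blast
qed

end

section \<open>The Melnikov function as a polynomial\<close>

lemma integral_periodic_shift:
  fixes f :: "real \<Rightarrow> real"
  assumes f: "continuous_on UNIV f" "\<And>x. f (x + p) = f x" and t: "0 \<le> t" "t \<le> p"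
  shows "integral {0..p} (\<lambda>s. f (t + s)) = integral {0..p} f"
proof -
  have int: "f integrable_on {x..y}" for x y
    by (intro integrable_continuous_interval continuous_on_subset[OF f(1)]) auto
  have sh: "integral {x..y} (\<lambda>s. f (s + r)) = integral {x + r..y + r} f" for x y r
    using integral_shift[of x r y f] continuous_on_subset[OF f(1)] by (simp add: o_def)
  have "integral {0..p} (\<lambda>s. f (t + s)) = integral {t..p + t} f"
    using sh[of 0 p t] by (simp add: add.commute)
  also have "\<dots> = integral {t..p} f + integral {p..p + t} f"
    by (rule Henstock_Kurzweil_Integration.integral_combine[symmetric]) (use t int in auto)
  also have "integral {p..p + t} f = integral {0..t} f"
    using sh[of 0 t p] f(2) by (simp add: add.commute)
  also have "integral {t..p} f + integral {0..t} f = integral {0..p} f"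
    using Henstock_Kurzweil_Integration.integral_combine[of 0 t p f] t int by simp
  finally show ?thesis .
qed

text \<open>After a shift by \<open>pi / 2\<close> the reflection becomes
  \<open>x \<mapsto> - x\<close>, and the integrand is an odd function on a symmetric
  interval.\<close>

lemma integral_reflection_zero:
  fixes f :: "real \<Rightarrow> real"
  assumes f: "continuous_on UNIV f" "\<And>x. f (x + 2 * pi) = f x" "\<And>x. f (pi - x) = - f x"
  shows "integral {0..2 * pi} f = 0"
proof -
  define g where "g x = f (x + pi / 2)" for x
  \<comment> \<open>Modulo a period \<open>3 * pi / 2\<close> is \<open>- pi / 2\<close>; in terms
    of \<open>g\<close> the interval of integration becomes \<open>{- pi..pi}\<close>.\<close>
  have "integral {0..2 * pi} f = integral {0..2 * pi} (\<lambda>s. f (3 * pi / 2 + s))"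
    by (rule integral_periodic_shift[symmetric, OF f(1,2)]) auto
  also have "(\<lambda>s. f (3 * pi / 2 + s)) = (\<lambda>s. g (s + (- pi)))"
  proof
    fix s show "f (3 * pi / 2 + s) = g (s + (- pi))"
      using f(2)[of "s - pi / 2"] by (simp add: g_def algebra_simps)
  qed
  also have "integral {0..2 * pi} (\<lambda>s. g (s + (- pi))) = integral {- pi..pi} g"
  proof -
    have "continuous_on {0 + (- pi)..2 * pi + (- pi)} g"
      unfolding g_def by (rule continuous_on_compose2[OF f(1)]) (auto intro!: continuous_intros)
    from integral_shift[OF this] show ?thesis by (simp add: o_def)
  qed
  finally have 1: "integral {0..2 * pi} f = integral {- pi..pi} g" .
  have odd: "g (- x) = - g x" for x
    using f(3)[of "x + pi / 2"] by (simp add: g_def algebra_simps)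
  have "integral {- pi..pi} g = integral {- pi..pi} (\<lambda>x. g (- x))"
    using Henstock_Kurzweil_Integration.integral_reflect_real[of pi "- pi" g] by simp
  also have "\<dots> = - integral {- pi..pi} g" by (simp add: odd)
  finally show ?thesis using 1 by simp
qed

lemma center_field_eq: "center_field n c = perturbed_field n c P Q 0"
  by (auto simp: fun_eq_iff center_field_def perturbed_field_def)

lemma shift_into_period:
  fixes x t :: real
  obtains k :: int where "t \<le> x + 2 * pi * k" "x + 2 * pi * k \<le> t + 2 * pi"
proof -
  define k where "k = \<lceil>(t - x) / (2 * pi)\<rceil>"
  have "(t - x) / (2 * pi) \<le> of_int k" "of_int k < (t - x) / (2 * pi) + 1"
    unfolding k_def by linarith+
  then have "(t - x) / (2 * pi) * (2 * pi) \<le> of_int k * (2 * pi)" "of_int k * (2 * pi) < ((t - x) / (2 * pi) + 1) * (2 * pi)"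
    by (intro mult_right_mono mult_strict_right_mono; simp)+
  then have "t - x \<le> of_int k * (2 * pi)" "of_int k * (2 * pi) < t - x + 2 * pi"
    by (simp_all add: distrib_right)
  then show ?thesis using that[of k] by (simp add: mult.commute)
qed

context center
begin

text \<open>The Melnikov form pulled back by \<open>\<phi> \<mapsto> E \<phi> r\<close>.\<close>

definition mel :: "real poly poly \<Rightarrow> real poly poly \<Rightarrow> real \<Rightarrow> real \<Rightarrow> real" where
  "mel p q r \<phi> = (bieval p (E \<phi> r) * (r * dA \<phi>) + bieval q (E \<phi> r) * (r ^ (2 * n) * dB \<phi>)) / V (E \<phi> r)"

lemma level_orbit_eq:
  assumes r: "0 < r" shows "level_orbit n c (r ^ (4 * n)) = (\<lambda>s. E (t + s) r) ` {0..2 * pi}"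
proof (intro equalityI subsetI)
  fix z assume "z \<in> level_orbit n c (r ^ (4 * n))"
  then have z: "H z = r ^ (4 * n)" by (simp add: level_orbit_def)
  then have "z \<noteq> 0" using H_zero r n1 by auto
  then obtain \<phi> r' where E: "0 < r'" "z = E \<phi> r'" by (elim E_surj)
  then have "r' ^ (4 * n) = r ^ (4 * n)" using z H_E by simp
  then have "r' = r" using E(1) r n1 by (simp add: power_eq_iff_eq_base)
  obtain k :: int where k: "t \<le> \<phi> + 2 * pi * k" "\<phi> + 2 * pi * k \<le> t + 2 * pi" by (rule shift_into_period)
  have "z = E (t + (\<phi> + 2 * pi * k - t)) r" using periodic(7)[of \<phi> k r] E \<open>r' = r\<close> by simp
  then show "z \<in> (\<lambda>s. E (t + s) r) ` {0..2 * pi}" using k by (intro image_eqI[of _ _ "\<phi> + 2 * pi * k - t"]) auto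
qed (use r H_E in \<open>auto simp: level_orbit_def\<close>)

lemma continuous_mel: "r > 0 \<Longrightarrow> continuous_on S (mel p q r)"
  unfolding mel_def[abs_def] using V_pos[OF E_ne] by (intro continuous_intros) (auto simp: less_imp_neq[symmetric])

lemma mel_periodic: "mel p q r (\<phi> + 2 * pi) = mel p q r \<phi>"
  using periodic[of \<phi> 1] by (simp add: mel_def)

text \<open>The definite description requires existence and uniqueness. A solution that traverses
  the level once follows a turn of the polar coordinates from its own starting angle; its duration
  is that of the turn, and by periodicity the starting angle does not affect the integral.\<close>

lemma melnikov_eq:
  assumes r: "0 < r"
  shows "melnikov n c p q (r ^ (4 * n)) = integral {0..2 * pi} (mel p q r)"
proof -
  \<comment> \<open>The unperturbed system is the zero perturbation, so the results on turns apply
    to it.\<close>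
  interpret perturbation n c "\<lambda>_. 0" "\<lambda>_. 0" 0
    by unfold_locales (auto simp: total_degree_le_def)
  have X0: "X0 = X 0" by (rule center_field_eq)
  define I where "I = integral {0..2 * pi} (mel p q r)"
  define lf where "lf z = bieval p z / V z * fst (X0 z) + bieval q z / V z * snd (X0 z)" for z
  have rden0: "rden 0 \<phi> r = real (2 * n) * VV \<phi> * r ^ (4 * n - 1)" for \<phi> by (simp add: rden_def)
  have tr: "transit 0 t (\<lambda>_. r)" for t
    by (rule transitI) (use r VV_pos n1 in \<open>auto simp: rden0\<close>)
  have ratelf: "rate 0 \<phi> r * lf (E \<phi> r) = mel p q r \<phi>" and rate0: "rate 0 \<phi> r > 0" for \<phi>
  proof -
    obtain m where m: "n = Suc m" using n1 by (cases n) auto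
    define k where "k = r ^ (2 * n - 1)"
    have rk: "r ^ (2 * n) = r * k" "r ^ (4 * n - 1) = r * k * k"
      by (simp_all add: k_def m numeral_3_eq_3 flip: power_add power_Suc)
    have k: "k > 0" using r by (simp add: k_def)
    have rt: "rate 0 \<phi> r = \<kappa> \<phi> / k"
      unfolding rate_def rden0 rk using r k VV_pos[of \<phi>] n1 by simp
    then show "rate 0 \<phi> r > 0" using k \<kappa>_pos by simp
    have "\<kappa> \<phi> / k * fst (X0 (E \<phi> r)) = r * dA \<phi>"
      using k by (simp add: center_field_def E_def dA_def power_mult_distrib rk(1)) (simp add: field_simps)
    moreover have "\<kappa> \<phi> / k * snd (X0 (E \<phi> r)) = r ^ (2 * n) * dB \<phi>"
      using k by (simp add: center_field_def E_def dB_def power_mult_distrib rk[unfolded One_nat_def])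
    moreover have "x * (a / v * f + b / v * g) = (a * (x * f) + b * (x * g)) / v" for x a b v f g :: real
      by (simp add: add_divide_distrib distrib_left mult_ac)
    ultimately show "rate 0 \<phi> r * lf (E \<phi> r) = mel p q r \<phi>"
      unfolding rt lf_def mel_def by simp
  qed
  have uniq: "line_integral (\<lambda>z. bieval p z / V z) (\<lambda>z. bieval q z / V z) \<phi> 0 T' = I"
    if tv: "traverses_once X0 \<phi> T' (level_orbit n c (r ^ (4 * n)))" for \<phi> T'
  proof -
    have \<phi>: "0 < T'" "solution_on (X 0) \<phi> UNIV" "\<phi> T' = \<phi> 0" "inj_on \<phi> {0..<T'}"
      using tv by (auto simp: traverses_once_def X0)
    have "\<phi> 0 \<in> level_orbit n c (r ^ (4 * n))" using tv by (force simp: traverses_once_def)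
    then obtain t where t: "t \<in> {0..2 * pi}" "\<phi> 0 = E t r" unfolding level_orbit_eq[OF r, of 0] by auto
    obtain T \<eta> where T: "0 < T" "\<eta> 0 = 0" "\<eta> T = 2 * pi" "strict_mono_on {0..T} \<eta>" "\<eta> ` {0..T} = {0..2 * pi}"
      "\<And>\<tau>. \<tau> \<in> {0..T} \<Longrightarrow> (\<eta> has_real_derivative 1 / rate 0 (t + \<eta> \<tau>) r) (at \<tau> within {0..T})"
      and un: "\<And>\<phi> T' \<tau>. solution_on (X 0) \<phi> {0..T'} \<Longrightarrow> \<phi> 0 = E t r \<Longrightarrow> 0 \<le> \<tau> \<Longrightarrow> \<tau> \<le> T \<Longrightarrow> \<tau> \<le> T' \<Longrightarrow>
        \<phi> \<tau> = E (t + \<eta> \<tau>) r"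
      by (rule transit_unique[OF tr[of t]]) (rule that)
    have agree: "\<phi> \<tau> = E (t + \<eta> \<tau>) r" if "0 \<le> \<tau>" "\<tau> \<le> T" for \<tau>
      by (rule un[OF solution_on_subset[OF \<phi>(2)] t(2) that(1,2), of T]) (use that in auto)
    \<comment> \<open>A shorter closed solution would return to its angle before completing the
      turn; a longer one would meet its initial point once more and not be injective.\<close>
    have "T' = T"
    proof (rule linorder_cases[of T' T])
      assume less: "T' < T"
      have "0 < \<eta> T'" "\<eta> T' < 2 * pi"
        using strict_mono_onD[OF T(4), of 0 T'] strict_mono_onD[OF T(4), of T' T] T \<phi>(1) less by auto
      moreover have "E (t + \<eta> T') r = E t r" using agree[of T'] less \<phi>(1,3) t(2) by simp
      then obtain k :: int where "\<eta> T' = 2 * pi * k" using E_eq_iff[OF r r] by force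
      ultimately show ?thesis using no_int_multiple by blast
    next
      assume less: "T < T'"
      have "\<phi> T = \<phi> 0" using agree[of T] T t(2) periodic(7)[of t 1 r] by simp
      then show ?thesis using inj_onD[OF \<phi>(4), of T 0] T(1) less by simp
    qed
    define W where "W u = integral {0..u} (\<lambda>s. mel p q r (t + s))" for u
    have dW: "(W has_real_derivative mel p q r (t + u)) (at u within {0..2 * pi})" if "u \<in> {0..2 * pi}" for u
      unfolding W_def
      by (rule integral_has_real_derivative)
         (use that in \<open>auto intro!: continuous_on_compose2[OF continuous_mel[OF r, of UNIV]] continuous_intros\<close>)
    \<comment> \<open>The change of variables from time to angle is made through the antiderivative
      \<open>W\<close> in the angle.\<close>
    have "((\<lambda>\<tau>. lf (\<phi> \<tau>)) has_integral (W (\<eta> T) - W (\<eta> 0))) {0..T}"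
    proof (rule fundamental_theorem_of_calculus)
      fix \<tau> assume \<tau>: "\<tau> \<in> {0..T}"
      have "\<eta> \<tau> \<in> {0..2 * pi}" using T(5) \<tau> by auto
      from DERIV_image_chain[OF dW[OF this, folded T(5)] T(6)[OF \<tau>]]
      have "((W \<circ> \<eta>) has_real_derivative mel p q r (t + \<eta> \<tau>) * (1 / rate 0 (t + \<eta> \<tau>) r)) (at \<tau> within {0..T})" .
      moreover have "mel p q r (t + \<eta> \<tau>) * (1 / rate 0 (t + \<eta> \<tau>) r) = lf (\<phi> \<tau>)"
        using rate0[of "t + \<eta> \<tau>"] agree[of \<tau>] \<tau> unfolding ratelf[symmetric] by simp
      ultimately show "((\<lambda>\<tau>. W (\<eta> \<tau>)) has_vector_derivative lf (\<phi> \<tau>)) (at \<tau> within {0..T})"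
        by (simp add: has_real_derivative_iff_has_vector_derivative o_def)
    qed (use T(1) in simp)
    then have "integral {0..T} (\<lambda>\<tau>. lf (\<phi> \<tau>)) = W (2 * pi)" using T by (simp add: W_def integral_unique)
    also have "W (2 * pi) = I"
      unfolding W_def I_def by (rule integral_periodic_shift[OF continuous_mel[OF r] mel_periodic]) (use t(1) in auto)
    finally have "integral {0..T} (\<lambda>\<tau>. lf (\<phi> \<tau>)) = I" .
    moreover have "vector_derivative \<phi> (at \<tau>) = X0 (\<phi> \<tau>)" for \<tau>
      using \<phi>(2) by (intro vector_derivative_at) (simp add: solution_on_def X0)
    ultimately show ?thesis by (simp add: line_integral_def lf_def \<open>T' = T\<close>)
  qed
  obtain T \<zeta> where "0 < T" "solution_on (X 0) \<zeta> UNIV" "\<And>t. \<zeta> (t + T) = \<zeta> t" "range \<zeta> = (\<lambda>s. E s r) ` {0..2 * pi}"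
    "inj_on \<zeta> {0..<T}"
    by (rule closed_transit[OF tr[of 0]]) (use r that in auto)
  then have "traverses_once X0 \<zeta> T (level_orbit n c (r ^ (4 * n)))"
    using range_periodic[of T \<zeta>] \<open>\<And>t. \<zeta> (t + T) = \<zeta> t\<close>[of 0] unfolding traverses_once_def level_orbit_eq[OF r, of 0] X0
    by simp
  then have "\<exists>\<phi> T. traverses_once X0 \<phi> T (level_orbit n c (r ^ (4 * n))) \<and>
      I = line_integral (\<lambda>z. bieval p z / V z) (\<lambda>z. bieval q z / V z) \<phi> 0 T"
    using uniq by metis
  then show ?thesis
    unfolding melnikov_def I_def[symmetric] using uniq by (intro the_equality) auto
qed

end

text \<open>The exponents of \<open>melnikov_poly\<close> below that survive the reflection are \<open>1 + 2 (a + n j)\<close>.\<close>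

lemma card_exponents:
  fixes n :: nat assumes n: "1 \<le> n"
  shows "finite {a + n * j |a j. 2 * a + j \<le> 4 * n - 1}" (is "finite ?M")
    and "card {a + n * j |a j. 2 * a + j \<le> 4 * n - 1} \<le> n * (3 * n + 1)"
proof -
  \<comment> \<open>For \<open>j \<le> 2 * n + 1\<close> the values \<open>a + n * j\<close> lie
    below \<open>n * (2 * n + 2)\<close>, and all numbers below are counted. For larger
    \<open>j\<close> the admissible \<open>a\<close> are counted one by one,
    \<open>(4 * n - 1 - j) div 2 + 1\<close> of them for each \<open>j\<close>.\<close>
  define J where "J = {2 * n + 2..<4 * n}"
  define U where "U = {..<n * (2 * n + 2)} \<union> (\<Union>j\<in>J. {n * j..n * j + (4 * n - 1 - j) div 2})"
  have sub: "?M \<subseteq> U"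
  proof
    fix x assume "x \<in> ?M"
    then obtain a j where x: "x = a + n * j" "2 * a + j \<le> 4 * n - 1" by auto
    obtain m where m: "n = Suc m" using n by (cases n) auto
    show "x \<in> U"
    proof (cases "j \<le> 2 * n + 1")
      case True
      \<comment> \<open>The constraint gives \<open>2 * x \<le> 4 * n - 1 + (2 * n - 1) * j\<close>,
        to be estimated at \<open>j = 2 * n + 1\<close>.\<close>
      have "(2 * m + 1) * j \<le> (2 * m + 1) * (2 * n + 1)" using True by (intro mult_le_mono2)
      then have "2 * x < 2 * (n * (2 * n + 2))" using x by (simp add: m algebra_simps)
      then show ?thesis by (simp add: U_def)
    next
      case False
      then have "j \<in> J" "a \<le> (4 * n - 1 - j) div 2" using x(2) n by (auto simp: J_def)
      then show ?thesis unfolding U_def x(1) by (intro UnI2 UN_I[of j]) auto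
    qed
  qed
  have finU: "finite U" by (auto simp: U_def J_def)
  show "finite ?M" using finite_subset[OF sub finU] .
  have ind: "(\<Sum>i<2 * m. i div 2 + 1) = m * (m + 1)" for m :: nat
    by (induction m) (auto simp: algebra_simps)
  have "card ?M \<le> card U" by (rule card_mono[OF finU sub])
  also have "\<dots> \<le> card {..<n * (2 * n + 2)} + card (\<Union>j\<in>J. {n * j..n * j + (4 * n - 1 - j) div 2})"
    unfolding U_def by (rule card_Un_le)
  also have "card (\<Union>j\<in>J. {n * j..n * j + (4 * n - 1 - j) div 2}) \<le> (\<Sum>j\<in>J. card {n * j..n * j + (4 * n - 1 - j) div 2})"
    by (rule card_UN_le) (simp add: J_def)
  also have "\<dots> = (\<Sum>j\<in>J. (4 * n - 1 - j) div 2 + 1)" by simp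
  also have "\<dots> = (\<Sum>i<2 * (n - 1). (2 * (n - 1) - Suc i) div 2 + 1)"
  proof (rule sum.reindex_bij_witness[where i="\<lambda>i. i + (2 * n + 2)" and j="\<lambda>j. j - (2 * n + 2)"])
    fix j assume "j \<in> J"
    then show "(2 * (n - 1) - Suc (j - (2 * n + 2))) div 2 + 1 = (4 * n - 1 - j) div 2 + 1"
      by (auto simp: J_def intro!: arg_cong[of _ _ "\<lambda>x. x div 2"])
  qed (auto simp: J_def)
  also have "\<dots> = (\<Sum>i<2 * (n - 1). i div 2 + 1)"
    by (rule sum.nat_diff_reindex[of "\<lambda>i. i div 2 + 1"])
  also have "\<dots> = (n - 1) * (n - 1 + 1)" by (rule ind)
  finally have "card ?M \<le> n * (2 * n + 2) + (n - 1) * (n - 1 + 1)" by simp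
  also have "\<dots> = n * (3 * n + 1)" using n by (cases n) (auto simp: algebra_simps)
  finally show "card ?M \<le> n * (3 * n + 1)" .
qed

context center
begin

text \<open>Moments of the level curve \<open>H = 1\<close>; on the other level curves they change
  only by a power of the radius.\<close>

definition Ia :: "nat \<Rightarrow> nat \<Rightarrow> real" where
  "Ia i j = integral {0..2 * pi} (\<lambda>\<phi>. A \<phi> ^ i * B \<phi> ^ j * dA \<phi> / VV \<phi>)"

definition Ib :: "nat \<Rightarrow> nat \<Rightarrow> real" where
  "Ib i j = integral {0..2 * pi} (\<lambda>\<phi>. A \<phi> ^ i * B \<phi> ^ j * dB \<phi> / VV \<phi>)"

lemma VV_ne: "VV \<phi> \<noteq> 0"
  using VV_pos[of \<phi>] by simp

lemma has_integral_Ia: "((\<lambda>\<phi>. A \<phi> ^ i * B \<phi> ^ j * dA \<phi> / VV \<phi>) has_integral Ia i j) {0..2 * pi}"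
  and has_integral_Ib: "((\<lambda>\<phi>. A \<phi> ^ i * B \<phi> ^ j * dB \<phi> / VV \<phi>) has_integral Ib i j) {0..2 * pi}"
  unfolding Ia_def Ib_def
  by (intro integrable_integral integrable_continuous_interval continuous_intros; simp add: VV_ne)+

lemma periodic_2pi: "A (\<phi> + 2 * pi) = A \<phi>" "B (\<phi> + 2 * pi) = B \<phi>" "VV (\<phi> + 2 * pi) = VV \<phi>"
    "dA (\<phi> + 2 * pi) = dA \<phi>" "dB (\<phi> + 2 * pi) = dB \<phi>"
  using periodic[of \<phi> 1] by simp_all

lemma Ia_odd: "odd i \<Longrightarrow> Ia i j = 0"
  unfolding Ia_def
  by (rule integral_reflection_zero) (auto intro!: continuous_intros simp: VV_ne periodic_2pi reflection)

lemma Ib_even: "even i \<Longrightarrow> Ib i j = 0"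
  unfolding Ib_def
  by (rule integral_reflection_zero) (auto intro!: continuous_intros simp: VV_ne periodic_2pi reflection)

text \<open>Here \<open>y\<^sup>j dy\<close> has a definite sign along the orbit, because \<open>dy = 2 n c x\<^sup>4\<^sup>n\<^sup>-\<^sup>1 dt\<close>
  and \<open>c < 0\<close>.\<close>

lemma Ib_neq_0:
  assumes "odd i" "even j" shows "Ib i j \<noteq> 0"
proof
  assume 0: "Ib i j = 0"
  define f where "f \<phi> = - (A \<phi> ^ i * B \<phi> ^ j * dB \<phi> / VV \<phi>)" for \<phi>
  have f_eq: "f \<phi> = \<kappa> \<phi> * (2 * n) * (- c) * A \<phi> ^ (i + (4 * n - 1)) * B \<phi> ^ j / VV \<phi>" for \<phi>
    unfolding f_def dB_def power_add by simp
  have ev: "even (i + (4 * n - 1))" using assms(1) n1 by simp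
  have nn: "0 \<le> f \<phi>" for \<phi>
    unfolding f_eq using c \<kappa>_pos[of \<phi>] VV_pos[of \<phi>] assms(2) ev
    by (intro divide_nonneg_nonneg mult_nonneg_nonneg zero_le_even_power) auto
  have "(f has_integral - Ib i j) {0..2 * pi}"
    unfolding f_def by (rule has_integral_neg[OF has_integral_Ib])
  then have int: "(f has_integral 0) (cbox 0 (2 * pi))" by (simp add: 0)
  have "continuous_on (cbox 0 (2 * pi)) f"
    unfolding f_def by (intro continuous_intros) (simp add: VV_ne)
  \<comment> \<open>At \<open>pi / 4\<close> neither coordinate vanishes, so the nonnegative
    integrand is positive there.\<close>
  from has_integral_0_cbox_imp_0[OF this _ int, of "pi / 4"] nn pi_gt_zero have "f (pi / 4) = 0" by (simp del: pi_gt_zero)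
  moreover have "A (pi / 4) \<noteq> 0" "B (pi / 4) \<noteq> 0" by (auto simp: A_def B_def cos_45 sin_45)
  ultimately show False using c n1 \<kappa>_pos[of "pi / 4"] VV_pos[of "pi / 4"] unfolding f_eq by auto
qed

end

context perturbation
begin

lemma degree0: "total_degree_le d (P 0)" "total_degree_le d (Q 0)"
  using eventually_nhds_x_imp_x[OF degP] eventually_nhds_x_imp_x[OF degQ] by auto

text \<open>At radius \<open>r\<close> the monomials scale by \<open>r ^ (i + 2 * n * j)\<close>,
  \<open>dx\<close> by \<open>r\<close>, \<open>dy\<close> by \<open>r ^ (2 * n)\<close> and
  \<open>V\<close> by \<open>r ^ (4 * n)\<close>. Hence this is the Melnikov function at
  \<open>h = r ^ (4 * n)\<close>, multiplied by \<open>r ^ (4 * n)\<close> to clear the power in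
  \<open>V\<close>. In the variable \<open>h\<close> the exponents would be fractional.\<close>

definition melnikov_poly :: "complex \<Rightarrow> complex" where
  "melnikov_poly z = (\<Sum>j\<le>d. \<Sum>i\<le>d. of_real (coeff (coeff (P 0) j) i * Ia i j) * z ^ (1 + i + 2 * n * j)
      + of_real (coeff (coeff (Q 0) j) i * Ib i j) * z ^ (2 * n + i + 2 * n * j))"

text \<open>At \<open>e = 0\<close> the denominator of \<open>F\<close> is \<open>2 n VV\<close>
  times a power of \<open>z\<close>; clearing this power leaves the moments. Complex
  \<open>z\<close> are included because convergence is required on a complex neighbourhood.\<close>

lemma integral_F0:
  assumes z: "z \<noteq> 0"
  shows "- of_real (2 * n) * z ^ (4 * n - 1) * integral {0..2 * pi} (\<lambda>s. F 0 s z) = melnikov_poly z"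
proof -
  have r: "((\<lambda>s. k * of_real (f s)) has_integral (k * of_real J)) {0..2 * pi}"
    if "(f has_integral J) {0..2 * pi}" for f J and k :: complex
    using has_integral_mult_right[OF has_integral_linear[OF that bounded_linear_of_real]] by (simp add: o_def)
  have "((\<lambda>s. \<Sum>j\<le>d. \<Sum>i\<le>d. of_real (coeff (coeff (P 0) j) i) * z ^ (1 + i + 2 * n * j) * of_real (A s ^ i * B s ^ j * dA s / VV s)
      + of_real (coeff (coeff (Q 0) j) i) * z ^ (2 * n + i + 2 * n * j) * of_real (A s ^ i * B s ^ j * dB s / VV s))
    has_integral (\<Sum>j\<le>d. \<Sum>i\<le>d. of_real (coeff (coeff (P 0) j) i) * z ^ (1 + i + 2 * n * j) * of_real (Ia i j)
      + of_real (coeff (coeff (Q 0) j) i) * z ^ (2 * n + i + 2 * n * j) * of_real (Ib i j))) {0..2 * pi}"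
    by (intro has_integral_sum has_integral_add r has_integral_Ia has_integral_Ib) auto
  also have "(\<lambda>s. \<Sum>j\<le>d. \<Sum>i\<le>d. of_real (coeff (coeff (P 0) j) i) * z ^ (1 + i + 2 * n * j) * of_real (A s ^ i * B s ^ j * dA s / VV s)
      + of_real (coeff (coeff (Q 0) j) i) * z ^ (2 * n + i + 2 * n * j) * of_real (A s ^ i * B s ^ j * dB s / VV s))
    = (\<lambda>s. - of_real (2 * n) * z ^ (4 * n - 1) * F 0 s z)"
  proof
    fix s
    have "- of_real (2 * n) * z ^ (4 * n - 1) * F 0 s z = num 0 s z / of_real (VV s)"
      using z n1 VV_ne[of s] by (simp add: F_def den_def field_simps)
    also have "\<dots> = (\<Sum>j\<le>d. \<Sum>i\<le>d. of_real (coeff (coeff (P 0) j) i) * z ^ (1 + i + 2 * n * j) * of_real (A s ^ i * B s ^ j * dA s / VV s)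
      + of_real (coeff (coeff (Q 0) j) i) * z ^ (2 * n + i + 2 * n * j) * of_real (A s ^ i * B s ^ j * dB s / VV s))"
      unfolding num_def cev_def sum_distrib_left sum_divide_distrib add_divide_distrib sum.distrib
      by (intro arg_cong2[of _ _ _ _ "(+)"] sum.cong refl)
         (simp_all add: power_mult_distrib power_add mult_ac flip: power_mult)
    finally show "(\<Sum>j\<le>d. \<Sum>i\<le>d. of_real (coeff (coeff (P 0) j) i) * z ^ (1 + i + 2 * n * j) * of_real (A s ^ i * B s ^ j * dA s / VV s)
      + of_real (coeff (coeff (Q 0) j) i) * z ^ (2 * n + i + 2 * n * j) * of_real (A s ^ i * B s ^ j * dB s / VV s))
      = - of_real (2 * n) * z ^ (4 * n - 1) * F 0 s z" by simp
  qed
  finally have "((\<lambda>s. - of_real (2 * n) * z ^ (4 * n - 1) * F 0 s z) has_integral melnikov_poly z) {0..2 * pi}"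
    by (simp add: melnikov_poly_def mult_ac)
  then have "integral {0..2 * pi} (\<lambda>s. - of_real (2 * n) * z ^ (4 * n - 1) * F 0 s z) = melnikov_poly z"
    by (rule integral_unique)
  then show ?thesis by simp
qed

text \<open>Through this identity the hypothesis that the Melnikov function is not identically zero
  becomes one about the coefficients of a polynomial.\<close>

lemma melnikov_eq_melnikov_poly:
  assumes r: "0 < r"
  shows "of_real (r ^ (4 * n) * melnikov n c (P 0) (Q 0) (r ^ (4 * n))) = melnikov_poly (of_real r)"
proof -
  have "melnikov_poly (of_real r) = - of_real (2 * n) * of_real r ^ (4 * n - 1) * integral {0..2 * pi} (\<lambda>s. F 0 s (of_real r))"
    by (rule integral_F0[symmetric]) (use r in simp)
  also have "\<dots> = integral {0..2 * pi} (\<lambda>s. - of_real (2 * n) * of_real r ^ (4 * n - 1) * F 0 s (of_real r))"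
    by simp
  also have "\<dots> = integral {0..2 * pi} (\<lambda>s. of_real (r ^ (4 * n) * mel (P 0) (Q 0) r s))"
  proof (rule integral_cong)
    fix s
    have "rnum 0 s r = r ^ (4 * n) * VV s * mel (P 0) (Q 0) r s"
      using V_E[of s r] V_pos[OF E_ne[OF r, of s]] r VV_ne[of s] by (simp add: rnum_def mel_def)
    moreover have "rden 0 s r = real (2 * n) * VV s * r ^ (4 * n - 1)" by (simp add: rden_def)
    ultimately have eq: "- real (2 * n) * r ^ (4 * n - 1) * (- rnum 0 s r / rden 0 s r) = r ^ (4 * n) * mel (P 0) (Q 0) r s"
      using VV_ne[of s] r n1 by simp
    show "- of_real (2 * n) * of_real r ^ (4 * n - 1) * F 0 s (of_real r) = complex_of_real (r ^ (4 * n) * mel (P 0) (Q 0) r s)"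
      unfolding F_of_real[OF degree0] eq[symmetric] by simp
  qed
  also have "\<dots> = of_real (integral {0..2 * pi} (\<lambda>s. r ^ (4 * n) * mel (P 0) (Q 0) r s))"
  proof -
    have "integral {0..2 * pi} (complex_of_real \<circ> (\<lambda>s. r ^ (4 * n) * mel (P 0) (Q 0) r s))
        = complex_of_real (integral {0..2 * pi} (\<lambda>s. r ^ (4 * n) * mel (P 0) (Q 0) r s))"
      by (rule integral_linear[OF _ bounded_linear_of_real])
         (intro integrable_continuous_interval continuous_on_mult continuous_on_const continuous_mel r)
    then show ?thesis by (simp only: o_def)
  qed
  also have "integral {0..2 * pi} (\<lambda>s. r ^ (4 * n) * mel (P 0) (Q 0) r s) = r ^ (4 * n) * melnikov n c (P 0) (Q 0) (r ^ (4 * n))"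
    by (simp add: melnikov_eq[OF r])
  finally show ?thesis by simp
qed

text \<open>The factor has no zeros on positive radii, so the zeros are kept, while the limit
  becomes the polynomial itself.\<close>

definition rescaled :: "(real \<Rightarrow> complex \<Rightarrow> complex) \<Rightarrow> real \<Rightarrow> complex \<Rightarrow> complex" where
  "rescaled g e z = - of_real (2 * n) * z ^ (4 * n - 1) * g e z"

lemma uniform_limit_rescaled:
  assumes a: "0 < a"
    and lim: "uniform_limit (complex_box a b (a / 4)) g (\<lambda>z. integral {0..2 * pi} (\<lambda>s. F 0 s z)) (at 0)"
    and K: "compact K" "K \<subseteq> complex_box a b (a / 4)"
  shows "uniform_limit K (rescaled g) melnikov_poly (at 0)"
proof -
  have z: "z \<noteq> 0" if "z \<in> K" for z using that K(2) a by (auto simp: complex_box_def in_box_complex_iff)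
  \<comment> \<open>A product converges uniformly if the limits of its factors are bounded; the
    integral is continuous on the compact \<open>K\<close>, being a polynomial divided by a power of
    \<open>z\<close>.\<close>
  have cont: "continuous_on K (\<lambda>z. integral {0..2 * pi} (\<lambda>s. F 0 s z))"
  proof -
    have "continuous_on K (\<lambda>z. melnikov_poly z / (- of_real (2 * n) * z ^ (4 * n - 1)))"
      unfolding melnikov_poly_def using z n1 by (intro continuous_intros) auto
    moreover have "melnikov_poly z / (- of_real (2 * n) * z ^ (4 * n - 1)) = integral {0..2 * pi} (\<lambda>s. F 0 s z)" if "z \<in> K" for z
      unfolding integral_F0[OF z[OF that], symmetric] using z[OF that] n1 by simp
    ultimately show ?thesis by (simp cong: continuous_on_cong)
  qed
  have "uniform_limit K (rescaled g) (\<lambda>z. - of_real (2 * n) * z ^ (4 * n - 1) * integral {0..2 * pi} (\<lambda>s. F 0 s z)) (at 0)"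
    unfolding rescaled_def[abs_def]
    by (intro uniform_lim_mult uniform_limit_const uniform_limit_on_subset[OF lim K(2)]
        bounded_image K(1) cont continuous_intros)
  then show ?thesis
    by (rule uniform_limit_cong'[THEN iffD1, rotated 2]) (use integral_F0 z in auto)
qed

end

section \<open>The upper bound\<close>

lemma sum_group_powers:
  fixes f :: "'i \<Rightarrow> real" and z :: complex
  assumes "finite S" "finite T" "h ` S \<subseteq> T"
  shows "(\<Sum>i\<in>S. of_real (f i) * z ^ h i) = (\<Sum>k\<in>T. of_real (\<Sum>i\<in>{i \<in> S. h i = k}. f i) * z ^ k)"
proof -
  have "(\<Sum>k\<in>T. of_real (\<Sum>i\<in>{i \<in> S. h i = k}. f i) * z ^ k) = (\<Sum>k\<in>T. \<Sum>i\<in>{i \<in> S. h i = k}. of_real (f i) * z ^ h i)"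
    by (intro sum.cong refl) (simp add: sum_distrib_right)
  also have "\<dots> = (\<Sum>i\<in>S. of_real (f i) * z ^ h i)" by (rule sum.group[OF assms])
  finally show ?thesis by simp
qed

context perturbation
begin

lemma card_zeros_rescaled:
  fixes g :: "real \<Rightarrow> complex \<Rightarrow> complex" and \<gamma> :: "nat \<Rightarrow> real"
  assumes ab: "0 < a" "a \<le> b" and T: "finite T" "T \<noteq> {}" "\<And>k. k \<in> T \<Longrightarrow> \<gamma> k \<noteq> 0"
    and mp: "\<And>z. melnikov_poly z = (\<Sum>k\<in>T. of_real (\<gamma> k) * z ^ k)"
    and lim: "uniform_limit (complex_box a b (a / 4)) g (\<lambda>z. integral {0..2 * pi} (\<lambda>s. F 0 s z)) (at 0)"
    and hol: "\<forall>\<^sub>F e in nhds 0. g e holomorphic_on complex_box a b (a / 4) \<and>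
       (\<forall>x. of_real x \<in> complex_box a b (a / 4) \<longrightarrow> g e (of_real x) \<in> \<real>)"
  shows "\<forall>\<^sub>F e in at 0. finite {r \<in> {a..b}. g e (of_real r) = 0} \<and> card {r \<in> {a..b}. g e (of_real r) = 0} < card T"
proof -
  have "\<forall>\<^sub>F e in at 0. finite {r \<in> {a..b}. rescaled g e (of_real r) = 0} \<and> card {r \<in> {a..b}. rescaled g e (of_real r) = 0} < card T"
  proof (rule card_zeros_near_sparse_polynomial[where \<Omega>="complex_box a b (a / 4)" and c=\<gamma>])
    show "open (complex_box a b (a / 4))" unfolding complex_box_def by (rule open_box)
    show "complex_of_real ` {a..b} \<subseteq> complex_box a b (a / 4)"
      using ab by (auto simp: complex_box_def in_box_complex_iff)
    show "uniform_limit K (rescaled g) (\<lambda>z. \<Sum>k\<in>T. of_real (\<gamma> k) * z ^ k) (at 0)"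
      if "compact K" "K \<subseteq> complex_box a b (a / 4)" for K
    proof -
      have "melnikov_poly = (\<lambda>z. \<Sum>k\<in>T. of_real (\<gamma> k) * z ^ k)" by (rule ext) (rule mp)
      then show ?thesis using uniform_limit_rescaled[OF ab(1) lim that] by metis
    qed
    have "\<forall>\<^sub>F e in nhds 0. rescaled g e holomorphic_on complex_box a b (a / 4) \<and>
        (\<forall>x. complex_of_real x \<in> complex_box a b (a / 4) \<longrightarrow> rescaled g e (of_real x) \<in> \<real>)"
      using hol
    proof eventually_elim
      case (elim e)
      show ?case
      proof (intro conjI allI impI)
        show "rescaled g e holomorphic_on complex_box a b (a / 4)"
          unfolding rescaled_def[abs_def] using elim by (intro holomorphic_intros) auto
        show "rescaled g e (of_real x) \<in> \<real>" if "complex_of_real x \<in> complex_box a b (a / 4)" for x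
          unfolding rescaled_def using elim that by (intro Reals_mult Reals_minus Reals_power Reals_of_real) auto
      qed
    qed
    then show "\<forall>\<^sub>F e in at 0. rescaled g e holomorphic_on complex_box a b (a / 4) \<and>
        (\<forall>x. complex_of_real x \<in> complex_box a b (a / 4) \<longrightarrow> rescaled g e (of_real x) \<in> \<real>)"
      by (simp add: eventually_nhds_conv_at)
  qed (use ab T in auto)
  moreover have "{r \<in> {a..b}. rescaled g e (of_real r) = 0} = {r \<in> {a..b}. g e (of_real r) = 0}" for e
    using ab(1) n1 by (auto simp: rescaled_def)
  ultimately show ?thesis by simp
qed

text \<open>The forms \<open>x ^ (2 * a + 1) * y ^ j dy\<close> and
  \<open>x ^ (2 * a) * y ^ (j + 1) dx\<close> have the same total degree and scale alike, so the
  \<open>dy\<close> part contributes no exponents beyond those of the \<open>dx\<close>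
  part.\<close>

lemma melnikov_poly_sparse:
  assumes deg: "total_degree_le (4 * n - 1) (P 0)" "total_degree_le (4 * n - 1) (Q 0)"
    and nz: "\<exists>h>0. melnikov n c (P 0) (Q 0) h \<noteq> 0"
  obtains T \<gamma> where "finite T" "T \<noteq> {}" "\<And>k. k \<in> T \<Longrightarrow> \<gamma> k \<noteq> (0::real)"
    "\<And>z. melnikov_poly z = (\<Sum>k\<in>T. of_real (\<gamma> k) * z ^ k)" "card T \<le> n * (3 * n + 1)"
proof -
  define IJ where "IJ = {..d} \<times> {..d}"
  define fp where "fp = (\<lambda>(j, i). coeff (coeff (P 0) j) i * Ia i j)"
  define fq where "fq = (\<lambda>(j, i). coeff (coeff (Q 0) j) i * Ib i j)"
  define hp where "hp = (\<lambda>(j, i). 1 + i + 2 * n * j)"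
  define hq where "hq = (\<lambda>(j, i). 2 * n + i + 2 * n * j)"
  define K where "K = hp ` IJ \<union> hq ` IJ"
  have fin: "finite IJ" "finite K" by (auto simp: IJ_def K_def)
  define \<gamma> where "\<gamma> k = (\<Sum>x\<in>{x \<in> IJ. hp x = k}. fp x) + (\<Sum>x\<in>{x \<in> IJ. hq x = k}. fq x)" for k
  have mp: "melnikov_poly z = (\<Sum>k\<in>K. of_real (\<gamma> k) * z ^ k)" for z
  proof -
    have "melnikov_poly z = (\<Sum>x\<in>IJ. of_real (fp x) * z ^ hp x + of_real (fq x) * z ^ hq x)"
      unfolding melnikov_poly_def IJ_def sum.cartesian_product
      by (intro sum.cong refl) (auto simp: fp_def fq_def hp_def hq_def)
    also have "\<dots> = (\<Sum>k\<in>K. of_real (\<Sum>i\<in>{i \<in> IJ. hp i = k}. fp i) * z ^ k) + (\<Sum>k\<in>K. of_real (\<Sum>i\<in>{i \<in> IJ. hq i = k}. fq i) * z ^ k)"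
      unfolding sum.distrib using fin by (simp add: sum_group_powers[where T=K] K_def)
    finally show ?thesis by (simp add: \<gamma>_def distrib_right sum.distrib)
  qed
  \<comment> \<open>Exponents whose coefficients cancel are dropped, since the zero count is stated
    for nonzero coefficients.\<close>
  define T where "T = {k \<in> K. \<gamma> k \<noteq> 0}"
  have mpT: "melnikov_poly z = (\<Sum>k\<in>T. of_real (\<gamma> k) * z ^ k)" for z
    unfolding mp by (rule sum.mono_neutral_right) (use fin in \<open>auto simp: T_def\<close>)
  have "T \<subseteq> (\<lambda>m. 2 * m + 1) ` {a + n * j |a j. 2 * a + j \<le> 4 * n - 1}"
  proof
    fix k assume "k \<in> T"
    then have "(\<Sum>x\<in>{x \<in> IJ. hp x = k}. fp x) \<noteq> 0 \<or> (\<Sum>x\<in>{x \<in> IJ. hq x = k}. fq x) \<noteq> 0"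
      by (auto simp: T_def \<gamma>_def)
    then show "k \<in> (\<lambda>m. 2 * m + 1) ` {a + n * j |a j. 2 * a + j \<le> 4 * n - 1}"
    proof
      assume "(\<Sum>x\<in>{x \<in> IJ. hp x = k}. fp x) \<noteq> 0"
      then obtain x where "x \<in> IJ" "hp x = k" "fp x \<noteq> 0" by (auto elim: sum.not_neutral_contains_not_neutral)
      then obtain i j where ij: "k = 1 + i + 2 * n * j" "coeff (coeff (P 0) j) i \<noteq> 0" "Ia i j \<noteq> 0"
        by (cases x) (auto simp: hp_def fp_def)
      then have i: "even i" "i + j \<le> 4 * n - 1" using Ia_odd deg(1) by (auto simp: total_degree_le_def)
      then obtain a where a: "i = 2 * a" by (auto elim: evenE)
      have "2 * a + j \<le> 4 * n - 1" "k = 2 * (a + n * j) + 1" using i(2) ij(1) a by (simp_all add: algebra_simps)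
      then show ?thesis by blast
    next
      assume "(\<Sum>x\<in>{x \<in> IJ. hq x = k}. fq x) \<noteq> 0"
      then obtain x where "x \<in> IJ" "hq x = k" "fq x \<noteq> 0" by (auto elim: sum.not_neutral_contains_not_neutral)
      then obtain i j where ij: "k = 2 * n + i + 2 * n * j" "coeff (coeff (Q 0) j) i \<noteq> 0" "Ib i j \<noteq> 0"
        by (cases x) (auto simp: hq_def fq_def)
      then have i: "odd i" "i + j \<le> 4 * n - 1" using Ib_even deg(2) by (auto simp: total_degree_le_def)
      then obtain a where a: "i = 2 * a + 1" by (auto elim: oddE)
      have "2 * a + Suc j \<le> 4 * n - 1" using i(2) a by simp
      moreover have "k = 2 * (a + n * Suc j) + 1" using ij(1) a by (simp add: algebra_simps)
      ultimately show ?thesis by blast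
    qed
  qed
  then have "card T \<le> card ((\<lambda>m. 2 * m + 1) ` {a + n * j |a j. 2 * a + j \<le> 4 * n - 1})"
    by (intro card_mono finite_imageI card_exponents(1)[OF n1])
  also have "\<dots> \<le> card {a + n * j |a j. 2 * a + j \<le> 4 * n - 1}"
    by (rule card_image_le[OF card_exponents(1)[OF n1]])
  also have "\<dots> \<le> n * (3 * n + 1)" by (rule card_exponents(2)[OF n1])
  finally have cardT: "card T \<le> n * (3 * n + 1)" .
  have "T \<noteq> {}"
  proof
    assume "T = {}"
    then have m0: "melnikov_poly z = 0" for z by (simp add: mpT)
    obtain h where h: "0 < h" "melnikov n c (P 0) (Q 0) h \<noteq> 0" using nz by blast
    define r where "r = root (4 * n) h"
    have r: "0 < r" "r ^ (4 * n) = h" using h(1) n1 by (simp_all add: r_def)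
    have "complex_of_real (h * melnikov n c (P 0) (Q 0) h) = 0" using melnikov_eq_melnikov_poly[OF r(1)] m0 r(2) by simp
    then show False using h by (simp del: of_real_mult)
  qed
  moreover have "finite T" using fin(2) by (simp add: T_def)
  moreover have "\<gamma> k \<noteq> 0" if "k \<in> T" for k using that by (simp add: T_def)
  ultimately show ?thesis using that[of T \<gamma>] mpT cardT by blast
qed

lemma E_axis: "E 0 r = (r * A 0, 0)" "0 < A 0"
  by (simp_all add: E_def A_def B_def)

text \<open>A point of the section that returns to itself has a radius fixed by one turn, hence a
  zero of the divided displacement; these zeros number fewer than the monomials of the
  limit.\<close>

lemma upper_bound:
  assumes deg: "total_degree_le (4 * n - 1) (P 0)" "total_degree_le (4 * n - 1) (Q 0)"
    and nz: "\<exists>h>0. melnikov n c (P 0) (Q 0) h \<noteq> 0"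
  shows "at_most_limit_cycles X (n * (3 * n + 1) - 1)"
  unfolding at_most_limit_cycles_def
proof (intro allI impI)
  fix K assume K: "compact K \<and> K \<subseteq> cross_section"
  show "\<exists>e0>0. \<forall>e. 0 < \<bar>e\<bar> \<and> \<bar>e\<bar> < e0 \<longrightarrow>
     (let Z = {p \<in> K. first_return (X e) cross_section p p \<and> (\<exists>\<gamma>. limit_cycle (X e) \<gamma> \<and> p \<in> \<gamma>)}
      in finite Z \<and> card Z \<le> n * (3 * n + 1) - 1)"
  proof (cases "K = {}")
    case False
    obtain T \<gamma> where T: "finite T" "T \<noteq> {}" "\<And>k. k \<in> T \<Longrightarrow> \<gamma> k \<noteq> (0::real)"
        "\<And>z. melnikov_poly z = (\<Sum>k\<in>T. of_real (\<gamma> k) * z ^ k)" "card T \<le> n * (3 * n + 1)"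
      using melnikov_poly_sparse[OF deg nz] by blast
    have cptf: "compact (fst ` K)" using K by (intro compact_continuous_image continuous_intros) auto
    obtain p0 where p0: "p0 \<in> K" "\<And>p. p \<in> K \<Longrightarrow> fst p0 \<le> fst p"
      using compact_attains_inf[OF cptf] False by blast
    obtain p1 where p1: "p1 \<in> K" "\<And>p. p \<in> K \<Longrightarrow> fst p \<le> fst p1"
      using compact_attains_sup[OF cptf] False by blast
    \<comment> \<open>The orbit of radius \<open>r\<close> meets the section at
      \<open>x = r * A 0\<close>, so dividing the extreme abscissas of \<open>K\<close> by
      \<open>A 0\<close> gives the interval of radii.\<close>
    define a where "a = fst p0 / A 0"
    define b where "b = fst p1 / A 0"
    have "0 < fst p0" using K p0(1) by (auto simp: cross_section_def)
    then have a: "0 < a" using E_axis(2) by (simp add: a_def)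
    have ab: "a \<le> b" using p1(2)[OF p0(1)] E_axis(2) by (simp add: a_def b_def divide_right_mono)
    have KE: "\<exists>r\<in>{a..b}. p = E 0 r" if "p \<in> K" for p
    proof -
      obtain x where x: "p = (x, 0)" using K \<open>p \<in> K\<close> by (auto simp: cross_section_def)
      have "x / A 0 \<in> {a..b}" using p0(2)[OF that] p1(2)[OF that] E_axis(2) x by (simp add: a_def b_def divide_right_mono)
      moreover have "p = E 0 (x / A 0)" using E_axis(2) by (simp add: x E_axis(1))
      ultimately show ?thesis by blast
    qed
    obtain v g C where "0 \<le> C" and
      ev: "\<forall>\<^sub>F e in nhds 0.
      (\<forall>t\<in>{0..2 * pi}. \<forall>r\<in>{a..b}. v e t 0 r = r \<and>
         (\<forall>s\<in>{0..2 * pi}. \<bar>v e t s r - r\<bar> \<le> \<bar>e\<bar> * C \<and> 0 < v e t s r) \<and>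
         continuous_on {0..2 * pi} (\<lambda>s. v e t s r) \<and> transit e t (\<lambda>s. v e t s r)) \<and>
      (\<forall>r\<in>{a..b}. \<forall>r'\<in>{a..b}. r < r' \<longrightarrow> v e 0 (2 * pi) r < v e 0 (2 * pi) r') \<and>
      g e holomorphic_on complex_box a b (a / 4) \<and>
      (\<forall>x. of_real x \<in> complex_box a b (a / 4) \<longrightarrow> g e (of_real x) \<in> \<real>) \<and>
      (\<forall>r\<in>{a..b}. g e (of_real r) = of_real ((v e 0 (2 * pi) r - r) / e))"
      and lim: "uniform_limit (complex_box a b (a / 4)) g (\<lambda>z. integral {0..2 * pi} (\<lambda>s. F 0 s z)) (at 0)"
      by (rule radial_flow[OF a ab])
    have hol: "\<forall>\<^sub>F e in nhds 0. g e holomorphic_on complex_box a b (a / 4) \<and>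
       (\<forall>x. of_real x \<in> complex_box a b (a / 4) \<longrightarrow> g e (of_real x) \<in> \<real>)"
      using ev by eventually_elim blast
    have zeros: "\<forall>\<^sub>F e in at 0. finite {r \<in> {a..b}. g e (of_real r) = 0} \<and> card {r \<in> {a..b}. g e (of_real r) = 0} < card T"
      by (rule card_zeros_rescaled[OF a ab _ _ _ _ lim hol]) (use T in auto)
    have "\<forall>\<^sub>F e in at 0. finite {p \<in> K. first_return (X e) cross_section p p \<and> (\<exists>\<gamma>. limit_cycle (X e) \<gamma> \<and> p \<in> \<gamma>)} \<and>
        card {p \<in> K. first_return (X e) cross_section p p \<and> (\<exists>\<gamma>. limit_cycle (X e) \<gamma> \<and> p \<in> \<gamma>)} \<le> n * (3 * n + 1) - 1"
      using ev[unfolded eventually_nhds_conv_at, THEN conjunct1] zeros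
    proof eventually_elim
      case (elim e)
      define N where "N = {r \<in> {a..b}. g e (of_real r) = 0}"
      have "{p \<in> K. first_return (X e) cross_section p p \<and> (\<exists>\<gamma>. limit_cycle (X e) \<gamma> \<and> p \<in> \<gamma>)} \<subseteq> E 0 ` N" (is "?Z \<subseteq> _")
      proof
        fix p assume "p \<in> ?Z"
        then have p: "p \<in> K" "first_return (X e) cross_section p p" by auto
        obtain r where r: "r \<in> {a..b}" "p = E 0 r" using KE[OF p(1)] by blast
        have z0: "(0::real) \<in> {0..2 * pi}" "2 * pi \<in> {0..2 * pi}" by auto
        have v: "v e 0 0 r = r" "\<And>s. s \<in> {0..2 * pi} \<Longrightarrow> 0 < v e 0 s r" "transit e 0 (\<lambda>s. v e 0 s r)"
          using elim(1) z0 r(1) by blast+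
        have "p = E 0 (v e 0 (2 * pi) r)"
          by (rule first_return_transit[OF v(3,2)]) (use p(2) r v(1) in auto)
        then have "v e 0 (2 * pi) r = r"
          using r E_eq_iff[of r "v e 0 (2 * pi) r" 0 0] a v(2)[OF z0(2)] by auto
        then have "g e (of_real r) = 0" using elim(1) r(1) by simp
        then show "p \<in> E 0 ` N" using r by (auto simp: N_def)
      qed
      moreover have "finite N" "card N < card T" using elim(2) by (auto simp: N_def)
      ultimately have "finite ?Z" "card ?Z \<le> card N"
        using finite_surj card_mono[of "E 0 ` N" ?Z] card_image_le[of N "E 0"] by (auto intro: finite_subset order_trans)
      then show ?case using \<open>card N < card T\<close> T(5) by linarith
    qed
    then show ?thesis
      unfolding eventually_at Let_def by (auto simp: dist_real_def)
  qed (auto intro: exI[of _ 1])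
qed

end

section \<open>The lower bound\<close>

text \<open>Induction on the largest exponent \<open>k\<close>. The new monomial gets a coefficient
  so small that the old signs persist, with the sign that is required at a new point so far to the
  right that this monomial dominates there.\<close>

lemma alternating_sparse_polynomial:
  assumes "finite S" "S \<noteq> {}"
  shows "\<exists>(\<gamma> :: nat \<Rightarrow> real) t. (\<forall>k\<in>S. \<gamma> k \<noteq> 0) \<and> (\<forall>i<card S. 0 < t i) \<and>
    (\<forall>i j. i < j \<longrightarrow> j < card S \<longrightarrow> t i < t j) \<and> (\<forall>i<card S. 0 < (-1) ^ i * (\<Sum>k\<in>S. \<gamma> k * t i ^ k))"
  using assms
proof (induction S rule: finite_linorder_max_induct)
  case (insert k S)
  show ?case
  proof (cases "S = {}")
    case True
    then show ?thesis by (intro exI[of _ "\<lambda>_. 1"] exI[of _ "\<lambda>_. 1"]) auto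
  next
    case False
    then obtain \<gamma> t :: "nat \<Rightarrow> real" where IH: "\<forall>k\<in>S. \<gamma> k \<noteq> 0" "\<forall>i<card S. 0 < t i"
      "\<forall>i j. i < j \<longrightarrow> j < card S \<longrightarrow> t i < t j" "\<forall>i<card S. 0 < (-1) ^ i * (\<Sum>k\<in>S. \<gamma> k * t i ^ k)"
      using insert.IH[OF False] by (elim exE conjE) (rule that; assumption)
    define f where "f x = (\<Sum>k\<in>S. \<gamma> k * x ^ k)" for x :: real
    define N where "N = card S"
    have N: "0 < N" using insert(1) False by (simp add: N_def card_gt_0_iff)
    have kS: "k \<notin> S" using insert(2) by auto
    have "\<forall>\<^sub>F d in at_right 0. \<forall>i\<in>{..<N}. 0 < (-1) ^ i * (f (t i) + (-1) ^ N * d * t i ^ k)"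
    proof (rule eventually_ball_finite)
      show "\<forall>i\<in>{..<N}. \<forall>\<^sub>F d in at_right 0. 0 < (-1) ^ i * (f (t i) + (-1) ^ N * d * t i ^ k)"
      proof
        fix i assume "i \<in> {..<N}"
        then have "0 < (-1) ^ i * (f (t i) + (-1) ^ N * 0 * t i ^ k)" using IH(4) by (simp add: f_def N_def)
        moreover have "((\<lambda>d. (-1) ^ i * (f (t i) + (-1) ^ N * d * t i ^ k)) \<longlongrightarrow> (-1) ^ i * (f (t i) + (-1) ^ N * 0 * t i ^ k)) (at_right 0)"
          by (intro tendsto_intros)
        ultimately show "\<forall>\<^sub>F d in at_right 0. 0 < (-1) ^ i * (f (t i) + (-1) ^ N * d * t i ^ k)"
          by (intro order_tendstoD(1))
      qed
    qed simp
    moreover have "\<forall>\<^sub>F d in at_right (0::real). 0 < d" by (simp add: eventually_at_filter)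
    ultimately have "\<forall>\<^sub>F d in at_right 0. 0 < d \<and> (\<forall>i\<in>{..<N}. 0 < (-1) ^ i * (f (t i) + (-1) ^ N * d * t i ^ k))"
      by eventually_elim simp
    from eventually_happens'[OF trivial_limit_at_right_real this]
    obtain d where d: "0 < d" "\<And>i. i < N \<Longrightarrow> 0 < (-1) ^ i * (f (t i) + (-1) ^ N * d * t i ^ k)"
      by (elim exE conjE) (rule that, assumption, simp)
    define C where "C = (\<Sum>j\<in>S. \<bar>\<gamma> j\<bar>)"
    \<comment> \<open>\<open>x > 1\<close> bounds the old part by \<open>C * x ^ (k - 1)\<close>,
      and \<open>d * x > C\<close> makes the new term larger; the last summand puts \<open>x\<close>
      to the right of the old points.\<close>
    define x where "x = 1 + C / d + t (N - 1)"
    have C0: "0 \<le> C" unfolding C_def by (intro sum_nonneg) auto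
    have tN: "0 < t (N - 1)" using IH(2) N by (simp add: N_def)
    have x: "1 < x" "C < d * x" "t (N - 1) < x"
    proof -
      show "1 < x" "t (N - 1) < x" using C0 d(1) tN by (auto simp: x_def intro: add_pos_nonneg add_nonneg_pos)
      have "d * x = d + C + d * t (N - 1)" using d(1) by (simp add: x_def distrib_left)
      moreover have "0 < d * t (N - 1)" using d(1) tN by (rule mult_pos_pos)
      ultimately show "C < d * x" using d(1) by linarith
    qed
    have fx: "\<bar>f x\<bar> < d * x ^ k"
    proof -
      obtain k' where k': "k = Suc k'" using insert(2) False by (cases k) auto
      have "\<bar>f x\<bar> \<le> (\<Sum>j\<in>S. \<bar>\<gamma> j\<bar> * x ^ k')"
        unfolding f_def
      proof (rule sum_abs[THEN order_trans], rule sum_mono)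
        fix j assume "j \<in> S"
        then have "j \<le> k'" using insert(2) k' by auto
        then have "x ^ j \<le> x ^ k'" using x(1) by (intro power_increasing) auto
        then show "\<bar>\<gamma> j * x ^ j\<bar> \<le> \<bar>\<gamma> j\<bar> * x ^ k'" using x(1) by (simp add: abs_mult mult_left_mono)
      qed
      also have "\<dots> = C * x ^ k'" by (simp add: C_def sum_distrib_right)
      also have "\<dots> < d * x * x ^ k'" using x by (intro mult_strict_right_mono) auto
      finally show ?thesis by (simp add: k' mult.assoc)
    qed
    define \<gamma>' where "\<gamma>' = \<gamma>(k := (-1) ^ N * d)"
    define t' where "t' = t(N := x)"
    have sum': "(\<Sum>j\<in>insert k S. \<gamma>' j * y ^ j) = f y + (-1) ^ N * d * y ^ k" for y
    proof -
      have "(\<Sum>j\<in>S. \<gamma>' j * y ^ j) = f y" unfolding f_def using kS by (intro sum.cong) (auto simp: \<gamma>'_def)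
      then show ?thesis using insert(1) kS by (simp add: \<gamma>'_def)
    qed
    have card': "card (insert k S) = Suc N" using insert(1) kS by (simp add: N_def)
    have tx: "t i < x" if "i < N" for i
    proof (cases "i = N - 1")
      case False
      then have "t i < t (N - 1)" using IH(3) that by (simp add: N_def)
      then show ?thesis using x(3) by simp
    qed (use x in simp)
    show ?thesis
    proof (rule exI[of _ \<gamma>'], rule exI[of _ t'], intro conjI ballI allI impI)
      show "\<gamma>' j \<noteq> 0" if "j \<in> insert k S" for j using that IH(1) d(1) by (auto simp: \<gamma>'_def)
      show "0 < t' i" if "i < card (insert k S)" for i
        using that IH(2) x(1) unfolding card' by (auto simp: t'_def N_def less_Suc_eq)
      show "t' i < t' j" if "i < j" "j < card (insert k S)" for i j
        using that IH(3) tx unfolding card' by (auto simp: t'_def N_def less_Suc_eq)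
      show "0 < (-1) ^ i * (\<Sum>j\<in>insert k S. \<gamma>' j * t' i ^ j)" if "i < card (insert k S)" for i
      proof (cases "i = N")
        case True
        have "(-1) ^ N * (f x + (-1) ^ N * d * x ^ k) = (-1) ^ N * f x + d * x ^ k"
          by (simp add: distrib_left flip: mult.assoc power_add)
        moreover have "\<bar>(-1) ^ N * f x\<bar> = \<bar>f x\<bar>" by (simp add: abs_mult power_abs)
        ultimately show ?thesis unfolding sum' using fx True by (simp add: t'_def)
      next
        case False
        then show ?thesis unfolding sum' using d(2)[of i] that unfolding card' by (simp add: t'_def less_Suc_eq)
      qed
    qed
  qed
qed simp

lemma IVT_sign_change:
  fixes f :: "real \<Rightarrow> real"
  assumes "a < b" "continuous_on {a..b} f" "f a * f b < 0"
  obtains x where "a < x" "x < b" "f x = 0"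
proof -
  have "\<exists>x. a \<le> x \<and> x \<le> b \<and> f x = 0"
  proof (cases "f a < 0")
    case True
    then have "0 \<le> f b" using assms(3) by (simp add: mult_less_0_iff)
    then show ?thesis using IVT'[of f a 0 b] True assms by auto
  next
    case False
    then have "0 < f a" "f b \<le> 0" using assms(3) by (auto simp: mult_less_0_iff not_less)
    then show ?thesis using IVT2'[of f b 0 a] assms by auto
  qed
  then obtain x where "a \<le> x" "x \<le> b" "f x = 0" by blast
  moreover from this have "x \<noteq> a" "x \<noteq> b" using assms(3) by auto
  ultimately show ?thesis using that[of x] by simp
qed

lemma alternating_product:
  assumes "0 < (-1) ^ i * x" "0 < (-1) ^ Suc i * y" shows "x * y < (0::real)"
proof -
  have "0 < ((-1) ^ i * x) * ((-1) ^ Suc i * y)" using assms by (rule mult_pos_pos)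
  also have "\<dots> = - (((-1) ^ i * (-1) ^ i) * (x * y))" by simp
  also have "(-1) ^ i * (-1) ^ i = (1::real)" by (simp flip: power_add)
  finally show ?thesis by simp
qed

context perturbation
begin

text \<open>The alternating signs persist for small \<open>e\<close> and give a cycle in every gap
  between the points \<open>t i\<close>. The zero count, applied to the displacement, makes these
  cycles isolated; applied to the limit \<open>f\<close>, it leaves exactly one zero
  \<open>z i\<close> in each gap, to which the radii must converge.\<close>

lemma lower_bound:
  fixes t \<gamma> :: "nat \<Rightarrow> real"
  assumes T: "finite T" "card T = N" "2 \<le> N" "\<And>k. k \<in> T \<Longrightarrow> \<gamma> k \<noteq> 0"
    and mp: "\<And>z. melnikov_poly z = (\<Sum>k\<in>T. of_real (\<gamma> k) * z ^ k)"
    and t: "\<And>i. i < N \<Longrightarrow> 0 < t i" "\<And>i j. i < j \<Longrightarrow> j < N \<Longrightarrow> t i < t j"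
      "\<And>i. i < N \<Longrightarrow> 0 < (-1) ^ i * (\<Sum>k\<in>T. \<gamma> k * t i ^ k)"
  shows "at_least_limit_cycles X (N - 1)"
proof -
  define f where "f r = (\<Sum>k\<in>T. \<gamma> k * r ^ k)" for r
  have mpf: "melnikov_poly (of_real r) = of_real (f r)" for r by (simp add: mp f_def)
  have contf: "continuous_on A f" for A unfolding f_def by (intro continuous_intros)
  \<comment> \<open>The margins \<open>t 0 / 2\<close> on the left and 1 on the right keep the whole
    orbits between \<open>a\<close> and \<open>b\<close> once \<open>\<bar>e\<bar> * C\<close> is
    smaller than both.\<close>
  define a where "a = t 0 / 2"
  define b where "b = t (N - 1) + 1"
  have t0: "0 < t 0" using t(1) T(3) by simp
  have tmono: "t i \<le> t j" if "i \<le> j" "j < N" for i j using t(2)[of i j] that by (cases "i = j") auto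
  have tab: "t 0 \<le> t i" "t i \<le> t (N - 1)" if "i < N" for i using tmono[of 0 i] tmono[of i "N - 1"] that by auto
  have a: "0 < a" and ab: "a \<le> b" using t0 tab(2)[of 0] T(3) by (auto simp: a_def b_def)
  have inab: "x \<in> {a..b}" if "i < N - 1" "t i \<le> x" "x \<le> t (Suc i)" for i x
  proof -
    have "i < N" "Suc i < N" using that(1) by auto
    from tab(1)[OF this(1)] tab(2)[OF this(2)] show ?thesis using that(2,3) t0 by (auto simp: a_def b_def)
  qed
  have Tne: "T \<noteq> {}" using T by auto
  obtain v g C where C: "0 \<le> C" and
      ev: "\<forall>\<^sub>F e in nhds 0.
      (\<forall>t\<in>{0..2 * pi}. \<forall>r\<in>{a..b}. v e t 0 r = r \<and>
         (\<forall>s\<in>{0..2 * pi}. \<bar>v e t s r - r\<bar> \<le> \<bar>e\<bar> * C \<and> 0 < v e t s r) \<and>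
         continuous_on {0..2 * pi} (\<lambda>s. v e t s r) \<and> transit e t (\<lambda>s. v e t s r)) \<and>
      (\<forall>r\<in>{a..b}. \<forall>r'\<in>{a..b}. r < r' \<longrightarrow> v e 0 (2 * pi) r < v e 0 (2 * pi) r') \<and>
      g e holomorphic_on complex_box a b (a / 4) \<and>
      (\<forall>x. of_real x \<in> complex_box a b (a / 4) \<longrightarrow> g e (of_real x) \<in> \<real>) \<and>
      (\<forall>r\<in>{a..b}. g e (of_real r) = of_real ((v e 0 (2 * pi) r - r) / e))"
      and lim: "uniform_limit (complex_box a b (a / 4)) g (\<lambda>z. integral {0..2 * pi} (\<lambda>s. F 0 s z)) (at 0)"
    by (rule radial_flow[OF a ab])
  have hol: "\<forall>\<^sub>F e in nhds 0. g e holomorphic_on complex_box a b (a / 4) \<and>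
       (\<forall>x. of_real x \<in> complex_box a b (a / 4) \<longrightarrow> g e (of_real x) \<in> \<real>)"
    using ev by eventually_elim blast
  have zeros: "\<forall>\<^sub>F e in at 0. finite {r \<in> {a..b}. g e (of_real r) = 0} \<and> card {r \<in> {a..b}. g e (of_real r) = 0} < card T"
    by (rule card_zeros_rescaled[OF a ab _ _ _ _ lim hol]) (use T Tne mp in auto)
  have seg: "compact (complex_of_real ` {a..b})" "complex_of_real ` {a..b} \<subseteq> complex_box a b (a / 4)"
    using a by (auto intro!: compact_continuous_image continuous_intros simp: complex_box_def in_box_complex_iff)
  define q where "q e r = Re (rescaled g e (of_real r))" for e r
  have qf: "\<forall>\<^sub>F e in at 0. \<forall>r\<in>{a..b}. \<bar>q e r - f r\<bar> < \<eta>" if "0 < \<eta>" for \<eta>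
    using uniform_limitD[OF uniform_limit_rescaled[OF a lim seg] that]
  proof eventually_elim
    case (elim e)
    show ?case
    proof
      fix r assume "r \<in> {a..b}"
      then have "norm (rescaled g e (of_real r) - of_real (f r)) < \<eta>" using elim by (auto simp: mpf dist_norm)
      then show "\<bar>q e r - f r\<bar> < \<eta>"
        using abs_Re_le_cmod[of "rescaled g e (of_real r) - of_real (f r)"] by (simp add: q_def)
    qed
  qed
  have zf: "finite {r \<in> {a..b}. f r = 0} \<and> card {r \<in> {a..b}. f r = 0} < N"
  proof -
    \<comment> \<open>The count for convergent families, applied to a constant family, is Descartes'
      rule for \<open>f\<close>.\<close>
    have "\<forall>\<^sub>F e in at (0::real). finite {r \<in> {a..b}. melnikov_poly (of_real r) = 0} \<and> card {r \<in> {a..b}. melnikov_poly (of_real r) = 0} < card T"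
    proof (rule card_zeros_near_sparse_polynomial[where \<Omega>="UNIV" and c=\<gamma> and g="\<lambda>_. melnikov_poly"])
      show "uniform_limit K (\<lambda>_. melnikov_poly) (\<lambda>z. \<Sum>k\<in>T. of_real (\<gamma> k) * z ^ k) (at (0::real))" for K
      proof -
        have "melnikov_poly = (\<lambda>z. \<Sum>k\<in>T. of_real (\<gamma> k) * z ^ k)" by (rule ext) (rule mp)
        then have "uniform_limit K (\<lambda>_. melnikov_poly) (\<lambda>z. \<Sum>k\<in>T. of_real (\<gamma> k) * z ^ k) (at (0::real)) = uniform_limit K (\<lambda>_. melnikov_poly) melnikov_poly (at (0::real))"
          by metis
        then show ?thesis using uniform_limit_const by blast
      qed
      have "melnikov_poly holomorphic_on UNIV" unfolding mp[abs_def] by (intro holomorphic_intros)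
      then show "\<forall>\<^sub>F e in at (0::real). melnikov_poly holomorphic_on UNIV \<and> (\<forall>x. complex_of_real x \<in> UNIV \<longrightarrow> melnikov_poly (of_real x) \<in> \<real>)"
        by (simp add: mpf)
    qed (use a T Tne in auto)
    then show ?thesis by (simp add: mpf T(2))
  qed
  have "\<exists>x. t i < x \<and> x < t (Suc i) \<and> f x = 0" if i: "i < N - 1" for i
  proof -
    have "f (t i) * f (t (Suc i)) < 0"
      by (rule alternating_product[of i]) (use t(3)[of i] t(3)[of "Suc i"] i in \<open>auto simp: f_def\<close>)
    then show ?thesis using IVT_sign_change[of "t i" "t (Suc i)" f] contf t(2)[of i "Suc i"] i by (metis less_diff_conv lessI Suc_eq_plus1)
  qed
  then obtain z where z: "\<And>i. i < N - 1 \<Longrightarrow> t i < z i \<and> z i < t (Suc i) \<and> f (z i) = 0" by metis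
  have disj: "i = j" if "i < N - 1" "j < N - 1" "t i \<le> x" "x \<le> t (Suc i)" "t j < x" "x < t (Suc j)" for i j x
  proof (rule linorder_cases[of i j])
    assume "i < j"
    then have "t (Suc i) \<le> t j" using that by (intro tmono) auto
    then show ?thesis using that by simp
  next
    assume "j < i"
    then have "t (Suc j) \<le> t i" using that by (intro tmono) auto
    then show ?thesis using that by simp
  qed
  \<comment> \<open>The gaps supply \<open>N - 1\<close> distinct zeros of \<open>f\<close>, and
    \<open>f\<close> has no more than that in \<open>{a..b}\<close>.\<close>
  have zuniq: "x = z i" if i: "i < N - 1" and x: "t i \<le> x" "x \<le> t (Suc i)" "f x = 0" for i x
  proof -
    have inj: "inj_on z {..<N - 1}"
    proof (rule inj_onI)
      fix i j assume "i \<in> {..<N - 1}" "j \<in> {..<N - 1}" "z i = z j"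
      then show "i = j" using disj[of i j "z i"] z[of i] z[of j] by simp
    qed
    have sub: "z ` {..<N - 1} \<subseteq> {r \<in> {a..b}. f r = 0}"
      using z inab by (fastforce simp: less_imp_le)
    have "z ` {..<N - 1} = {r \<in> {a..b}. f r = 0}"
    proof (rule card_seteq[OF _ sub])
      show "card {r \<in> {a..b}. f r = 0} \<le> card (z ` {..<N - 1})"
        unfolding card_image[OF inj] card_lessThan using zf by (simp add: less_Suc_eq_le[symmetric])
    qed (use zf in simp)
    moreover have "x \<in> {r \<in> {a..b}. f r = 0}" using inab[OF i x(1,2)] x(3) by simp
    ultimately obtain j where "j < N - 1" "x = z j" by auto
    then show ?thesis using disj[of i j x] z[of j] i x by simp
  qed
  \<comment> \<open>One zero is picked in each gap; for small \<open>e \<noteq> 0\<close> the sign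
    change guarantees that there is one to pick.\<close>
  define \<rho> where "\<rho> i e = (SOME x. t i < x \<and> x < t (Suc i) \<and> q e x = 0)" for i e
  define good where "good e \<longleftrightarrow> e \<noteq> 0 \<and>
      (\<forall>t\<in>{0..2 * pi}. \<forall>r\<in>{a..b}. v e t 0 r = r \<and>
         (\<forall>s\<in>{0..2 * pi}. \<bar>v e t s r - r\<bar> \<le> \<bar>e\<bar> * C \<and> 0 < v e t s r) \<and> transit e t (\<lambda>s. v e t s r)) \<and>
      (\<forall>r\<in>{a..b}. \<forall>r'\<in>{a..b}. r < r' \<longrightarrow> v e 0 (2 * pi) r < v e 0 (2 * pi) r') \<and>
      continuous_on {a..b} (v e 0 (2 * pi)) \<and>
      (\<forall>r\<in>{a..b}. q e r = 0 \<longleftrightarrow> v e 0 (2 * pi) r = r) \<and>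
      finite {r \<in> {a..b}. v e 0 (2 * pi) r = r} \<and>
      (\<forall>i<N - 1. t i < \<rho> i e \<and> \<rho> i e < t (Suc i) \<and> v e 0 (2 * pi) (\<rho> i e) = \<rho> i e) \<and>
      (\<forall>i<N - 1. \<forall>s\<in>{0..2 * pi}. v e 0 s (\<rho> i e) \<in> {a<..<b})" for e
  have sign: "\<forall>\<^sub>F e in at 0. \<forall>i\<in>{..<N}. 0 < (-1) ^ i * q e (t i)"
  proof (rule eventually_ball_finite)
    show "\<forall>i\<in>{..<N}. \<forall>\<^sub>F e in at 0. 0 < (-1) ^ i * q e (t i)"
    proof
      fix i assume "i \<in> {..<N}"
      then have i: "i < N" by simp
      have pos: "0 < (-1) ^ i * f (t i)" using t(3)[OF i] by (simp add: f_def)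
      have tin: "t i \<in> {a..b}" using tab[OF i] t0 by (auto simp: a_def b_def)
      show "\<forall>\<^sub>F e in at 0. 0 < (-1) ^ i * q e (t i)"
        using qf[OF pos]
      proof eventually_elim
        case (elim e)
        have "\<bar>(-1) ^ i * (q e (t i) - f (t i))\<bar> < (-1) ^ i * f (t i)" using elim tin by (simp add: abs_mult power_abs)
        then show ?case by (simp add: right_diff_distrib abs_less_iff)
      qed
    qed
  qed simp
  have smallC: "\<forall>\<^sub>F e in at 0. \<bar>e\<bar> * C < min (t 0 / 2) 1"
  proof -
    have "((\<lambda>e. \<bar>e\<bar> * C) \<longlongrightarrow> \<bar>0\<bar> * C) (at 0)" by (intro tendsto_intros)
    then show ?thesis using t0 by (intro order_tendstoD(2)) auto
  qed
  have good: "\<forall>\<^sub>F e in at 0. good e"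
    using ev[unfolded eventually_nhds_conv_at, THEN conjunct1] zeros sign smallC eventually_neq_at_within[of 0 0 UNIV]
  proof eventually_elim
    case (elim e)
    have e: "e \<noteq> 0" using elim(5) by simp
    have ge: "g e (of_real r) = of_real ((v e 0 (2 * pi) r - r) / e)" if "r \<in> {a..b}" for r
      using elim(1) that by blast
    have geq: "g e (of_real r) = 0 \<longleftrightarrow> v e 0 (2 * pi) r = r" if "r \<in> {a..b}" for r
      unfolding ge[OF that] using e by simp
    have qe: "q e r = - real (2 * n) * r ^ (4 * n - 1) * ((v e 0 (2 * pi) r - r) / e)" if "r \<in> {a..b}" for r
    proof -
      have "rescaled g e (of_real r) = of_real (- real (2 * n) * r ^ (4 * n - 1) * ((v e 0 (2 * pi) r - r) / e))"
        unfolding rescaled_def ge[OF that] by simp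
      then show ?thesis unfolding q_def by (simp only: Re_complex_of_real)
    qed
    have qeq: "q e r = 0 \<longleftrightarrow> v e 0 (2 * pi) r = r" if "r \<in> {a..b}" for r
      unfolding qe[OF that] using e n1 that a by auto
    have contg: "continuous_on {a..b} (\<lambda>r. g e (of_real r))"
    proof (rule continuous_on_compose2[of "complex_box a b (a / 4)" "g e"])
      show "continuous_on (complex_box a b (a / 4)) (g e)"
        using elim(1) by (blast intro: holomorphic_on_imp_continuous_on)
    qed (use seg in \<open>auto intro!: continuous_intros\<close>)
    have contv: "continuous_on {a..b} (v e 0 (2 * pi))"
    proof -
      have "continuous_on {a..b} (\<lambda>r. r + e * Re (g e (of_real r)))"
        by (intro continuous_intros contg)
      moreover have "r + e * Re (g e (of_real r)) = v e 0 (2 * pi) r" if "r \<in> {a..b}" for r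
        unfolding ge[OF that] Re_complex_of_real using e by simp
      ultimately show ?thesis by (subst (asm) continuous_on_cong[OF refl]) auto
    qed
    have contq: "continuous_on {a..b} (q e)"
    proof -
      have "continuous_on {a..b} (\<lambda>r. - real (2 * n) * r ^ (4 * n - 1) * ((v e 0 (2 * pi) r - r) / e))"
        using e by (intro continuous_intros contv) auto
      then show ?thesis by (rule iffD2[OF continuous_on_cong[OF refl qe], rotated])
    qed
    have \<rho>: "t i < \<rho> i e \<and> \<rho> i e < t (Suc i) \<and> q e (\<rho> i e) = 0" if i: "i < N - 1" for i
      unfolding \<rho>_def
    proof (rule someI_ex)
      have "q e (t i) * q e (t (Suc i)) < 0"
        using elim(3)[rule_format, of i] elim(3)[rule_format, of "Suc i"] i
        by (intro alternating_product[of i]) (simp_all add: less_diff_conv)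
      moreover have "t i < t (Suc i)" using t(2)[of i "Suc i"] i by simp
      moreover have "continuous_on {t i..t (Suc i)} (q e)"
        by (rule continuous_on_subset[OF contq]) (use inab[OF i] in auto)
      ultimately show "\<exists>x. t i < x \<and> x < t (Suc i) \<and> q e x = 0" using IVT_sign_change by metis
    qed
    have \<rho>ab: "\<rho> i e \<in> {a..b}" if "i < N - 1" for i using inab[OF that, of "\<rho> i e"] \<rho>[OF that] by simp
    have ann: "v e 0 s (\<rho> i e) \<in> {a<..<b}" if "i < N - 1" "s \<in> {0..2 * pi}" for i s
    proof -
      have "(0::real) \<in> {0..2 * pi}" by simp
      then have "\<bar>v e 0 s (\<rho> i e) - \<rho> i e\<bar> \<le> \<bar>e\<bar> * C" using elim(1) that(2) \<rho>ab[OF that(1)] by blast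
      then have "\<bar>v e 0 s (\<rho> i e) - \<rho> i e\<bar> < t 0 / 2" "\<bar>v e 0 s (\<rho> i e) - \<rho> i e\<bar> < 1" using elim(4) by auto
      moreover have "t 0 < \<rho> i e" "\<rho> i e < t (N - 1)"
        using \<rho>[OF that(1)] tab(1)[of i] tab(2)[of "Suc i"] that(1) by linarith+
      ultimately show ?thesis unfolding greaterThanLessThan_iff a_def b_def by linarith
    qed
    have "{r \<in> {a..b}. g e (of_real r) = 0} = {r \<in> {a..b}. v e 0 (2 * pi) r = r}" using geq by blast
    then have fin: "finite {r \<in> {a..b}. v e 0 (2 * pi) r = r}" using elim(2) by simp
    show ?case unfolding good_def
    proof (intro conjI)
      show "\<forall>t\<in>{0..2 * pi}. \<forall>r\<in>{a..b}. v e t 0 r = r \<and>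
         (\<forall>s\<in>{0..2 * pi}. \<bar>v e t s r - r\<bar> \<le> \<bar>e\<bar> * C \<and> 0 < v e t s r) \<and> transit e t (\<lambda>s. v e t s r)"
        using elim(1) by blast
      show "\<forall>r\<in>{a..b}. \<forall>r'\<in>{a..b}. r < r' \<longrightarrow> v e 0 (2 * pi) r < v e 0 (2 * pi) r'"
        using elim(1) by blast
      show "\<forall>r\<in>{a..b}. q e r = 0 \<longleftrightarrow> v e 0 (2 * pi) r = r" using qeq by blast
      show "\<forall>i<N - 1. t i < \<rho> i e \<and> \<rho> i e < t (Suc i) \<and> v e 0 (2 * pi) (\<rho> i e) = \<rho> i e"
        using \<rho> qeq \<rho>ab by blast
      show "\<forall>i<N - 1. \<forall>s\<in>{0..2 * pi}. v e 0 s (\<rho> i e) \<in> {a<..<b}" using ann by blast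
    qed (use e contv fin in auto)
  qed
  have \<rho>lim: "(\<rho> i \<longlongrightarrow> z i) (at 0)" if i: "i < N - 1" for i
  proof (rule tendstoI)
    fix \<delta> :: real assume \<delta>: "0 < \<delta>"
    \<comment> \<open>On the compact rest of the gap \<open>f\<close> is bounded away from 0, so
      \<open>q e\<close> has no zero there once it is close enough to \<open>f\<close>.\<close>
    define K where "K = {t i..t (Suc i)} - ball (z i) \<delta>"
    have K: "compact K" unfolding K_def by (intro compact_diff) auto
    obtain m where m: "0 < m" "\<And>x. x \<in> K \<Longrightarrow> m \<le> \<bar>f x\<bar>"
    proof (cases "K = {}")
      case False
      obtain x0 where x0: "x0 \<in> K" "\<And>x. x \<in> K \<Longrightarrow> \<bar>f x0\<bar> \<le> \<bar>f x\<bar>"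
        using continuous_attains_inf[OF K False, of "\<lambda>x. \<bar>f x\<bar>"] contf by (auto intro: continuous_intros)
      have "f x0 \<noteq> 0"
      proof
        assume "f x0 = 0"
        then have "x0 = z i" using zuniq[OF i] x0(1) by (simp add: K_def)
        then show False using x0(1) \<delta> by (simp add: K_def)
      qed
      then show ?thesis using that[of "\<bar>f x0\<bar>"] x0(2) by simp
    qed (use that[of 1] in simp)
    show "\<forall>\<^sub>F e in at 0. dist (\<rho> i e) (z i) < \<delta>"
      using good qf[OF m(1)]
    proof eventually_elim
      case (elim e)
      have \<rho>: "t i < \<rho> i e" "\<rho> i e < t (Suc i)" "v e 0 (2 * pi) (\<rho> i e) = \<rho> i e" using elim(1) i by (auto simp: good_def)
      have "\<rho> i e \<in> {a..b}" using inab[OF i, of "\<rho> i e"] \<rho> by simp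
      moreover from this have "q e (\<rho> i e) = 0" using elim(1) \<rho>(3) unfolding good_def by blast
      ultimately have "\<bar>f (\<rho> i e)\<bar> < m" using elim(2) by force
      then have "\<rho> i e \<notin> K" using m(2) by force
      then show ?case using \<rho> by (auto simp: K_def dist_commute)
    qed
  qed
  define \<Gamma> where "\<Gamma> i e = (\<lambda>s. E s (v e 0 s (\<rho> i e))) ` {0..2 * pi}" for i e
  have z0: "(0::real) \<in> {0..2 * pi}" "2 * pi \<in> {0..2 * pi}" by auto
  have lc: "limit_cycle (X e) (\<Gamma> i e)" if e: "good e" and i: "i < N - 1" for e i
  proof -
    have \<rho>: "t i < \<rho> i e" "\<rho> i e < t (Suc i)" "v e 0 (2 * pi) (\<rho> i e) = \<rho> i e" using e i by (auto simp: good_def)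
    have \<rho>ab: "\<rho> i e \<in> {a..b}" using inab[OF i, of "\<rho> i e"] \<rho> by simp
    have "finite {r \<in> {a..b}. v e 0 (2 * pi) r = r}" using e unfolding good_def by blast
    \<comment> \<open>Since the fixed points are finite in number, each of them has an isolation
      radius.\<close>
    then obtain \<epsilon> where \<epsilon>: "0 < \<epsilon>" "\<forall>x\<in>{r \<in> {a..b}. v e 0 (2 * pi) r = r}. x \<noteq> \<rho> i e \<longrightarrow> \<epsilon> \<le> dist (\<rho> i e) x"
      using finite_set_avoid by blast
    show ?thesis unfolding \<Gamma>_def
    proof (rule limit_cycleI[OF a])
      show "r = \<rho> i e" if "r \<in> {a..b}" "\<bar>r - \<rho> i e\<bar> < \<epsilon>" "v e 0 (2 * pi) r = r" for r
        using \<epsilon>(2) that by (force simp: dist_real_def)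
      show "continuous_on {a..b} (v e 0 (2 * pi))" using e unfolding good_def by blast
      show "v e 0 (2 * pi) r < v e 0 (2 * pi) r'" if "r \<in> {a..b}" "r' \<in> {a..b}" "r < r'" for r r'
        using e that unfolding good_def by blast
      show "v e 0 s (\<rho> i e) \<in> {a<..<b}" if "s \<in> {0..2 * pi}" for s
        using e that i unfolding good_def by blast
      show "v e t 0 r = r" "transit e t (\<lambda>s. v e t s r)" if "t \<in> {0..2 * pi}" "r \<in> {a..b}" for t r
        using e that unfolding good_def by blast+
      show "0 < v e t s r" if "t \<in> {0..2 * pi}" "s \<in> {0..2 * pi}" "r \<in> {a..b}" for t s r
        using e that unfolding good_def by blast
    qed (use \<rho>ab \<rho>(3) \<epsilon>(1) in auto)
  qed
  have inj: "inj_on (\<lambda>i. \<Gamma> i e) {..<N - 1}" if e: "good e" for e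
  proof (rule inj_onI)
    fix i j assume ij: "i \<in> {..<N - 1}" "j \<in> {..<N - 1}" and eq: "\<Gamma> i e = \<Gamma> j e"
    have \<rho>: "t i < \<rho> i e \<and> \<rho> i e < t (Suc i) \<and> v e 0 (2 * pi) (\<rho> i e) = \<rho> i e" if "i < N - 1" for i using e that by (auto simp: good_def)
    have \<rho>ab: "\<rho> i e \<in> {a..b}" if "i < N - 1" for i using inab[OF that, of "\<rho> i e"] \<rho>[OF that] by simp
    have v0: "v e 0 0 (\<rho> i e) = \<rho> i e" if "i < N - 1" for i using e z0(1) \<rho>ab[OF that] unfolding good_def by blast
    have "E 0 (\<rho> i e) \<in> \<Gamma> i e" unfolding \<Gamma>_def using v0[of i] ij z0(1) by (intro image_eqI[of _ _ 0]) auto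
    then obtain s where s: "s \<in> {0..2 * pi}" "E 0 (\<rho> i e) = E s (v e 0 s (\<rho> j e))" unfolding eq by (auto simp: \<Gamma>_def)
    have vp: "0 < v e 0 s (\<rho> j e)" using e z0(1) s(1) \<rho>ab[of j] ij unfolding good_def by blast
    have "0 < \<rho> i e" using \<rho>ab[of i] a ij by simp
    then have r: "v e 0 s (\<rho> j e) = \<rho> i e" "\<exists>k::int. s = 0 + 2 * pi * k"
      using E_eq_iff[OF vp, of "\<rho> i e" s 0] s(2) by auto
    then have "s = 0 \<or> s = 2 * pi" using s(1) no_int_multiple[of s] by force
    then have "\<rho> j e = \<rho> i e" using r(1) v0[of j] \<rho>[of j] ij by auto
    then show "i = j" using disj[of i j "\<rho> i e"] \<rho>[of i] \<rho>[of j] ij by simp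
  qed
  have orbit: "periodic_orbit (X 0) ((\<lambda>s. E s (z i)) ` {0..2 * pi}) \<and>
      hausdorff_tendsto (\<Gamma> i) ((\<lambda>s. E s (z i)) ` {0..2 * pi}) (at 0)" if i: "i < N - 1" for i
  proof
    have zab: "z i \<in> {a..b}" using inab[OF i, of "z i"] z[OF i] by simp
    \<comment> \<open>The eventual statement also holds at \<open>e = 0\<close>, where the bound
      \<open>\<bar>e\<bar> * C\<close> forces the radius to be constant.\<close>
    note pk = eventually_nhds_x_imp_x[OF ev, THEN conjunct1]
    have v0: "v 0 0 s (z i) = z i" if "s \<in> {0..2 * pi}" for s
    proof -
      have "\<bar>v 0 0 s (z i) - z i\<bar> \<le> \<bar>0\<bar> * C" using pk z0(1) zab that by blast
      then show ?thesis by simp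
    qed
    have tr: "transit 0 0 (\<lambda>s. v 0 0 s (z i))" using pk z0(1) zab by blast
    have "periodic_orbit (X 0) ((\<lambda>s. E s (v 0 0 s (z i))) ` {0..2 * pi})"
      by (rule closed_transit[OF tr]) (use v0 a zab in auto)
    also have "(\<lambda>s. E s (v 0 0 s (z i))) ` {0..2 * pi} = (\<lambda>s. E s (z i)) ` {0..2 * pi}"
      using v0 by (intro image_cong) auto
    finally show "periodic_orbit (X 0) ((\<lambda>s. E s (z i)) ` {0..2 * pi})" .
    show "hausdorff_tendsto (\<Gamma> i) ((\<lambda>s. E s (z i)) ` {0..2 * pi}) (at 0)"
      unfolding hausdorff_tendsto_def
    proof (intro allI impI)
      fix \<delta> :: real assume \<delta>: "0 < \<delta>"
      \<comment> \<open>Points at equal angles are compared; closeness of the radii becomes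
        closeness in the plane, and this gives both inclusions.\<close>
      have "uniformly_continuous_on ({0..2 * pi} \<times> {a..b}) (\<lambda>p. E (fst p) (snd p))"
        by (intro compact_uniformly_continuous compact_Times continuous_intros) auto
      then obtain m where m: "0 < m" "\<And>p p'. p \<in> {0..2 * pi} \<times> {a..b} \<Longrightarrow> p' \<in> {0..2 * pi} \<times> {a..b} \<Longrightarrow>
          dist p p' < m \<Longrightarrow> dist (E (fst p) (snd p)) (E (fst p') (snd p')) < \<delta>"
        unfolding uniformly_continuous_on_def using \<delta> by metis
      have "((\<lambda>e. \<bar>e\<bar> * C + dist (\<rho> i e) (z i)) \<longlongrightarrow> \<bar>0\<bar> * C + dist (z i) (z i)) (at 0)"
        by (intro tendsto_intros \<rho>lim i)
      then have "\<forall>\<^sub>F e in at 0. \<bar>e\<bar> * C + dist (\<rho> i e) (z i) < m"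
        using m(1) by (intro order_tendstoD(2)) auto
      with good show "\<forall>\<^sub>F e in at 0. \<Gamma> i e \<subseteq> (\<Union>x\<in>(\<lambda>s. E s (z i)) ` {0..2 * pi}. ball x \<delta>) \<and>
          (\<lambda>s. E s (z i)) ` {0..2 * pi} \<subseteq> (\<Union>x\<in>\<Gamma> i e. ball x \<delta>)"
      proof eventually_elim
        case (elim e)
        have \<rho>: "t i < \<rho> i e" "\<rho> i e < t (Suc i)" using elim(1) i by (auto simp: good_def)
        have \<rho>ab: "\<rho> i e \<in> {a..b}" using inab[OF i, of "\<rho> i e"] \<rho> by simp
        have close: "dist (E s (v e 0 s (\<rho> i e))) (E s (z i)) < \<delta>" if s: "s \<in> {0..2 * pi}" for s
        proof -
          have "v e 0 s (\<rho> i e) \<in> {a<..<b}" using elim(1) i s unfolding good_def by blast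
          then have vab: "v e 0 s (\<rho> i e) \<in> {a..b}" by simp
          have "\<bar>v e 0 s (\<rho> i e) - \<rho> i e\<bar> \<le> \<bar>e\<bar> * C" using elim(1) s z0(1) \<rho>ab unfolding good_def by blast
          then have "dist (v e 0 s (\<rho> i e)) (z i) < m"
            using elim(2) dist_triangle[of "v e 0 s (\<rho> i e)" "z i" "\<rho> i e"] by (simp add: dist_real_def)
          then show ?thesis
            using m(2)[of "(s, v e 0 s (\<rho> i e))" "(s, z i)"] s vab zab by (simp add: dist_Pair_Pair)
        qed
        show ?case
        proof
          show "\<Gamma> i e \<subseteq> (\<Union>x\<in>(\<lambda>s. E s (z i)) ` {0..2 * pi}. ball x \<delta>)"
            unfolding \<Gamma>_def using close by (auto simp: dist_commute)
          show "(\<lambda>s. E s (z i)) ` {0..2 * pi} \<subseteq> (\<Union>x\<in>\<Gamma> i e. ball x \<delta>)"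
            unfolding \<Gamma>_def using close by auto
        qed
      qed
    qed
  qed
  obtain e0 where e0: "0 < e0" "\<And>e. e \<noteq> 0 \<Longrightarrow> \<bar>e\<bar> < e0 \<Longrightarrow> good e"
    using good unfolding eventually_at by (auto simp: dist_real_def)
  show ?thesis
    unfolding at_least_limit_cycles_def
  proof (intro exI[of _ e0] exI[of _ \<Gamma>] conjI allI impI)
    fix e :: real assume "0 < \<bar>e\<bar> \<and> \<bar>e\<bar> < e0"
    then have "good e" using e0(2) by simp
    then show "inj_on (\<lambda>i. \<Gamma> i e) {..<N - 1}" "\<And>i. i < N - 1 \<Longrightarrow> limit_cycle (X e) (\<Gamma> i e)"
      using inj lc by auto
  next
    fix i assume "i < N - 1"
    then show "\<exists>\<gamma>. periodic_orbit (X 0) \<gamma> \<and> hausdorff_tendsto (\<Gamma> i) \<gamma> (at 0)" using orbit by blast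
  qed (rule e0(1))
qed

end

context center
begin

text \<open>The pairs stand for the forms \<open>x ^ (2 * a + 1) * y ^ (2 * l) dy\<close> of total
  degree at most \<open>4 * n - 1\<close>, a condition that amounts to
  \<open>a + l < 2 * n\<close>.\<close>

definition low_index :: "(nat \<times> nat) set" where "low_index = (SIGMA l:{..<2 * n}. {..<2 * n - l})"

definition low_exponent :: "nat \<times> nat \<Rightarrow> nat" where "low_exponent = (\<lambda>(l, a). 2 * n + (2 * a + 1) + 2 * n * (2 * l))"

text \<open>Division by the nonzero moments makes the values of \<open>\<gamma>\<close> the
  coefficients of the resulting Melnikov polynomial.\<close>

definition qpoly :: "(nat \<Rightarrow> real) \<Rightarrow> real poly poly" where
  "qpoly \<gamma> = (\<Sum>(l, a)\<in>low_index. monom (monom (\<gamma> (low_exponent (l, a)) / Ib (2 * a + 1) (2 * l)) (2 * a + 1)) (2 * l))"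

lemma finite_low_index: "finite low_index"
  by (simp add: low_index_def)

lemma card_low_index: "card low_index = n * (2 * n + 1)"
proof -
  have "card low_index = (\<Sum>l<2 * n. 2 * n - l)" by (simp add: low_index_def)
  also have "\<dots> = (\<Sum>l<2 * n. Suc l)"
    using sum.nat_diff_reindex[of Suc "2 * n"] by (simp add: Suc_diff_Suc)
  also have "\<dots> = n * (2 * n + 1)" by (induction n) (auto simp: algebra_simps)
  finally show ?thesis .
qed

text \<open>Up to the constant \<open>2 * n + 1\<close> the exponent is
  \<open>2 * a + 4 * n * l\<close> with \<open>2 * a < 4 * n\<close>, so division with remainder
  recovers \<open>l\<close> and \<open>a\<close>.\<close>

lemma inj_low_exponent: "inj_on low_exponent low_index"
proof (rule inj_onI)
  fix x y assume xy: "x \<in> low_index" "y \<in> low_index" "low_exponent x = low_exponent y"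
  obtain l a l' a' where x: "x = (l, a)" "y = (l', a')" by (cases x, cases y) auto
  have a: "2 * a < 4 * n" "2 * a' < 4 * n" using xy x by (auto simp: low_index_def)
  have eq: "2 * a + l * (4 * n) = 2 * a' + l' * (4 * n)" using xy(3) by (simp add: x low_exponent_def algebra_simps)
  have "(2 * a + l * (4 * n)) div (4 * n) = l" "(2 * a' + l' * (4 * n)) div (4 * n) = l'"
    using a n1 by (simp_all add: div_mult_self1)
  then have "l = l'" using eq by simp
  then show "x = y" using eq by (simp add: x)
qed

lemma coeff_qpoly: "coeff (coeff (qpoly \<gamma>) j) i =
    (\<Sum>(l, a)\<in>low_index. if 2 * l = j \<and> 2 * a + 1 = i then \<gamma> (low_exponent (l, a)) / Ib (2 * a + 1) (2 * l) else 0)"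
proof -
  have "coeff (coeff (qpoly \<gamma>) j) i =
      (\<Sum>(l, a)\<in>low_index. coeff (coeff (monom (monom (\<gamma> (low_exponent (l, a)) / Ib (2 * a + 1) (2 * l)) (2 * a + 1)) (2 * l)) j) i)"
    unfolding qpoly_def coeff_sum case_prod_beta by (rule refl)
  also have "\<dots> = (\<Sum>(l, a)\<in>low_index. if 2 * l = j \<and> 2 * a + 1 = i then \<gamma> (low_exponent (l, a)) / Ib (2 * a + 1) (2 * l) else 0)"
    by (intro sum.cong refl) (auto simp: coeff_monom)
  finally show ?thesis .
qed

lemma coeff_qpoly_neq_0:
  assumes "coeff (coeff (qpoly \<gamma>) j) i \<noteq> 0"
  obtains l a where "(l, a) \<in> low_index" "j = 2 * l" "i = 2 * a + 1"
proof -
  obtain x where "x \<in> low_index" "(case x of (l, a) \<Rightarrow> if 2 * l = j \<and> 2 * a + 1 = i then \<gamma> (low_exponent (l, a)) / Ib (2 * a + 1) (2 * l) else 0) \<noteq> 0"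
    using assms unfolding coeff_qpoly by (auto elim: sum.not_neutral_contains_not_neutral)
  then show ?thesis using that by (cases x) (auto split: if_splits)
qed

lemma coeff_qpoly_low_index:
  assumes "(l, a) \<in> low_index"
  shows "coeff (coeff (qpoly \<gamma>) (2 * l)) (2 * a + 1) = \<gamma> (low_exponent (l, a)) / Ib (2 * a + 1) (2 * l)"
proof -
  have "coeff (coeff (qpoly \<gamma>) (2 * l)) (2 * a + 1) =
      (\<Sum>x\<in>low_index. if x = (l, a) then \<gamma> (low_exponent (l, a)) / Ib (2 * a + 1) (2 * l) else 0)"
    unfolding coeff_qpoly by (intro sum.cong refl) (auto split: if_splits)
  then show ?thesis using assms finite_low_index by simp
qed

lemma total_degree_qpoly: "total_degree_le (4 * n - 1) (qpoly \<gamma>)"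
  unfolding total_degree_le_def
proof (intro allI impI)
  fix i j assume "coeff (coeff (qpoly \<gamma>) j) i \<noteq> 0"
  then obtain l a where "(l, a) \<in> low_index" "j = 2 * l" "i = 2 * a + 1" by (rule coeff_qpoly_neq_0)
  then show "i + j \<le> 4 * n - 1" by (auto simp: low_index_def)
qed

end

context perturbation
begin

lemma melnikov_poly_qpoly:
  assumes P: "P 0 = 0" and Q: "Q 0 = qpoly \<gamma>" and d: "4 * n \<le> d"
  shows "melnikov_poly z = (\<Sum>k\<in>low_exponent ` low_index. of_real (\<gamma> k) * z ^ k)"
proof -
  define h where "h = (\<lambda>(j, i). of_real (coeff (coeff (qpoly \<gamma>) j) i * Ib i j) * z ^ (2 * n + i + 2 * n * j))"
  define \<pi> where "\<pi> = (\<lambda>(l, a). (2 * l, 2 * a + 1) :: nat \<times> nat)"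
  have "melnikov_poly z = (\<Sum>x\<in>{..d} \<times> {..d}. h x)"
    unfolding melnikov_poly_def P Q h_def by (simp add: sum.cartesian_product)
  also have "\<dots> = (\<Sum>x\<in>\<pi> ` low_index. h x)"
  proof (rule sum.mono_neutral_right)
    show "\<pi> ` low_index \<subseteq> {..d} \<times> {..d}" using d by (auto simp: \<pi>_def low_index_def)
    show "\<forall>x\<in>{..d} \<times> {..d} - \<pi> ` low_index. h x = 0"
    proof
      fix x assume x: "x \<in> {..d} \<times> {..d} - \<pi> ` low_index"
      obtain j i where ji: "x = (j, i)" by fastforce
      have "coeff (coeff (qpoly \<gamma>) j) i = 0"
      proof (rule ccontr)
        assume "coeff (coeff (qpoly \<gamma>) j) i \<noteq> 0"
        then obtain l a where "(l, a) \<in> low_index" "j = 2 * l" "i = 2 * a + 1" by (rule coeff_qpoly_neq_0)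
        then have "x \<in> \<pi> ` low_index" by (auto simp: ji \<pi>_def intro!: image_eqI[of _ _ "(l, a)"])
        then show False using x by simp
      qed
      then show "h x = 0" by (simp add: h_def ji)
    qed
  qed simp
  also have "\<dots> = (\<Sum>x\<in>low_index. h (\<pi> x))"
    by (rule sum.reindex_cong[of \<pi>]) (auto simp: inj_on_def \<pi>_def)
  also have "\<dots> = (\<Sum>x\<in>low_index. of_real (\<gamma> (low_exponent x)) * z ^ low_exponent x)"
  proof (intro sum.cong refl)
    fix x assume x: "x \<in> low_index"
    obtain l a where la: "x = (l, a)" by fastforce
    have "Ib (2 * a + 1) (2 * l) \<noteq> 0" by (rule Ib_neq_0) auto
    then have "coeff (coeff (qpoly \<gamma>) (2 * l)) (2 * a + 1) * Ib (2 * a + 1) (2 * l) = \<gamma> (low_exponent (l, a))"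
      using coeff_qpoly_low_index x la by simp
    then show "h (\<pi> x) = of_real (\<gamma> (low_exponent x)) * z ^ low_exponent x"
      unfolding la h_def \<pi>_def case_prod_conv by (simp only:) (simp add: low_exponent_def)
  qed
  also have "\<dots> = (\<Sum>k\<in>low_exponent ` low_index. of_real (\<gamma> k) * z ^ k)"
    by (simp add: sum.reindex[OF inj_low_exponent])
  finally show ?thesis .
qed

end

lemma total_degree_le_mono: "total_degree_le d p \<Longrightarrow> d \<le> d' \<Longrightarrow> total_degree_le d' p"
  unfolding total_degree_le_def using order_trans by blast

lemma analytic_poly_family_tendsto:
  assumes "analytic_poly_family P"
  shows "((\<lambda>e. coeff (coeff (P e) j) i) \<longlongrightarrow> coeff (coeff (P 0) j) i) (nhds 0)"
proof -
  obtain F where "(\<lambda>e. coeff (coeff (P e) j) i) has_fps_expansion F"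
    using assms unfolding analytic_poly_family_def by blast
  then have "isCont (\<lambda>e. coeff (coeff (P e) j) i) 0"
    using has_fps_expansion_imp_continuous[of _ F UNIV] by blast
  then show ?thesis
    unfolding isCont_def using tendsto_at_iff_tendsto_nhds_within[of "\<lambda>e. coeff (coeff (P e) j) i" 0 _ UNIV] by simp
qed

lemma admissible_imp_perturbation:
  assumes "n \<ge> 1" "c < - 1 / 4" "admissible_perturbation n P Q"
  obtains d where "4 * n \<le> d" "perturbation n c P Q d"
proof -
  have an: "analytic_poly_family P" "analytic_poly_family Q" using assms(3) by (auto simp: admissible_perturbation_def)
  obtain d1 where d1: "\<forall>\<^sub>F e in nhds 0. total_degree_le d1 (P e)" using an(1) by (auto simp: analytic_poly_family_def)
  obtain d2 where d2: "\<forall>\<^sub>F e in nhds 0. total_degree_le d2 (Q e)" using an(2) by (auto simp: analytic_poly_family_def)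
  \<comment> \<open>The summand \<open>4 * n\<close> makes room for every monomial of
    \<open>qpoly\<close> in the double sums up to \<open>d\<close>.\<close>
  define d where "d = d1 + d2 + 4 * n"
  have "\<forall>\<^sub>F e in nhds 0. total_degree_le d (P e)"
    using d1 by (rule eventually_mono) (erule total_degree_le_mono, simp add: d_def)
  moreover have "\<forall>\<^sub>F e in nhds 0. total_degree_le d (Q e)"
    using d2 by (rule eventually_mono) (erule total_degree_le_mono, simp add: d_def)
  ultimately have "perturbation n c P Q d"
    using assms(1,2) analytic_poly_family_tendsto[OF an(1)] analytic_poly_family_tendsto[OF an(2)]
    by unfold_locales auto
  then show ?thesis using that[of d] by (simp add: d_def)
qed

theorem theorem3:
  fixes n :: nat and c :: real
  assumes "n \<ge> 1" and "c < - 1 / 4"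
  shows
    "(\<forall>P Q. admissible_perturbation n P Q \<and> (\<exists>h>0. melnikov n c (P 0) (Q 0) h \<noteq> 0) \<longrightarrow>
        at_most_limit_cycles (perturbed_field n c P Q) (n * (3 * n + 1) - 1))
     \<and>
     (\<exists>p q. total_degree_le (4 * n - 1) p \<and> total_degree_le (4 * n - 1) q \<and>
        (\<exists>h>0. melnikov n c p q h \<noteq> 0) \<and>
        (\<forall>P Q. admissible_perturbation n P Q \<and> P 0 = p \<and> Q 0 = q \<longrightarrow>
           at_least_limit_cycles (perturbed_field n c P Q) (n * (2 * n + 1) - 1)))"
proof (intro conjI allI impI)
  fix P Q assume PQ: "admissible_perturbation n P Q \<and> (\<exists>h>0. melnikov n c (P 0) (Q 0) h \<noteq> 0)"
  then obtain d where "perturbation n c P Q d" using admissible_imp_perturbation[OF assms] by blast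
  then show "at_most_limit_cycles (perturbed_field n c P Q) (n * (3 * n + 1) - 1)"
    using PQ by (intro perturbation.upper_bound) (auto simp: admissible_perturbation_def)
next
  interpret center n c using assms by unfold_locales
  have ne: "low_exponent ` low_index \<noteq> {}" "finite (low_exponent ` low_index)" and card: "card (low_exponent ` low_index) = n * (2 * n + 1)"
    using card_low_index finite_low_index assms(1) by (auto simp: card_image[OF inj_low_exponent])
  from alternating_sparse_polynomial[OF ne(2,1), unfolded card]
  obtain \<gamma> t :: "nat \<Rightarrow> real" where \<gamma>t: "\<forall>k\<in>low_exponent ` low_index. \<gamma> k \<noteq> 0" "\<forall>i<n * (2 * n + 1). 0 < t i"
      "\<forall>i j. i < j \<longrightarrow> j < n * (2 * n + 1) \<longrightarrow> t i < t j"
      "\<forall>i<n * (2 * n + 1). 0 < (-1) ^ i * (\<Sum>k\<in>low_exponent ` low_index. \<gamma> k * t i ^ k)"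
    by (elim exE conjE) (rule that; assumption)
  note \<gamma> = \<gamma>t(1)[rule_format] \<gamma>t(2)[rule_format] \<gamma>t(3)[rule_format] \<gamma>t(4)[rule_format]
  have N: "2 \<le> n * (2 * n + 1)"
  proof -
    have "1 * (2 * 1 + 1) \<le> n * (2 * n + 1)" using assms(1) by (intro mult_le_mono add_le_mono) auto
    then show ?thesis by simp
  qed
  show "\<exists>p q. total_degree_le (4 * n - 1) p \<and> total_degree_le (4 * n - 1) q \<and>
        (\<exists>h>0. melnikov n c p q h \<noteq> 0) \<and>
        (\<forall>P Q. admissible_perturbation n P Q \<and> P 0 = p \<and> Q 0 = q \<longrightarrow>
           at_least_limit_cycles (perturbed_field n c P Q) (n * (2 * n + 1) - 1))"
  \<comment> \<open>The \<open>dy\<close> part alone realises the alternating polynomial. Only the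
    values at \<open>e = 0\<close> are prescribed; the terms of higher order in \<open>e\<close>
    remain arbitrary.\<close>
  proof (rule exI[of _ 0], rule exI[of _ "qpoly \<gamma>"], intro conjI allI impI)
    show "total_degree_le (4 * n - 1) 0" by (simp add: total_degree_le_def)
    show deg: "total_degree_le (4 * n - 1) (qpoly \<gamma>)" by (rule total_degree_qpoly)
    \<comment> \<open>The constant family serves to evaluate the Melnikov function, which is nonzero
      at the level \<open>t 0 ^ (4 * n)\<close> because the polynomial is positive at
      \<open>t 0\<close>.\<close>
    interpret const: perturbation n c "\<lambda>_. 0" "\<lambda>_. qpoly \<gamma>" "4 * n"
      by unfold_locales (auto simp: total_degree_le_def intro!: total_degree_le_mono[OF deg, unfolded total_degree_le_def, rule_format])
    have t0: "0 < t 0" "(\<Sum>k\<in>low_exponent ` low_index. \<gamma> k * t 0 ^ k) \<noteq> 0" using \<gamma>(2)[of 0] \<gamma>(4)[of 0] assms(1) by auto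
    have "complex_of_real (t 0 ^ (4 * n) * melnikov n c 0 (qpoly \<gamma>) (t 0 ^ (4 * n))) = of_real (\<Sum>k\<in>low_exponent ` low_index. \<gamma> k * t 0 ^ k)"
      using const.melnikov_eq_melnikov_poly[OF t0(1)] const.melnikov_poly_qpoly[of \<gamma> "of_real (t 0)"] by simp
    then have "t 0 ^ (4 * n) * melnikov n c 0 (qpoly \<gamma>) (t 0 ^ (4 * n)) = (\<Sum>k\<in>low_exponent ` low_index. \<gamma> k * t 0 ^ k)"
      by (simp only: of_real_eq_iff)
    then have "melnikov n c 0 (qpoly \<gamma>) (t 0 ^ (4 * n)) \<noteq> 0" using t0(2) by auto
    then show "\<exists>h>0. melnikov n c 0 (qpoly \<gamma>) h \<noteq> 0" using t0(1) by (intro exI[of _ "t 0 ^ (4 * n)"]) auto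
    fix P Q assume PQ: "admissible_perturbation n P Q \<and> P 0 = 0 \<and> Q 0 = qpoly \<gamma>"
    then obtain d where d: "4 * n \<le> d" "perturbation n c P Q d" using admissible_imp_perturbation[OF assms] by blast
    interpret pq: perturbation n c P Q d by (rule d(2))
    show "at_least_limit_cycles (perturbed_field n c P Q) (n * (2 * n + 1) - 1)"
      by (rule pq.lower_bound[OF ne(2) card N \<gamma>(1) pq.melnikov_poly_qpoly[OF _ _ d(1)] \<gamma>(2) \<gamma>(3) \<gamma>(4)]) (use PQ in auto)
  qed
qed

end
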